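(* Let $X_1,X_2,\ldots$ be independent and identically distributed copies of a Gaussian random element $X$ of $\mathbb{H}=L^2([0,1],\mathbb{R})$ with covariance operator $\mathcal{C}$. Assume that $\int_{\mathbb{H}}\|f\|_{\mathbb{H}}^4\,Q(\mathrm{d}f)<\infty$. Then, as $n\to\infty$, $$nT_n\overset{\mathcal{D}}{\to}\|\mathcal{V}\|_Q^2,$$ where $\mathcal{V}$ is a centred Gaussian random element of $L^2_Q$ having covariance kernel $$\mathbb{E}[\mathcal{V}(f)\mathcal{V}(g)]=\exp\left(-\tfrac12(\sigma_f^2+\sigma_g^2)\right)\left\{\exp(\sigma_{f,g})-1-\sigma_{f,g}-\tfrac12\sigma_{f,g}^2\right\},\quad f,g\in\mathbb{H},$$ with $\sigma_{f,g}=\langle\mathcal{C}f,g\rangle$ and $\sigma_f^2=\sigma_{f,f}$.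
   Context: $\mathbb{H}=L^2([0,1],\mathbb{R})$ is the separable Hilbert space of (equivalence classes of) square-integrable real functions on $[0,1]$, with inner product $\langle f,g\rangle=\int_0^1 f(t)g(t)\,\mathrm{d}t$, norm $\|f\|_{\mathbb{H}}=\langle f,f\rangle^{1/2}$, and Borel $\sigma$-algebra. $Q$ is a fixed Borel probability measure on $\mathbb{H}$ that is symmetric, i.e. invariant under the map $x\mapsto -x$. For $m\in\mathbb{H}$ and a positive symmetric trace-class operator $\mathcal{K}$ on $\mathbb{H}$, put $\varphi(f;m,\mathcal{K})=\exp\left(\mathrm{i}\langle m,f\rangle-\frac12\langle\mathcal{K}f,f\rangle\right)$, $f\in\mathbb{H}$. A random element $X$ of $\mathbb{H}$ is Gaussian with expectation $\mu$ and covariance operator $\mathcal{C}$ if its characteristic functional $f\mapsto\mathbb{E}[\exp(\mathrm{i}\langle X,f\rangle)]$ equals $\varphi(\cdot;\mu,\mathcal{C})$, for $\mu\in\mathbb{H}$ and $\mathcal{C}$ positive symmetric trace-class. Given $X_1,\ldots,X_n$, let $\overline{X}_n=\frac1n\sum_{j=1}^n X_j$, let $\mathcal{C}_n$ be the sample covariance operator $\mathcal{C}_nf(s)=\int_0^1 c_n(s,t)f(t)\,\mathrm{d}t$ with $c_n(s,t)=\frac1n\sum_{j=1}^n\{X_j(s)-\overline{X}_n(s)\}\{X_j(t)-\overline{X}_n(t)\}$, let $\varphi_n(f)=\frac1n\sum_{j=1}^n\exp(\mathrm{i}\langle f,X_j\rangle)$, and define $$T_n=\int_{\mathbb{H}}\left|\varphi_n(f)-\varphi(f;\overline{X}_n,\mathcal{C}_n)\right|^2\,Q(\mathrm{d}f).$$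 $L^2_Q$ is the separable Hilbert space of (equivalence classes of) measurable functions $\Upsilon:\mathbb{H}\to\mathbb{R}$ with $\int_{\mathbb{H}}\Upsilon(f)^2\,Q(\mathrm{d}f)<\infty$, with scalar product $\langle\Upsilon,\Phi\rangle_Q=\int_{\mathbb{H}}\Upsilon(f)\Phi(f)\,Q(\mathrm{d}f)$ and norm $\|\cdot\|_Q$. A centred Gaussian random element $\mathcal{V}$ of $L^2_Q$ has covariance kernel $K(f,g)=\mathbb{E}[\mathcal{V}(f)\mathcal{V}(g)]$ in the sense that $\mathbb{E}[\langle\mathcal{V},\Upsilon\rangle_Q\langle\mathcal{V},\Phi\rangle_Q]=\int_{\mathbb{H}}\int_{\mathbb{H}}K(f,g)\Upsilon(f)\Phi(g)\,Q(\mathrm{d}f)\,Q(\mathrm{d}g)$ for all $\Upsilon,\Phi\in L^2_Q$. $\overset{\mathcal{D}}{\to}$ denotes convergence in distribution. *)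

theory Defs
  imports "HOL-Probability.Probability"
begin

section \<open>Square-integrable functions\<close>

text \<open>
  These notions refer to functions rather than to classes modulo almost everywhere equality.
  All of them depend on the class of their arguments only. They are used with the Lebesgue measure
  on the unit interval, where the quotient is formed below as a type, and with the measure \<open>Q\<close>,
  where the quotient would be a type depending on \<open>Q\<close>.
\<close>

definition L2 :: "'a measure \<Rightarrow> ('a \<Rightarrow> real) set" where
  "L2 M = {f \<in> borel_measurable M. integrable M (\<lambda>x. (f x)\<^sup>2)}"

definition inner_L2 :: "'a measure \<Rightarrow> ('a \<Rightarrow> real) \<Rightarrow> ('a \<Rightarrow> real) \<Rightarrow> real" where
  "inner_L2 M f g = (LINT x|M. f x * g x)"

definition norm_L2 :: "'a measure \<Rightarrow> ('a \<Rightarrow> real) \<Rightarrow> real" where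
  "norm_L2 M f = sqrt (inner_L2 M f f)"

text \<open>
  The open sets of the seminorm are unions of classes modulo almost everywhere equality, so this
  \<open>\<sigma>\<close>-algebra is the preimage of the Borel \<open>\<sigma>\<close>-algebra of the quotient space.
\<close>

definition borel_L2 :: "'a measure \<Rightarrow> ('a \<Rightarrow> real) measure" where
  "borel_L2 M = sigma (L2 M)
     {U. U \<subseteq> L2 M \<and> (\<forall>f\<in>U. \<exists>\<epsilon>>0. \<forall>g\<in>L2 M. norm_L2 M (\<lambda>x. g x - f x) < \<epsilon> \<longrightarrow> g \<in> U)}"

lemma L2_mult_integrable:
  assumes "f \<in> L2 M" "g \<in> L2 M"
  shows "integrable M (\<lambda>x. f x * g x)"
proof (rule Bochner_Integration.integrable_bound)
  show "integrable M (\<lambda>x. (f x)\<^sup>2 + (g x)\<^sup>2)"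
    using assms by (simp add: L2_def)
  show "(\<lambda>x. f x * g x) \<in> borel_measurable M"
    using assms by (auto simp: L2_def)
  have "\<bar>a * b\<bar> \<le> a\<^sup>2 + b\<^sup>2" for a b :: real
  proof -
    have "2 * (\<bar>a\<bar> * \<bar>b\<bar>) \<le> a\<^sup>2 + b\<^sup>2"
      using sum_squares_bound[of "\<bar>a\<bar>" "\<bar>b\<bar>"] by simp
    moreover have "0 \<le> \<bar>a\<bar> * \<bar>b\<bar>" by simp
    ultimately show ?thesis unfolding abs_mult by linarith
  qed
  then show "AE x in M. norm (f x * g x) \<le> norm ((f x)\<^sup>2 + (g x)\<^sup>2)"
    by simp
qed

lemma L2_zero: "(\<lambda>x. 0) \<in> L2 M"
  by (simp add: L2_def)

lemma L2_add:
  assumes "f \<in> L2 M" "g \<in> L2 M"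
  shows "(\<lambda>x. f x + g x) \<in> L2 M"
  using assms L2_mult_integrable[OF assms]
  by (auto simp: L2_def power2_sum mult.assoc)

lemma L2_scale: "f \<in> L2 M \<Longrightarrow> (\<lambda>x. c * f x) \<in> L2 M"
  by (auto simp: L2_def power_mult_distrib)

lemma L2_uminus: "f \<in> L2 M \<Longrightarrow> (\<lambda>x. - f x) \<in> L2 M"
  by (simp add: L2_def)

lemma L2_diff:
  assumes "f \<in> L2 M" "g \<in> L2 M"
  shows "(\<lambda>x. f x - g x) \<in> L2 M"
  using L2_add[OF assms(1) L2_uminus[OF assms(2)]] by simp


section \<open>The Hilbert space of square-integrable functions on the unit interval\<close>

abbreviation unit_interval_measure :: "real measure" where
  "unit_interval_measure \<equiv> lebesgue_on {0..1}"

quotient_type l2unit = "real \<Rightarrow> real" / partial: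
  "\<lambda>f g. f \<in> L2 unit_interval_measure \<and> g \<in> L2 unit_interval_measure \<and>
     (AE t in unit_interval_measure. f t = g t)"
proof (rule part_equivpI)
  show "\<exists>f. f \<in> L2 unit_interval_measure \<and> f \<in> L2 unit_interval_measure \<and>
     (AE t in unit_interval_measure. f t = (f t :: real))"
    using L2_zero by auto
qed (auto intro!: sympI transpI)

instantiation l2unit :: real_inner
begin

lift_definition zero_l2unit :: l2unit is "\<lambda>t. 0"
  by (simp add: L2_zero)

lift_definition plus_l2unit :: "l2unit \<Rightarrow> l2unit \<Rightarrow> l2unit" is "\<lambda>f g t. f t + g t"
  by (auto simp: L2_add)

lift_definition minus_l2unit :: "l2unit \<Rightarrow> l2unit \<Rightarrow> l2unit" is "\<lambda>f g t. f t - g t"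
  by (auto simp: L2_diff)

lift_definition uminus_l2unit :: "l2unit \<Rightarrow> l2unit" is "\<lambda>f t. - f t"
  by (auto simp: L2_uminus)

lift_definition scaleR_l2unit :: "real \<Rightarrow> l2unit \<Rightarrow> l2unit" is "\<lambda>c f t. c * f t"
  by (auto simp: L2_scale)

lift_definition inner_l2unit :: "l2unit \<Rightarrow> l2unit \<Rightarrow> real" is "inner_L2 unit_interval_measure"
  unfolding inner_L2_def by (rule integral_cong_AE) (auto simp: L2_def)

definition norm_l2unit :: "l2unit \<Rightarrow> real" where
  "norm_l2unit x = sqrt (inner x x)"

definition dist_l2unit :: "l2unit \<Rightarrow> l2unit \<Rightarrow> real" where
  "dist_l2unit x y = norm (x - y)"

definition sgn_l2unit :: "l2unit \<Rightarrow> l2unit" where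
  "sgn_l2unit x = inverse (norm x) *\<^sub>R x"

definition uniformity_l2unit :: "(l2unit \<times> l2unit) filter" where
  "uniformity_l2unit = (INF e\<in>{0 <..}. principal {(x, y). dist x y < e})"

definition open_l2unit :: "l2unit set \<Rightarrow> bool" where
  "open_l2unit U \<longleftrightarrow> (\<forall>x\<in>U. eventually (\<lambda>(x', y). x' = x \<longrightarrow> y \<in> U) uniformity)"

instance
proof
  fix x y z :: l2unit and a b :: real
  show "x + y + z = x + (y + z)"
    by transfer (auto intro!: L2_add simp: add.assoc)
  show "x + y = y + x"
    by transfer (auto intro!: L2_add simp: add.commute)
  show "0 + x = x"
    by transfer auto
  show "- x + x = 0"
    by transfer (auto simp: L2_zero)
  show "x - y = x + - y"
    by transfer (auto intro!: L2_add L2_diff L2_uminus)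
  show "a *\<^sub>R (x + y) = a *\<^sub>R x + a *\<^sub>R y"
    by transfer (auto intro!: L2_add L2_scale simp: distrib_left)
  show "(a + b) *\<^sub>R x = a *\<^sub>R x + b *\<^sub>R x"
    by transfer (auto intro!: L2_add L2_scale simp: distrib_right)
  show "a *\<^sub>R b *\<^sub>R x = (a * b) *\<^sub>R x"
    by transfer (auto intro!: L2_scale simp: mult.assoc)
  show "1 *\<^sub>R x = x"
    by transfer auto
  show "inner x y = inner y x"
    by transfer (auto simp: inner_L2_def mult.commute)
  show "inner (x + y) z = inner x z + inner y z"
    by transfer (auto simp: inner_L2_def distrib_right L2_mult_integrable)
  show "inner (a *\<^sub>R x) y = a * inner x y"
    by transfer (auto simp: inner_L2_def mult.assoc)
  show "0 \<le> inner x x"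
    by transfer (auto simp: inner_L2_def)
  show "inner x x = 0 \<longleftrightarrow> x = 0"
  proof transfer
    fix f :: "real \<Rightarrow> real"
    assume f: "f \<in> L2 unit_interval_measure \<and> f \<in> L2 unit_interval_measure \<and>
      (AE t in unit_interval_measure. f t = f t)"
    then have "integrable unit_interval_measure (\<lambda>t. f t * f t)"
      by (auto intro: L2_mult_integrable)
    then have "inner_L2 unit_interval_measure f f = 0 \<longleftrightarrow>
        (AE t in unit_interval_measure. f t * f t = 0)"
      unfolding inner_L2_def by (rule integral_nonneg_eq_0_iff_AE) auto
    then show "inner_L2 unit_interval_measure f f = 0 \<longleftrightarrow>
        f \<in> L2 unit_interval_measure \<and> (\<lambda>t. 0) \<in> L2 unit_interval_measure \<and>
        (AE t in unit_interval_measure. f t = 0)"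
      using f L2_zero by auto
  qed
qed (auto simp: norm_l2unit_def dist_l2unit_def sgn_l2unit_def uniformity_l2unit_def
      open_l2unit_def)

end


section \<open>Gaussian random elements of the Hilbert space\<close>

definition orthonormal_basis :: "'a::real_inner set \<Rightarrow> bool" where
  "orthonormal_basis B \<longleftrightarrow> (\<forall>e\<in>B. norm e = 1) \<and> (\<forall>e\<in>B. \<forall>e'\<in>B. e \<noteq> e' \<longrightarrow> inner e e' = 0) \<and>
     (\<forall>x. (\<forall>e\<in>B. inner x e = 0) \<longrightarrow> x = 0)"

text \<open>
  As the operator is positive and symmetric, it is its own absolute value; hence being of trace
  class means that the sum of \<open>inner (C e) e\<close> over an orthonormal basis is finite.
\<close>

definition pos_sym_trace_class :: "('a::real_inner \<Rightarrow> 'a) \<Rightarrow> bool" where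
  "pos_sym_trace_class C \<longleftrightarrow> bounded_linear C \<and>
     (\<forall>f g. inner (C f) g = inner f (C g)) \<and>
     (\<forall>f. 0 \<le> inner (C f) f) \<and>
     (\<forall>B. orthonormal_basis B \<longrightarrow> (\<lambda>e. inner (C e) e) summable_on B)"

definition gauss_char :: "'a::real_inner \<Rightarrow> ('a \<Rightarrow> 'a) \<Rightarrow> 'a \<Rightarrow> complex" where
  "gauss_char m C f = exp (\<i> * of_real (inner m f) - of_real (inner (C f) f) / 2)"

definition gaussian_element :: "'w measure \<Rightarrow> ('w \<Rightarrow> 'a::real_inner) \<Rightarrow> 'a \<Rightarrow> ('a \<Rightarrow> 'a) \<Rightarrow> bool" where
  "gaussian_element M X \<mu> C \<longleftrightarrow> X \<in> borel_measurable M \<and> pos_sym_trace_class C \<and>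
     (\<forall>f. (LINT \<omega>|M. iexp (inner (X \<omega>) f)) = gauss_char \<mu> C f)"


section \<open>The test statistic\<close>

text \<open>
  The sample of size \<open>n\<close> is \<open>x 0, \<dots>, x (n - 1)\<close>. The value of the kernel at a single point
  depends on the chosen representatives, the sample covariance operator does not.
\<close>

definition sample_mean :: "nat \<Rightarrow> (nat \<Rightarrow> 'a::real_vector) \<Rightarrow> 'a" where
  "sample_mean n x = (1 / real n) *\<^sub>R (\<Sum>j<n. x j)"

definition sample_cov_kernel :: "nat \<Rightarrow> (nat \<Rightarrow> l2unit) \<Rightarrow> real \<Rightarrow> real \<Rightarrow> real" where
  "sample_cov_kernel n x s t = (1 / real n) *
     (\<Sum>j<n. (rep_l2unit (x j) s - rep_l2unit (sample_mean n x) s) *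
            (rep_l2unit (x j) t - rep_l2unit (sample_mean n x) t))"

definition sample_cov :: "nat \<Rightarrow> (nat \<Rightarrow> l2unit) \<Rightarrow> l2unit \<Rightarrow> l2unit" where
  "sample_cov n x f =
     abs_l2unit (\<lambda>s. LINT t|unit_interval_measure. sample_cov_kernel n x s t * rep_l2unit f t)"

definition emp_char :: "nat \<Rightarrow> (nat \<Rightarrow> 'a::real_inner) \<Rightarrow> 'a \<Rightarrow> complex" where
  "emp_char n x f = (1 / of_nat n) * (\<Sum>j<n. iexp (inner f (x j)))"

definition T_stat :: "l2unit measure \<Rightarrow> nat \<Rightarrow> (nat \<Rightarrow> l2unit) \<Rightarrow> real" where
  "T_stat Q n x =
     (LINT f|Q. (cmod (emp_char n x f - gauss_char (sample_mean n x) (sample_cov n x) f))\<^sup>2)"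


section \<open>Centred Gaussian random elements of \<open>L2 M\<close>\<close>

definition orthonormal_basis_L2 :: "'a measure \<Rightarrow> ('a \<Rightarrow> real) set \<Rightarrow> bool" where
  "orthonormal_basis_L2 M B \<longleftrightarrow> B \<subseteq> L2 M \<and> (\<forall>e\<in>B. norm_L2 M e = 1) \<and>
     (\<forall>e\<in>B. \<forall>e'\<in>B. e \<noteq> e' \<longrightarrow> inner_L2 M e e' = 0) \<and>
     (\<forall>f\<in>L2 M. (\<forall>e\<in>B. inner_L2 M f e = 0) \<longrightarrow> norm_L2 M f = 0)"

text \<open>
  Linearity and boundedness together imply that the operator respects almost everywhere equality.
\<close>

definition pos_sym_trace_class_L2 :: "'a measure \<Rightarrow> (('a \<Rightarrow> real) \<Rightarrow> 'a \<Rightarrow> real) \<Rightarrow> bool" where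
  "pos_sym_trace_class_L2 M C \<longleftrightarrow>
     (\<forall>f\<in>L2 M. C f \<in> L2 M) \<and>
     (\<forall>f\<in>L2 M. \<forall>g\<in>L2 M. \<forall>a b. AE x in M. C (\<lambda>y. a * f y + b * g y) x = a * C f x + b * C g x) \<and>
     (\<exists>K. \<forall>f\<in>L2 M. norm_L2 M (C f) \<le> K * norm_L2 M f) \<and>
     (\<forall>f\<in>L2 M. \<forall>g\<in>L2 M. inner_L2 M (C f) g = inner_L2 M f (C g)) \<and>
     (\<forall>f\<in>L2 M. 0 \<le> inner_L2 M (C f) f) \<and>
     (\<forall>B. orthonormal_basis_L2 M B \<longrightarrow> (\<lambda>e. inner_L2 M (C e) e) summable_on B)"

definition centred_gaussian_L2 :: "'a measure \<Rightarrow> 'w measure \<Rightarrow> ('w \<Rightarrow> 'a \<Rightarrow> real) \<Rightarrow> bool" where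
  "centred_gaussian_L2 M N V \<longleftrightarrow> V \<in> measurable N (borel_L2 M) \<and>
     (\<exists>C. pos_sym_trace_class_L2 M C \<and>
       (\<forall>f\<in>L2 M. (LINT \<omega>|N. iexp (inner_L2 M (V \<omega>) f)) =
          exp (- of_real (inner_L2 M (C f) f) / 2)))"

definition has_cov_kernel ::
    "'a measure \<Rightarrow> 'w measure \<Rightarrow> ('w \<Rightarrow> 'a \<Rightarrow> real) \<Rightarrow> ('a \<Rightarrow> 'a \<Rightarrow> real) \<Rightarrow> bool" where
  "has_cov_kernel M N V K \<longleftrightarrow> (\<forall>\<Upsilon>\<in>L2 M. \<forall>\<Phi>\<in>L2 M.
     integrable N (\<lambda>\<omega>. inner_L2 M (V \<omega>) \<Upsilon> * inner_L2 M (V \<omega>) \<Phi>) \<and>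
     (LINT \<omega>|N. inner_L2 M (V \<omega>) \<Upsilon> * inner_L2 M (V \<omega>) \<Phi>) =
       (LINT f|M. LINT g|M. K f g * \<Upsilon> f * \<Phi> g))"

definition limit_kernel :: "('a::real_inner \<Rightarrow> 'a) \<Rightarrow> 'a \<Rightarrow> 'a \<Rightarrow> real" where
  "limit_kernel C f g =
     (let \<sigma> = (\<lambda>f g. inner (C f) g)
      in exp (- (\<sigma> f f + \<sigma> g g) / 2) * (exp (\<sigma> f g) - 1 - \<sigma> f g - (\<sigma> f g)\<^sup>2 / 2))"

end

theory Submission
  imports Defs "HOL-Real_Asymp.Real_Asymp"
begin

text \<open>
  Let \<open>h = cos + sin\<close> and let \<open>m\<close> be the sample mean. After removal of a factor of modulus one, the
  real part of the integrand of \<open>T\<^sub>n\<close> is even and its imaginary part odd in \<open>f\<close>; hence symmetry of \<open>Q\<close>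
  gives \<open>n T\<^sub>n = \<integral> V\<^sub>n(f)\<^sup>2 Q(df)\<close> with
  \<open>V\<^sub>n(f) = sqrt n (1/n \<Sum>\<^sub>j h(\<langle>f, X\<^sub>j - m\<rangle>) - exp(- \<langle>C\<^sub>n f, f\<rangle> / 2))\<close>. For fixed \<open>f\<close> only the normal
  variables \<open>\<langle>f, X\<^sub>j\<rangle>\<close> matter, and a Taylor expansion replaces \<open>V\<^sub>n(f)\<close> by a normalised sum \<open>W\<^sub>n(f)\<close> of
  independent centred variables with covariance \<open>limit_kernel\<close>. The mean square error tends to zero
  for each \<open>f\<close> and is at most a multiple of \<open>1 + \<parallel>f\<parallel>\<^sup>4\<close>, so its integral over \<open>Q\<close> vanishes.

  Laplace transforms at the natural numbers determine weak convergence of nonnegative variables.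
  Replacing \<open>f\<close> by a simple function \<open>t\<^sub>m(f)\<close> close to \<open>f\<close> turns \<open>\<integral> W\<^sub>n\<^sup>2 dQ\<close> into a finite quadratic
  form, whose Laplace transform converges by the one-dimensional central limit theorem; the error of
  this replacement depends on the kernel only, not on \<open>n\<close>. The limit \<open>V\<close> is obtained from the same
  discretisation: a Gaussian process on the countable set of all values of the \<open>t\<^sub>m\<close>, evaluated at
  \<open>t\<^sub>m(f)\<close>, converges in \<open>L\<^sup>2\<close> because the kernel is continuous and bounded.
\<close>


section \<open>Separability of the Hilbert space\<close>

text \<open>One real function can replace the complex modulus because, for a centred jointly normal
  pair with variances s, r and covariance c, the product of its values has mean exp(- (s + r) / 2 +
  c): the cosines contribute cosh c, the sines sinh c, the mixed products nothing. The growth in f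
  shapes the estimates. Let s be the variance \<langle>C f, f\<rangle>. Expanding exp(- x / 2) at
  the estimated variance leaves an error for which the rate 1 / n costs a factor s^4, hence the
  eighth power of the norm of f, which Q need not integrate. A second bound is of order s^2 and does
  not tend to zero. The one gives convergence for fixed f, the other the dominating function; this
  is where the fourth moment of Q enters. The passage from fixed f to the norm is a matter of second
  moments: exp(- l x) is Lipschitz for x \<ge> 0, so two random squared norms have close Laplace
  transforms once the processes are close in mean square. That a single discretisation serves all n
  is due to the normalised sums having exactly the limit covariance for every n > 0.\<close>

lemma separable_imp_countable_basis:
  fixes D :: "'a::metric_space set"
  assumes "countable D" and dense: "\<And>x e. 0 < e \<Longrightarrow> \<exists>d\<in>D. dist x d < e"
  shows "\<exists>B::'a set set. countable B \<and> open = generate_topology B"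
proof -
  define B where "B = (\<lambda>(d, n). ball d (1 / real (Suc n))) ` (D \<times> (UNIV::nat set))"
  have B: "topological_basis B"
  proof (rule topological_basisI)
    show "open b" if "b \<in> B" for b
      using that by (auto simp: B_def)
    fix U :: "'a set" and x assume "open U" "x \<in> U"
    then obtain e where e: "0 < e" "ball x e \<subseteq> U"
      by (meson openE)
    then obtain n where n: "1 / real (Suc n) < e / 2"
      by (metis half_gt_zero nat_approx_posE)
    obtain d where d: "d \<in> D" "dist x d < 1 / real (Suc n)"
      using dense[of "1 / real (Suc n)" x] by auto
    have "ball d (1 / real (Suc n)) \<subseteq> ball x e"
    proof
      fix y assume "y \<in> ball d (1 / real (Suc n))"
      then have "dist d y < 1 / real (Suc n)" by simp
      then show "y \<in> ball x e"
        using dist_triangle[of x y d] d n by simp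
    qed
    then show "\<exists>b\<in>B. x \<in> b \<and> b \<subseteq> U"
      using d e by (intro bexI[of _ "ball d (1 / real (Suc n))"]) (auto simp: B_def dist_commute)
  qed
  have "countable B"
    using \<open>countable D\<close> by (auto simp: B_def)
  moreover have "open = generate_topology B"
  proof (intro ext iffI)
    fix U :: "'a set" assume "open U"
    then obtain B' where "B' \<subseteq> B" "U = \<Union>B'"
      using B unfolding topological_basis_def by metis
    then show "generate_topology B U"
      by (auto intro!: generate_topology.UN intro: generate_topology.Basis)
  next
    fix U assume "generate_topology B U"
    then show "open U"
      by induction (use B in \<open>auto simp: topological_basis_def\<close>)
  qed
  ultimately show ?thesis by blast
qed

lemma L2_bounded_by:
  assumes "f \<in> borel_measurable M" "w \<in> L2 M" "\<And>x. x \<in> space M \<Longrightarrow> \<bar>f x\<bar> \<le> w x"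
  shows "f \<in> L2 M"
  unfolding L2_def mem_Collect_eq
proof (intro conjI)
  show "integrable M (\<lambda>x. (f x)\<^sup>2)"
  proof (rule Bochner_Integration.integrable_bound)
    show "integrable M (\<lambda>x. (w x)\<^sup>2)" using assms by (simp add: L2_def)
    show "AE x in M. norm ((f x)\<^sup>2) \<le> norm ((w x)\<^sup>2)"
      using assms(3) by (intro AE_I2) (auto simp flip: abs_le_square_iff intro: order.trans[OF _ abs_ge_self])
  qed (use assms in simp)
qed (rule assms)

lemma norm_abs_l2unit:
  assumes "f \<in> L2 unit_interval_measure"
  shows "norm (abs_l2unit f) = norm_L2 unit_interval_measure f"
  using assms by (simp add: norm_eq_sqrt_inner inner_l2unit.abs_eq norm_L2_def)

text \<open>Dominated convergence carries pointwise limits to limits of classes: the squared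
  differences are bounded by 4 w^2.\<close>

lemma abs_l2unit_tendsto:
  assumes [measurable]: "\<And>n. f n \<in> borel_measurable unit_interval_measure"
    "g \<in> borel_measurable unit_interval_measure"
    and w: "w \<in> L2 unit_interval_measure"
    and fw: "\<And>n x. x \<in> {0..1} \<Longrightarrow> \<bar>f n x\<bar> \<le> w x"
    and lim: "\<And>x. x \<in> {0..1} \<Longrightarrow> (\<lambda>n. f n x) \<longlonglongrightarrow> g x"
  shows "(\<lambda>n. abs_l2unit (f n)) \<longlonglongrightarrow> abs_l2unit g"
proof -
  let ?U = unit_interval_measure
  have gw: "\<bar>g x\<bar> \<le> w x" if "x \<in> {0..1}" for x
    using lim[OF that] fw[OF that] by (intro LIMSEQ_le_const2[OF tendsto_rabs]) auto
  have L: "f n \<in> L2 ?U" "g \<in> L2 ?U" for n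
    using fw gw by (auto intro!: L2_bounded_by[OF _ w])
  have "(\<lambda>n. LINT x|?U. (f n x - g x)\<^sup>2) \<longlonglongrightarrow> (LINT x|?U. 0)"
  proof (rule integral_dominated_convergence)
    show "integrable ?U (\<lambda>x. 4 * (w x)\<^sup>2)" using w by (simp add: L2_def)
    show "AE x in ?U. (\<lambda>n. (f n x - g x)\<^sup>2) \<longlonglongrightarrow> 0"
      using lim by (intro AE_I2) (auto intro!: tendsto_eq_intros)
    show "AE x in ?U. norm ((f n x - g x)\<^sup>2) \<le> 4 * (w x)\<^sup>2" for n
    proof (intro AE_I2)
      fix x assume "x \<in> space ?U"
      then have "\<bar>f n x - g x\<bar> \<le> 2 * w x"
        using fw[of x n] gw[of x] by simp
      then have "(f n x - g x)\<^sup>2 \<le> (2 * w x)\<^sup>2"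
        by (intro abs_le_square_iff[THEN iffD1]) simp
      then show "norm ((f n x - g x)\<^sup>2) \<le> 4 * (w x)\<^sup>2" by (simp add: power_mult_distrib)
    qed
  qed simp_all
  then have "(\<lambda>n. sqrt (LINT x|?U. (f n x - g x)\<^sup>2)) \<longlonglongrightarrow> sqrt 0"
    by (intro tendsto_real_sqrt) simp
  moreover have "sqrt (LINT x|?U. (f n x - g x)\<^sup>2) = norm (abs_l2unit (f n) - abs_l2unit g)" for n
    using L L2_diff[OF L]
    by (simp add: minus_l2unit.abs_eq norm_abs_l2unit norm_L2_def inner_L2_def power2_eq_square)
  ultimately show ?thesis
    by (simp add: LIM_zero_iff tendsto_norm_zero_iff)
qed

text \<open>Lists over a countable type make the countability of the range immediate, and appending
  lists adds step functions. Rational half-lines suffice, since intervals are differences of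
  them.\<close>

definition step_fun :: "(rat \<times> rat) list \<Rightarrow> l2unit" where
  "step_fun l = (\<Sum>(r, q)\<leftarrow>l. of_rat r *\<^sub>R abs_l2unit (indicator {..of_rat q}))"

definition step_closure :: "l2unit set" where
  "step_closure = closure (range step_fun)"

lemma step_closure_lim:
  "(\<And>n. x n \<in> step_closure) \<Longrightarrow> x \<longlonglongrightarrow> y \<Longrightarrow> y \<in> step_closure"
  unfolding step_closure_def by (rule closed_sequentially[OF closed_closure])

lemma step_closure_0: "0 \<in> step_closure"
proof -
  have "step_fun [] = 0" by (simp add: step_fun_def)
  then show ?thesis
    unfolding step_closure_def by (metis closure_subset range_eqI subsetD)
qed

lemma step_closure_add:
  assumes "x \<in> step_closure" "y \<in> step_closure"
  shows "x + y \<in> step_closure"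
proof -
  obtain u v where u: "\<And>n. u n \<in> range step_fun" "u \<longlonglongrightarrow> x"
      and v: "\<And>n. v n \<in> range step_fun" "v \<longlonglongrightarrow> y"
    using assms unfolding step_closure_def closure_sequential by metis
  have "u n + v n \<in> range step_fun" for n
  proof -
    obtain l m where "u n = step_fun l" "v n = step_fun m" using u(1)[of n] v(1)[of n] by blast
    then have "u n + v n = step_fun (l @ m)" by (simp add: step_fun_def)
    then show ?thesis by simp
  qed
  then have "u n + v n \<in> step_closure" for n
    unfolding step_closure_def using closure_subset by blast
  then show ?thesis
    by (rule step_closure_lim) (rule tendsto_add[OF u(2) v(2)])
qed

lemma step_closure_scaleR:
  assumes "x \<in> step_closure"
  shows "c *\<^sub>R x \<in> step_closure"
proof -
  obtain u where u: "\<And>n. u n \<in> range step_fun" "u \<longlonglongrightarrow> x"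
    using assms unfolding step_closure_def closure_sequential by metis
  \<comment> \<open>Only rational scalars act on step functions themselves, so scalar and vector are
    approximated at the same time.\<close>
  have "c \<in> closure \<rat>"
    unfolding closure_approachable dist_real_def
  proof safe
    fix e :: real assume "0 < e"
    then obtain r where "c < of_rat r" "of_rat r < c + e"
      using of_rat_dense[of c "c + e"] by auto
    then show "\<exists>y\<in>\<rat>. \<bar>y - c\<bar> < e"
      by (intro bexI[of _ "of_rat r"]) auto
  qed
  then obtain s where s: "\<And>n. s n \<in> \<rat>" "s \<longlonglongrightarrow> c"
    unfolding closure_sequential by metis
  have "s n *\<^sub>R u n \<in> range step_fun" for n
  proof -
    obtain l where l: "u n = step_fun l" using u(1)[of n] by blast
    obtain r where r: "s n = of_rat r" using s(1)[of n] by (auto elim: Rats_cases)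
    have "s n *\<^sub>R u n = step_fun (map (\<lambda>(a, b). (r * a, b)) l)"
      unfolding l r by (induction l) (auto simp: step_fun_def scaleR_right_distrib of_rat_mult)
    then show ?thesis by simp
  qed
  then have "s n *\<^sub>R u n \<in> step_closure" for n
    unfolding step_closure_def using closure_subset by blast
  then show ?thesis
    by (rule step_closure_lim) (rule tendsto_scaleR[OF s(2) u(2)])
qed

text \<open>Sets of \<open>unit_interval_measure\<close> lie in [0, 1], which half-lines do not; the
  second alternative admits Borel subsets of the whole line.\<close>

lemma indicator_L2: "A \<in> sets unit_interval_measure \<or> A \<in> sets borel \<Longrightarrow>
    (indicator A :: real \<Rightarrow> real) \<in> L2 unit_interval_measure"
proof -
  assume A: "A \<in> sets unit_interval_measure \<or> A \<in> sets borel"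
  have m: "(indicator A :: real \<Rightarrow> real) \<in> borel_measurable unit_interval_measure"
    using A
  proof
    assume "A \<in> sets borel"
    then have "(indicator A :: real \<Rightarrow> real) \<in> borel_measurable borel" by simp
    then show ?thesis
      by (intro measurable_restrict_space1 measurable_completion) simp
  qed (rule borel_measurable_indicator)
  interpret finite_measure unit_interval_measure
    by (rule finite_measureI) (simp add: emeasure_restrict_space)
  have "(\<lambda>x. 1::real) \<in> L2 unit_interval_measure" by (simp add: L2_def)
  then show ?thesis
    by (rule L2_bounded_by[OF m]) (auto split: split_indicator)
qed

text \<open>A Dynkin class argument: half-lines are stable under intersection and generate the Borel
  sets, while the sets with indicator in the closure are stable under complements and disjoint
  countable unions. Limits of sets pass to indicators by dominated convergence, the interval having
  finite measure.\<close>

lemma indicator_borel_step_closure: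
  assumes "A \<in> sets (borel :: real measure)"
  shows "abs_l2unit (indicator A) \<in> step_closure"
proof -
  have one: "(\<lambda>x. 1::real) \<in> L2 unit_interval_measure"
    using indicator_L2[of UNIV] by (simp add: indicator_def[abs_def])
  have lim: "abs_l2unit (indicator B) \<in> step_closure"
    if "\<And>n. abs_l2unit (indicator (F n)) \<in> step_closure" "\<And>n. F n \<in> sets borel" "B \<in> sets borel"
      "\<And>x. eventually (\<lambda>n. x \<in> F n \<longleftrightarrow> x \<in> B) sequentially" for F :: "nat \<Rightarrow> real set" and B
  proof (rule step_closure_lim)
    show "(\<lambda>n. abs_l2unit (indicator (F n))) \<longlonglongrightarrow> abs_l2unit (indicator B)"
    proof (rule abs_l2unit_tendsto[OF _ _ one])
      show "(\<lambda>n. indicator (F n) x) \<longlonglongrightarrow> (indicator B x :: real)" for x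
        using that(4)[of x] by (intro tendsto_eventually) (auto elim!: eventually_mono simp: indicator_def)
    qed (use indicator_L2 that in \<open>auto simp: L2_def split: split_indicator\<close>)
  qed (rule that)
  have rat: "abs_l2unit (indicator {..of_rat q}) \<in> step_closure" for q :: rat
  proof -
    have "step_fun [(1, q)] = abs_l2unit (indicator {..of_rat q})" by (simp add: step_fun_def)
    then show ?thesis unfolding step_closure_def by (metis closure_subset range_eqI subsetD)
  qed
  have atMost: "abs_l2unit (indicator {..a}) \<in> step_closure" for a :: real
  proof -
    \<comment> \<open>The end points approach \<open>a\<close> strictly from the right, because
      \<open>{..a}\<close> is the intersection of the larger half-lines.\<close>
    have "\<exists>q. a < of_rat q \<and> of_rat q < a + 1 / Suc n" for n
      by (rule of_rat_dense) simp
    then obtain q where q: "\<And>n. a < of_rat (q n)" "\<And>n. of_rat (q n) < a + 1 / Suc n"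
      by metis
    have "(\<lambda>n. a + 1 / Suc n) \<longlonglongrightarrow> a + 0"
      by (intro tendsto_intros LIMSEQ_Suc lim_1_over_n)
    then have up: "(\<lambda>n. a + 1 / Suc n) \<longlonglongrightarrow> a" by simp
    have qa: "(\<lambda>n. of_rat (q n)) \<longlonglongrightarrow> a"
      by (rule tendsto_sandwich[OF _ _ tendsto_const up]; rule always_eventually; rule allI)
        (rule less_imp_le, rule q)+
    show ?thesis
    proof (rule lim[OF rat])
      show "\<forall>\<^sub>F n in sequentially. x \<in> {..of_rat (q n)} \<longleftrightarrow> x \<in> {..a}" for x
      proof (cases "x \<le> a")
        case True
        then show ?thesis using q(1) by (intro always_eventually) (auto intro: order.trans less_imp_le)
      next
        case False
        then show ?thesis using order_tendstoD(2)[OF qa, of x] by (auto elim!: eventually_mono)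
      qed
    qed auto
  qed
  have diff: "abs_l2unit (indicator (B - F)) \<in> step_closure"
    if "abs_l2unit (indicator F) \<in> step_closure" "abs_l2unit (indicator B) \<in> step_closure" "F \<in> sets borel"
       "F \<subseteq> B" "B \<in> sets borel" for F B :: "real set"
  proof -
    have eq: "indicator (B - F) = (\<lambda>x. indicator B x - indicator F x :: real)"
      using that(4) by (intro ext) (auto split: split_indicator)
    have "abs_l2unit (indicator (B - F)) = abs_l2unit (indicator B) - abs_l2unit (indicator F)"
      unfolding eq using that indicator_L2[of F] indicator_L2[of B] by (subst minus_l2unit.abs_eq) auto
    then have "abs_l2unit (indicator (B - F)) = abs_l2unit (indicator B) + (-1) *\<^sub>R abs_l2unit (indicator F)"
      by simp
    then show ?thesis using that by (metis step_closure_add step_closure_scaleR)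
  qed
  have disj: "abs_l2unit (indicator (F \<union> B)) \<in> step_closure"
    if "abs_l2unit (indicator F) \<in> step_closure" "abs_l2unit (indicator B) \<in> step_closure" "F \<in> sets borel"
       "F \<inter> B = {}" "B \<in> sets borel" for F B :: "real set"
  proof -
    have "indicator (F \<union> B) = (\<lambda>x. indicator F x + indicator B x :: real)"
      using that(4) by (intro ext) (auto split: split_indicator)
    then have "abs_l2unit (indicator (F \<union> B)) = abs_l2unit (indicator F) + abs_l2unit (indicator B)"
      using that indicator_L2[of F] indicator_L2[of B] by (simp add: plus_l2unit.abs_eq)
    then show ?thesis using that by (metis step_closure_add)
  qed
  have U: "abs_l2unit (indicator UNIV) \<in> step_closure"
  proof (rule lim[of "\<lambda>n. {..real n}"])
    show "\<forall>\<^sub>F n in sequentially. x \<in> {..real n} \<longleftrightarrow> x \<in> UNIV" for x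
    proof -
      obtain m where "x \<le> real m" using real_arch_simple by blast
      then show ?thesis
        by (intro eventually_sequentiallyI[of m]) (metis UNIV_I atMost_iff of_nat_mono order.trans)
    qed
  qed (use atMost in auto)
  let ?G = "range (\<lambda>a::real. {..a})"
  have "Int_stable ?G"
    by (auto simp: Int_stable_def)
  moreover have "?G \<subseteq> Pow UNIV" by simp
  moreover have "A \<in> sigma_sets UNIV ?G"
    using assms by (simp add: borel_eq_atMost)
  ultimately have "A \<in> sets borel \<and> abs_l2unit (indicator A) \<in> step_closure"
  proof (induction rule: sigma_sets_induct_disjoint)
    case (compl F)
    then show ?case using diff[of F UNIV] U by auto
  next
    case (union F)
    \<comment> \<open>A countable union is the limit of finite ones, and these are built by adding
      one disjoint set at a time.\<close>
    have *: "abs_l2unit (indicator (\<Union>i<n. F i)) \<in> step_closure" for n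
    proof (induction n)
      case 0
      have "indicator {} = (\<lambda>x. 0 :: real)" by auto
      then show ?case using step_closure_0 by (simp add: zero_l2unit_def)
    next
      case (Suc n)
      have "(\<Union>i<Suc n. F i) = (\<Union>i<n. F i) \<union> F n" by (auto simp: less_Suc_eq)
      moreover have "(\<Union>i<n. F i) \<inter> F n = {}"
      proof -
        have "F i \<inter> F n = {}" if "i < n" for i
          using disjoint_family_onD[OF union(1), of i n] that by simp
        then show ?thesis by blast
      qed
      moreover have "(\<Union>i<n. F i) \<in> sets borel"
        using union by (intro sets.finite_UN) auto
      ultimately show ?case
        using disj[OF Suc.IH, of "F n"] union by auto
    qed
    have "abs_l2unit (indicator (\<Union>(range F))) \<in> step_closure"
    proof (rule lim[OF *])
      show "\<forall>\<^sub>F n in sequentially. x \<in> (\<Union>i<n. F i) \<longleftrightarrow> x \<in> \<Union>(range F)" for x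
      proof (cases "x \<in> \<Union>(range F)")
        case True
        then obtain i where "x \<in> F i" by auto
        then show ?thesis by (intro eventually_sequentiallyI[of "Suc i"]) auto
      qed auto
    qed (use union in auto)
    then show ?case using union by auto
  next
    case empty
    have "indicator {} = (\<lambda>x. 0 :: real)" by auto
    then show ?case using step_closure_0 by (simp add: zero_l2unit_def)
  qed (use atMost in auto)
  then show ?thesis by simp
qed

text \<open>A Lebesgue set differs from a Borel set by a subset of a null set, so both indicators
  have the same class.\<close>

lemma indicator_step_closure:
  assumes "A \<in> sets unit_interval_measure"
  shows "abs_l2unit (indicator A) \<in> step_closure"
proof -
  have "A \<in> sets (completion lborel)"
    using assms by (auto simp: sets_restrict_space)
  then obtain S N N' where S: "A = S \<union> N" "N \<subseteq> N'" "N' \<in> null_sets lborel" "S \<in> sets lborel"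
    by (rule sets_completionE)
  have "AE t in lebesgue. t \<notin> N'"
    using S(3) by (intro AE_not_in null_sets_completionI)
  then have "AE t in unit_interval_measure. (indicator A t :: real) = indicator S t"
    using S by (subst AE_restrict_space_iff) (auto elim!: eventually_mono split: split_indicator)
  then have "abs_l2unit (indicator A) = abs_l2unit (indicator S)"
    using indicator_L2 S assms by (intro Quotient3_rel_abs[OF Quotient3_l2unit]) auto
  then show ?thesis
    using indicator_borel_step_closure[of S] S by simp
qed

lemma step_closure_UNIV: "step_closure = UNIV"
proof (intro set_eqI iffI UNIV_I)
  let ?U = unit_interval_measure
  fix x :: l2unit
  obtain f where f: "f \<in> L2 ?U" "x = abs_l2unit f"
    using Quotient3_rel_rep[OF Quotient3_l2unit, of x x] Quotient3_abs_rep[OF Quotient3_l2unit, of x] by auto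
  have [measurable]: "f \<in> borel_measurable ?U" using f by (simp add: L2_def)
  \<comment> \<open>With base point 0 the simple functions are bounded by 2 |f|, which is the
    dominating function at the end of the proof.\<close>
  from borel_measurable_implies_sequence_metric[OF this, of 0]
  obtain F where F: "\<And>i. simple_function ?U (F i)" "\<And>t. t \<in> {0..1} \<Longrightarrow> (\<lambda>i. F i t) \<longlonglongrightarrow> f t"
    "\<And>i t. t \<in> {0..1} \<Longrightarrow> \<bar>F i t\<bar> \<le> 2 * \<bar>f t\<bar>"
    by (force simp: dist_real_def)
  have F_in: "abs_l2unit (F i) \<in> step_closure" for i
  proof -
    let ?S = "F i ` space ?U"
    have fin: "finite ?S" using F(1) by (simp add: simple_function_def)
    have sets: "F i -` {y} \<inter> space ?U \<in> sets ?U" for y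
      using F(1)[THEN simple_functionD(2)] by blast
    have main: "(\<lambda>t. \<Sum>y\<in>S. y * indicator (F i -` {y} \<inter> space ?U) t) \<in> L2 ?U \<and>
      abs_l2unit (\<lambda>t. \<Sum>y\<in>S. y * indicator (F i -` {y} \<inter> space ?U) t) \<in> step_closure" if "finite S" for S
      using that
    proof induction
      case empty
      then show ?case using step_closure_0 by (simp add: zero_l2unit_def L2_zero)
    next
      case (insert y S)
      have 1: "(\<lambda>t. y * indicator (F i -` {y} \<inter> space ?U) t) \<in> L2 ?U"
        using indicator_L2 sets by (intro L2_scale) auto
      have 2: "abs_l2unit (\<lambda>t. y * indicator (F i -` {y} \<inter> space ?U) t) =
          y *\<^sub>R abs_l2unit (indicator (F i -` {y} \<inter> space ?U))"
        using indicator_L2 sets by (subst scaleR_l2unit.abs_eq) auto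
      have split: "(\<lambda>t. \<Sum>y\<in>insert y S. y * indicator (F i -` {y} \<inter> space ?U) t) =
        (\<lambda>t. y * indicator (F i -` {y} \<inter> space ?U) t +
          (\<Sum>y\<in>S. y * indicator (F i -` {y} \<inter> space ?U) t))"
        using insert(1,2) by (intro ext) (simp only: sum.insert not_False_eq_True)
      have 3: "abs_l2unit (\<lambda>t. \<Sum>y\<in>insert y S. y * indicator (F i -` {y} \<inter> space ?U) t) =
        y *\<^sub>R abs_l2unit (indicator (F i -` {y} \<inter> space ?U)) +
        abs_l2unit (\<lambda>t. \<Sum>y\<in>S. y * indicator (F i -` {y} \<inter> space ?U) t)"
        unfolding 2[symmetric] split
        by (rule plus_l2unit.abs_eq[symmetric]) (use insert.IH 1 in blast)+
      show ?case
        using L2_add[OF 1, of "\<lambda>t. \<Sum>y\<in>S. y * indicator (F i -` {y} \<inter> space ?U) t"] insert.IH sets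
        unfolding 3 unfolding split
        by (intro conjI step_closure_add step_closure_scaleR indicator_step_closure) blast+
    qed
    have FL: "F i \<in> L2 ?U"
    proof (rule L2_bounded_by)
      show "(\<lambda>t. 2 * \<bar>f t\<bar>) \<in> L2 ?U"
        using f(1) by (intro L2_scale) (auto simp: L2_def)
    qed (use F in \<open>auto intro: borel_measurable_simple_function\<close>)
    have Feq: "F i t = (\<Sum>y\<in>?S. y * indicator (F i -` {y} \<inter> space ?U) t)" if "t \<in> space ?U" for t
    proof -
      have "(\<Sum>y\<in>?S. y * indicator (F i -` {y} \<inter> space ?U) t) = (\<Sum>y\<in>{F i t}. y)"
        using fin that by (intro sum.mono_neutral_cong_right) (auto split: split_indicator)
      then show ?thesis by simp
    qed
    have "AE t in ?U. F i t = (\<Sum>y\<in>?S. y * indicator (F i -` {y} \<inter> space ?U) t)"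
      by (rule AE_I2) (rule Feq)
    then have "abs_l2unit (F i) = abs_l2unit (\<lambda>t. \<Sum>y\<in>?S. y * indicator (F i -` {y} \<inter> space ?U) t)"
      using FL main[OF fin] by (intro Quotient3_rel_abs[OF Quotient3_l2unit] conjI) simp_all
    then show ?thesis using main[OF fin] by simp
  qed
  have "(\<lambda>i. abs_l2unit (F i)) \<longlonglongrightarrow> x"
    unfolding f(2)
  proof (rule abs_l2unit_tendsto)
    show "(\<lambda>t. 2 * \<bar>f t\<bar>) \<in> L2 ?U"
      using f(1) by (intro L2_scale) (auto simp: L2_def)
  qed (use F f in \<open>auto intro: borel_measurable_simple_function simp: L2_def\<close>)
  then show "x \<in> step_closure"
    by (rule step_closure_lim[OF F_in])
qed

text \<open>Second countability makes the Borel sets of a product those generated by rectangles, on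
  which the measurability of differences and inner products of random elements depends.\<close>

instance l2unit :: second_countable_topology
proof
  show "\<exists>B::l2unit set set. countable B \<and> open = generate_topology B"
  proof (rule separable_imp_countable_basis)
    show "countable (range step_fun)" by simp
    show "\<exists>d\<in>range step_fun. dist x d < e" if "0 < e" for x e
      using step_closure_UNIV that unfolding step_closure_def closure_approachable
      by (metis UNIV_I closure_approachable dist_commute)
  qed
qed

section \<open>Normal variables\<close>

definition normal_var :: "'w measure \<Rightarrow> ('w \<Rightarrow> real) \<Rightarrow> real \<Rightarrow> bool" where
  "normal_var M Z s \<longleftrightarrow> Z \<in> borel_measurable M \<and> 0 \<le> s \<and>
     (\<forall>t. (LINT \<omega>|M. iexp (t * Z \<omega>)) = of_real (exp (- (s * t\<^sup>2) / 2)))"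

lemma normal_var_measurable: "normal_var M Z s \<Longrightarrow> Z \<in> borel_measurable M"
  by (simp add: normal_var_def)

context prob_space
begin

text \<open>Levy's uniqueness theorem reduces all moments to those of the standard normal
  distribution, including the degenerate case s = 0.\<close>

lemma normal_var_distr:
  assumes "normal_var M Z s"
  shows "distr M borel Z = distr std_normal_distribution borel (\<lambda>x. sqrt s * x)"
proof (rule Levy_uniqueness)
  have [measurable]: "Z \<in> borel_measurable M" and s: "0 \<le> s"
    and ch: "\<And>t. (LINT \<omega>|M. iexp (t * Z \<omega>)) = of_real (exp (- (s * t\<^sup>2) / 2))"
    using assms by (auto simp: normal_var_def)
  show "real_distribution (distr M borel Z)"
    by (rule real_distribution_distr) simp
  interpret N: real_distribution std_normal_distribution
    by (rule real_dist_normal_dist)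
  show "real_distribution (distr std_normal_distribution borel (\<lambda>x. sqrt s * x))"
    by (rule N.real_distribution_distr) simp
  show "char (distr M borel Z) = char (distr std_normal_distribution borel (\<lambda>x. sqrt s * x))"
  proof
    fix t
    have "char (distr M borel Z) t = of_real (exp (- (s * t\<^sup>2) / 2))"
      unfolding char_def by (subst integral_distr) (simp_all only: ch, simp_all)
    also have "\<dots> = char std_normal_distribution (t * sqrt s)"
      using s by (simp add: char_std_normal_distribution power_mult_distrib mult.commute)
    also have "\<dots> = char (distr std_normal_distribution borel (\<lambda>x. sqrt s * x)) t"
      unfolding char_def by (subst integral_distr) (simp_all add: mult.assoc)
    finally show "char (distr M borel Z) t = char (distr std_normal_distribution borel (\<lambda>x. sqrt s * x)) t" .
  qed
qed

lemma
  assumes Z: "normal_var M Z s"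
  shows normal_var_integrable_power: "integrable M (\<lambda>\<omega>. Z \<omega> ^ k)"
    and normal_var_moment_even: "expectation (\<lambda>\<omega>. Z \<omega> ^ (2 * k)) = fact (2 * k) / (2 ^ k * fact k) * s ^ k"
    and normal_var_moment_odd: "odd k \<Longrightarrow> expectation (\<lambda>\<omega>. Z \<omega> ^ k) = 0"
proof -
  have [measurable]: "Z \<in> borel_measurable M" and s: "0 \<le> s"
    using Z by (auto simp: normal_var_def)
  have int: "integrable std_normal_distribution (\<lambda>x. (sqrt s * x) ^ k)" for k
    using integrable_std_normal_distribution_moment[of k] by (simp add: power_mult_distrib)
  have "integrable (distr M borel Z) (\<lambda>z. z ^ k)" for k
    unfolding normal_var_distr[OF Z] using int[of k] by (subst integrable_distr_eq) simp_all
  then show "integrable M (\<lambda>\<omega>. Z \<omega> ^ k)"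
    by (subst (asm) integrable_distr_eq) simp_all
  have E: "expectation (\<lambda>\<omega>. Z \<omega> ^ k) = sqrt s ^ k * (LINT x|std_normal_distribution. x ^ k)" for k
  proof -
    have "expectation (\<lambda>\<omega>. Z \<omega> ^ k) = (LINT z|distr M borel Z. z ^ k)"
      by (subst integral_distr) simp_all
    also have "\<dots> = (LINT x|std_normal_distribution. (sqrt s * x) ^ k)"
      unfolding normal_var_distr[OF Z] by (subst integral_distr) simp_all
    finally show ?thesis by (simp add: power_mult_distrib)
  qed
  show "expectation (\<lambda>\<omega>. Z \<omega> ^ (2 * k)) = fact (2 * k) / (2 ^ k * fact k) * s ^ k"
    using std_normal_distribution_even_moments(1)[of k] s unfolding E by (simp add: power_mult)
  show "expectation (\<lambda>\<omega>. Z \<omega> ^ k) = 0" if "odd k"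
    using integral_std_normal_distribution_moment_odd[OF that] unfolding E by simp
qed

lemma
  assumes Z: "normal_var M Z s"
  shows normal_var_cos: "expectation (\<lambda>\<omega>. cos (t * Z \<omega>)) = exp (- (s * t\<^sup>2) / 2)"
    and normal_var_sin: "expectation (\<lambda>\<omega>. sin (t * Z \<omega>)) = 0"
proof -
  have [measurable]: "Z \<in> borel_measurable M"
    and ch: "(LINT \<omega>|M. iexp (t * Z \<omega>)) = of_real (exp (- (s * t\<^sup>2) / 2))"
    using Z by (auto simp: normal_var_def)
  have int: "integrable M (\<lambda>\<omega>. iexp (t * Z \<omega>))"
    by (rule integrable_iexp) (simp_all del: of_real_mult)
  have "expectation (\<lambda>\<omega>. Re (iexp (t * Z \<omega>))) = Re (LINT \<omega>|M. iexp (t * Z \<omega>))"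
    by (rule integral_Re[OF int])
  then show "expectation (\<lambda>\<omega>. cos (t * Z \<omega>)) = exp (- (s * t\<^sup>2) / 2)"
    unfolding ch unfolding cis_conv_exp[symmetric] by simp
  have "expectation (\<lambda>\<omega>. Im (iexp (t * Z \<omega>))) = Im (LINT \<omega>|M. iexp (t * Z \<omega>))"
    by (rule integral_Im[OF int])
  then show "expectation (\<lambda>\<omega>. sin (t * Z \<omega>)) = 0"
    unfolding ch unfolding cis_conv_exp[symmetric] by simp
qed

lemma integrable_cos_sin:
  fixes Z :: "'a \<Rightarrow> real"
  assumes [measurable]: "Z \<in> borel_measurable M"
  shows "integrable M (\<lambda>\<omega>. cos (Z \<omega>))" "integrable M (\<lambda>\<omega>. sin (Z \<omega>))"
  by (auto intro!: integrable_const_bound[where B = 1] AE_I2)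

end

section \<open>Mixed moments of a jointly normal pair\<close>

lemma square_diff_quotient_bound:
  fixes y :: real
  shows "\<bar>2 * (1 - cos y)\<bar> \<le> y\<^sup>2"
proof -
  have "1 - cos y = 2 * (sin (y / 2))\<^sup>2"
    using cos_double_sin[of "y / 2"] by simp
  moreover have "(sin (y / 2))\<^sup>2 \<le> (y / 2)\<^sup>2"
    using abs_sin_x_le_abs_x[of "y / 2"] by (simp only: abs_le_square_iff)
  ultimately show ?thesis by (simp add: power_divide)
qed

text \<open>Joint normality in the Cramer-Wold form. The numbers s and r are the variances, and c is
  the covariance by \<open>E_ZW\<close>. Degenerate pairs such as Z = W are included; they yield the
  diagonal of the kernel.\<close>

locale normal_pair = prob_space +
  fixes Z W :: "'a \<Rightarrow> real" and s c r :: real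
  assumes joint: "\<And>\<alpha> \<beta>. normal_var M (\<lambda>\<omega>. \<alpha> * Z \<omega> + \<beta> * W \<omega>) (\<alpha>\<^sup>2 * s + 2 * \<alpha> * \<beta> * c + \<beta>\<^sup>2 * r)"
begin

lemma normal_Z: "normal_var M Z s" and normal_W: "normal_var M W r"
  using joint[of 1 0] joint[of 0 1] by simp_all

lemma measurable_ZW [measurable]: "Z \<in> borel_measurable M" "W \<in> borel_measurable M"
  using normal_Z normal_W by (auto simp: normal_var_def)

lemma swap: "normal_pair M W Z r c s"
proof
  show "normal_var M (\<lambda>\<omega>. \<alpha> * W \<omega> + \<beta> * Z \<omega>) (\<alpha>\<^sup>2 * r + 2 * \<alpha> * \<beta> * c + \<beta>\<^sup>2 * s)" for \<alpha> \<beta>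
    using joint[of \<beta> \<alpha>] by (simp add: algebra_simps)
qed

lemma int_ZW: "integrable M (\<lambda>\<omega>. Z \<omega> ^ i * W \<omega> ^ j)"
proof (rule Bochner_Integration.integrable_bound)
  show "integrable M (\<lambda>\<omega>. Z \<omega> ^ (2 * i) + W \<omega> ^ (2 * j))"
    using normal_var_integrable_power[OF normal_Z] normal_var_integrable_power[OF normal_W] by simp
  have "\<bar>a * b\<bar> \<le> a\<^sup>2 + b\<^sup>2" for a b :: real
    using sum_squares_bound[of "\<bar>a\<bar>" "\<bar>b\<bar>"] abs_ge_zero[of "a * b"] unfolding abs_mult power2_abs
    by linarith
  from this[of "Z _ ^ i" "W _ ^ j"]
  show "AE \<omega> in M. norm (Z \<omega> ^ i * W \<omega> ^ j) \<le> norm (Z \<omega> ^ (2 * i) + W \<omega> ^ (2 * j))"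
    by (intro AE_I2) (auto simp: power_mult power_mult_distrib power2_eq_square simp flip: power_even_abs
      intro: order.trans[OF _ abs_ge_self] simp: mult.commute[of 2] power_mult)
qed simp

text \<open>Polarisation: powers of sums and differences of Z and W have known moments, and
  expanding them isolates the mixed ones, here and in the next two lemmas.\<close>

lemma E_ZW: "expectation (\<lambda>\<omega>. Z \<omega> * W \<omega>) = c"
proof -
  have "expectation (\<lambda>\<omega>. (Z \<omega> + W \<omega>)\<^sup>2) = s + 2 * c + r"
    using normal_var_moment_even[OF joint[of 1 1], of 1] by simp
  moreover have "expectation (\<lambda>\<omega>. (Z \<omega> + W \<omega>)\<^sup>2) = expectation (\<lambda>\<omega>. (Z \<omega>)\<^sup>2 + 2 * (Z \<omega> * W \<omega>) + (W \<omega>)\<^sup>2)"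
    by (intro Bochner_Integration.integral_cong) (auto simp: power2_sum)
  moreover have "\<dots> = s + 2 * expectation (\<lambda>\<omega>. Z \<omega> * W \<omega>) + r"
    using int_ZW[of 1 1] int_ZW[of 2 0] int_ZW[of 0 2]
      normal_var_moment_even[OF normal_Z, of 1] normal_var_moment_even[OF normal_W, of 1] by simp
  ultimately show ?thesis by simp
qed

lemma E_ZWW: "expectation (\<lambda>\<omega>. Z \<omega> * (W \<omega>)\<^sup>2) = 0"
proof -
  have "0 = expectation (\<lambda>\<omega>. (1 * Z \<omega> + 1 * W \<omega>) ^ 3) + expectation (\<lambda>\<omega>. (1 * Z \<omega> + (-1) * W \<omega>) ^ 3)"
    using normal_var_moment_odd[OF joint[of 1 1], of 3] normal_var_moment_odd[OF joint[of 1 "-1"], of 3] by simp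
  also have "\<dots> = expectation (\<lambda>\<omega>. (1 * Z \<omega> + 1 * W \<omega>) ^ 3 + (1 * Z \<omega> + (-1) * W \<omega>) ^ 3)"
    by (intro Bochner_Integration.integral_add[symmetric] normal_var_integrable_power[OF joint])
  also have "\<dots> = expectation (\<lambda>\<omega>. 2 * Z \<omega> ^ 3 + 6 * (Z \<omega> * (W \<omega>)\<^sup>2))"
    by (intro Bochner_Integration.integral_cong) (auto simp: power2_eq_square power3_eq_cube algebra_simps)
  also have "\<dots> = 6 * expectation (\<lambda>\<omega>. Z \<omega> * (W \<omega>)\<^sup>2)"
    using int_ZW[of 1 2] int_ZW[of 3 0] normal_var_moment_odd[OF normal_Z, of 3] by simp
  finally show ?thesis by simp
qed

lemma E_ZZWW: "expectation (\<lambda>\<omega>. (Z \<omega>)\<^sup>2 * (W \<omega>)\<^sup>2) = s * r + 2 * c\<^sup>2"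
proof -
  have f: "fact 4 = (24::real)" by (simp add: fact_numeral)
  \<comment> \<open>The fourth moment of a centred normal variable with variance v is 3 v^2.\<close>
  have "3 * (s + 2 * c + r)\<^sup>2 + 3 * (s - 2 * c + r)\<^sup>2 =
      expectation (\<lambda>\<omega>. (1 * Z \<omega> + 1 * W \<omega>) ^ 4) + expectation (\<lambda>\<omega>. (1 * Z \<omega> + (-1) * W \<omega>) ^ 4)"
    using normal_var_moment_even[OF joint[of 1 1], of 2] normal_var_moment_even[OF joint[of 1 "-1"], of 2]
    by (simp add: f)
  also have "\<dots> = expectation (\<lambda>\<omega>. (1 * Z \<omega> + 1 * W \<omega>) ^ 4 + (1 * Z \<omega> + (-1) * W \<omega>) ^ 4)"
    by (intro Bochner_Integration.integral_add[symmetric] normal_var_integrable_power[OF joint])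
  also have "\<dots> = expectation (\<lambda>\<omega>. 2 * Z \<omega> ^ 4 + 12 * ((Z \<omega>)\<^sup>2 * (W \<omega>)\<^sup>2) + 2 * W \<omega> ^ 4)"
    by (intro Bochner_Integration.integral_cong) (auto simp: power2_eq_square power4_eq_xxxx algebra_simps)
  also have "\<dots> = 6 * s\<^sup>2 + 12 * expectation (\<lambda>\<omega>. (Z \<omega>)\<^sup>2 * (W \<omega>)\<^sup>2) + 6 * r\<^sup>2"
    using int_ZW[of 2 2] int_ZW[of 4 0] int_ZW[of 0 4]
      normal_var_moment_even[OF normal_Z, of 2] normal_var_moment_even[OF normal_W, of 2] by (simp add: f)
  finally show ?thesis by (simp add: power2_eq_square algebra_simps)
qed

text \<open>Product-to-sum formulas reduce everything to cos and sin of the normal variables Z +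
  \<beta> W and Z - \<beta> W. The factor \<beta> is kept free because differences in it at 0
  produce the moments with W and W^2 below.\<close>

lemma E_cos_sin:
  "expectation (\<lambda>\<omega>. sin (Z \<omega>) * sin (\<beta> * W \<omega>)) = exp (- (s + \<beta>\<^sup>2 * r) / 2) * (exp (\<beta> * c) - exp (- (\<beta> * c))) / 2"
  "expectation (\<lambda>\<omega>. cos (Z \<omega>) * cos (\<beta> * W \<omega>)) = exp (- (s + \<beta>\<^sup>2 * r) / 2) * (exp (\<beta> * c) + exp (- (\<beta> * c))) / 2"
  "expectation (\<lambda>\<omega>. cos (Z \<omega>) * sin (\<beta> * W \<omega>)) = 0"
  "expectation (\<lambda>\<omega>. sin (Z \<omega>) * cos (\<beta> * W \<omega>)) = 0"
proof -
  have C: "expectation (\<lambda>\<omega>. cos (Z \<omega> + b * W \<omega>)) = exp (- (s + b\<^sup>2 * r) / 2) * exp (- (b * c))"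
    and S: "expectation (\<lambda>\<omega>. sin (Z \<omega> + b * W \<omega>)) = 0" for b
    using normal_var_cos[OF joint[of 1 b], of 1] normal_var_sin[OF joint[of 1 b], of 1]
    by (simp_all add: exp_add[symmetric] field_simps)
  have int: "integrable M (\<lambda>\<omega>. cos (Z \<omega> + b * W \<omega>))" "integrable M (\<lambda>\<omega>. sin (Z \<omega> + b * W \<omega>))" for b
    by (rule integrable_cos_sin; simp)+
  have "expectation (\<lambda>\<omega>. sin (Z \<omega>) * sin (\<beta> * W \<omega>)) =
      expectation (\<lambda>\<omega>. (cos (Z \<omega> + (- \<beta>) * W \<omega>) - cos (Z \<omega> + \<beta> * W \<omega>)) / 2)"
    by (intro Bochner_Integration.integral_cong) (auto simp: cos_add cos_diff)
  also have "\<dots> = exp (- (s + \<beta>\<^sup>2 * r) / 2) * (exp (\<beta> * c) - exp (- (\<beta> * c))) / 2"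
    using int[of \<beta>] int[of "- \<beta>"] C[of \<beta>] C[of "- \<beta>"] by (simp add: algebra_simps)
  finally show "expectation (\<lambda>\<omega>. sin (Z \<omega>) * sin (\<beta> * W \<omega>)) = exp (- (s + \<beta>\<^sup>2 * r) / 2) * (exp (\<beta> * c) - exp (- (\<beta> * c))) / 2" .
  have "expectation (\<lambda>\<omega>. cos (Z \<omega>) * cos (\<beta> * W \<omega>)) =
      expectation (\<lambda>\<omega>. (cos (Z \<omega> + (- \<beta>) * W \<omega>) + cos (Z \<omega> + \<beta> * W \<omega>)) / 2)"
    by (intro Bochner_Integration.integral_cong) (auto simp: cos_add cos_diff)
  also have "\<dots> = exp (- (s + \<beta>\<^sup>2 * r) / 2) * (exp (\<beta> * c) + exp (- (\<beta> * c))) / 2"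
    using int[of \<beta>] int[of "- \<beta>"] C[of \<beta>] C[of "- \<beta>"] by (simp add: algebra_simps)
  finally show "expectation (\<lambda>\<omega>. cos (Z \<omega>) * cos (\<beta> * W \<omega>)) = exp (- (s + \<beta>\<^sup>2 * r) / 2) * (exp (\<beta> * c) + exp (- (\<beta> * c))) / 2" .
  have "expectation (\<lambda>\<omega>. cos (Z \<omega>) * sin (\<beta> * W \<omega>)) =
      expectation (\<lambda>\<omega>. (sin (Z \<omega> + \<beta> * W \<omega>) - sin (Z \<omega> + (- \<beta>) * W \<omega>)) / 2)"
    by (intro Bochner_Integration.integral_cong) (auto simp: sin_add sin_diff)
  then show "expectation (\<lambda>\<omega>. cos (Z \<omega>) * sin (\<beta> * W \<omega>)) = 0"
    using int[of \<beta>] int[of "- \<beta>"] S[of \<beta>] S[of "- \<beta>"] by simp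
  have "expectation (\<lambda>\<omega>. sin (Z \<omega>) * cos (\<beta> * W \<omega>)) =
      expectation (\<lambda>\<omega>. (sin (Z \<omega> + \<beta> * W \<omega>) + sin (Z \<omega> + (- \<beta>) * W \<omega>)) / 2)"
    by (intro Bochner_Integration.integral_cong) (auto simp: sin_add sin_diff)
  then show "expectation (\<lambda>\<omega>. sin (Z \<omega>) * cos (\<beta> * W \<omega>)) = 0"
    using int[of \<beta>] int[of "- \<beta>"] S[of \<beta>] S[of "- \<beta>"] by simp
qed

text \<open>A difference quotient at \<beta> = 0 with step 1 / (n + 1) of the mean of g sin(\<beta>
  W). For g a sine or cosine of Z the closed forms of \<open>E_cos_sin\<close> then determine the
  mean of g W.\<close>

lemma lim_sin_quotient:
  assumes [measurable]: "g \<in> borel_measurable M" and "\<And>\<omega>. \<bar>g \<omega>\<bar> \<le> 1"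
  shows "(\<lambda>n. expectation (\<lambda>\<omega>. g \<omega> * sin (1 / real (Suc n) * W \<omega>)) * Suc n) \<longlonglongrightarrow> expectation (\<lambda>\<omega>. g \<omega> * W \<omega>)"
proof -
  have "(\<lambda>n. expectation (\<lambda>\<omega>. g \<omega> * (sin (W \<omega> / real (Suc n)) * real (Suc n)))) \<longlonglongrightarrow> expectation (\<lambda>\<omega>. g \<omega> * W \<omega>)"
  proof (rule integral_dominated_convergence)
    show "integrable M (\<lambda>\<omega>. \<bar>W \<omega>\<bar>)" using int_ZW[of 0 1] by simp
    have "(\<lambda>n. sin (x / real (Suc n)) * real (Suc n)) \<longlonglongrightarrow> x" for x :: real
      by real_asymp
    then show "AE \<omega> in M. (\<lambda>n. g \<omega> * (sin (W \<omega> / real (Suc n)) * real (Suc n))) \<longlonglongrightarrow> g \<omega> * W \<omega>"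
      by (intro AE_I2 tendsto_intros)
    show "AE \<omega> in M. norm (g \<omega> * (sin (W \<omega> / real (Suc n)) * real (Suc n))) \<le> \<bar>W \<omega>\<bar>" for n
    proof (intro AE_I2)
      fix \<omega>
      have "\<bar>sin (W \<omega> / real (Suc n))\<bar> * real (Suc n) \<le> \<bar>W \<omega>\<bar>"
        using abs_sin_x_le_abs_x[of "W \<omega> / real (Suc n)"] by (simp add: field_simps)
      then show "norm (g \<omega> * (sin (W \<omega> / real (Suc n)) * real (Suc n))) \<le> \<bar>W \<omega>\<bar>"
        using mult_mono[OF assms(2)[of \<omega>], of "\<bar>sin (W \<omega> / real (Suc n))\<bar> * real (Suc n)" "\<bar>W \<omega>\<bar>"]
        by (simp add: abs_mult)
    qed
  qed simp_all
  then show ?thesis by (simp add: mult.assoc[symmetric] del: of_nat_Suc)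
qed

text \<open>The second-order counterpart: 2 (1 - cos(\<beta> W)) / \<beta>^2 tends to W^2 as \<beta>
  tends to 0, and \<open>square_diff_quotient_bound\<close> dominates it by W^2.\<close>

lemma lim_cos_quotient:
  assumes [measurable]: "g \<in> borel_measurable M" and "\<And>\<omega>. \<bar>g \<omega>\<bar> \<le> 1"
  shows "(\<lambda>n. (expectation g - expectation (\<lambda>\<omega>. g \<omega> * cos (1 / real (Suc n) * W \<omega>))) * (2 * (Suc n)\<^sup>2))
    \<longlonglongrightarrow> expectation (\<lambda>\<omega>. g \<omega> * (W \<omega>)\<^sup>2)"
proof -
  have "(\<lambda>n. expectation (\<lambda>\<omega>. g \<omega> * (2 * (1 - cos (W \<omega> / real (Suc n))) * (real (Suc n))\<^sup>2))) \<longlonglongrightarrow> expectation (\<lambda>\<omega>. g \<omega> * (W \<omega>)\<^sup>2)"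
  proof (rule integral_dominated_convergence)
    show "integrable M (\<lambda>\<omega>. (W \<omega>)\<^sup>2)" using int_ZW[of 0 2] by simp
    have "(\<lambda>n. 2 * (1 - cos (x / real (Suc n))) * (real (Suc n))\<^sup>2) \<longlonglongrightarrow> x * x" for x :: real
      by real_asymp
    then have "(\<lambda>n. 2 * (1 - cos (x / real (Suc n))) * (real (Suc n))\<^sup>2) \<longlonglongrightarrow> x\<^sup>2" for x :: real
      by (simp add: power2_eq_square)
    then show "AE \<omega> in M. (\<lambda>n. g \<omega> * (2 * (1 - cos (W \<omega> / real (Suc n))) * (real (Suc n))\<^sup>2)) \<longlonglongrightarrow> g \<omega> * (W \<omega>)\<^sup>2"
      by (intro AE_I2 tendsto_intros)
    show "AE \<omega> in M. norm (g \<omega> * (2 * (1 - cos (W \<omega> / real (Suc n))) * (real (Suc n))\<^sup>2)) \<le> (W \<omega>)\<^sup>2" for n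
    proof (intro AE_I2)
      fix \<omega>
      have "\<bar>2 * (1 - cos (W \<omega> / real (Suc n)))\<bar> * (real (Suc n))\<^sup>2 \<le> (W \<omega>)\<^sup>2"
        using square_diff_quotient_bound[of "W \<omega> / real (Suc n)"] by (simp add: field_simps)
      then show "norm (g \<omega> * (2 * (1 - cos (W \<omega> / real (Suc n))) * (real (Suc n))\<^sup>2)) \<le> (W \<omega>)\<^sup>2"
        using mult_mono[OF assms(2)[of \<omega>], of "\<bar>2 * (1 - cos (W \<omega> / real (Suc n)))\<bar> * (real (Suc n))\<^sup>2" "(W \<omega>)\<^sup>2"]
        by (simp add: abs_mult)
    qed
  qed simp_all
  moreover have "expectation (\<lambda>\<omega>. g \<omega> * (2 * (1 - cos (W \<omega> / real (Suc n))) * (real (Suc n))\<^sup>2)) =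
    (expectation g - expectation (\<lambda>\<omega>. g \<omega> * cos (1 / real (Suc n) * W \<omega>))) * (2 * (Suc n)\<^sup>2)" for n
  proof -
    have i1: "integrable M g" by (rule integrable_const_bound[of _ 1]) (use assms in auto)
    have i2: "integrable M (\<lambda>\<omega>. g \<omega> * cos (1 / real (Suc n) * W \<omega>))"
    proof (rule integrable_const_bound[of _ 1])
      show "AE \<omega> in M. norm (g \<omega> * cos (1 / real (Suc n) * W \<omega>)) \<le> 1"
        using mult_mono[OF assms(2) abs_cos_le_one] by (intro AE_I2) (auto simp: abs_mult)
    qed simp
    show ?thesis
      unfolding Bochner_Integration.integral_diff[OF i1 i2, symmetric] integral_mult_left_zero[symmetric]
      by (intro Bochner_Integration.integral_cong) (auto simp: algebra_simps)
  qed
  ultimately show ?thesis by simp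
qed

lemma E_trig_W:
  "expectation (\<lambda>\<omega>. sin (Z \<omega>) * W \<omega>) = c * exp (- s / 2)"
  "expectation (\<lambda>\<omega>. cos (Z \<omega>) * W \<omega>) = 0"
  "expectation (\<lambda>\<omega>. sin (Z \<omega>) * (W \<omega>)\<^sup>2) = 0"
  "expectation (\<lambda>\<omega>. cos (Z \<omega>) * (W \<omega>)\<^sup>2) = (r - c\<^sup>2) * exp (- s / 2)"
proof -
  have "(\<lambda>n. exp (- (s + (1 / real (Suc n))\<^sup>2 * r) / 2) * (exp (1 / real (Suc n) * c) - exp (- (1 / real (Suc n) * c))) / 2 * Suc n)
    \<longlonglongrightarrow> c * exp (- s / 2)"
  proof -
    have "(\<lambda>n. (exp (1 / real (Suc n) * c) - exp (- (1 / real (Suc n) * c))) / 2 * Suc n) \<longlonglongrightarrow> c"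
      by real_asymp
    moreover have "(\<lambda>n. exp (- (s + (1 / real (Suc n))\<^sup>2 * r) / 2)) \<longlonglongrightarrow> exp (- s / 2)"
      by real_asymp
    ultimately show ?thesis
      using tendsto_mult by (fastforce simp: ac_simps)
  qed
  with lim_sin_quotient[of "\<lambda>\<omega>. sin (Z \<omega>)"]
  show "expectation (\<lambda>\<omega>. sin (Z \<omega>) * W \<omega>) = c * exp (- s / 2)"
    unfolding E_cos_sin by (intro LIMSEQ_unique) auto
  show "expectation (\<lambda>\<omega>. cos (Z \<omega>) * W \<omega>) = 0"
    using lim_sin_quotient[of "\<lambda>\<omega>. cos (Z \<omega>)"] unfolding E_cos_sin by (simp add: LIMSEQ_const_iff)
  show "expectation (\<lambda>\<omega>. sin (Z \<omega>) * (W \<omega>)\<^sup>2) = 0"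
    using lim_cos_quotient[of "\<lambda>\<omega>. sin (Z \<omega>)"] normal_var_sin[OF normal_Z, of 1]
    unfolding E_cos_sin by (simp add: LIMSEQ_const_iff)
  have Ec: "expectation (\<lambda>\<omega>. cos (Z \<omega>)) = exp (- s / 2)"
    using normal_var_cos[OF normal_Z, of 1] by simp
  have "(\<lambda>n. (exp (- s / 2) - exp (- (s + (1 / real (Suc n))\<^sup>2 * r) / 2) * (exp (1 / real (Suc n) * c) + exp (- (1 / real (Suc n) * c))) / 2)
     * (2 * (Suc n)\<^sup>2)) \<longlonglongrightarrow> (r - c\<^sup>2) * exp (- s / 2)"
  proof -
    \<comment> \<open>The factor exp(- s / 2) is split off first, so that the asymptotic expansion
      involves only r and c.\<close>
    have "(\<lambda>n. (1 - exp (- ((1 / real (Suc n))\<^sup>2 * r) / 2) * (exp (1 / real (Suc n) * c) + exp (- (1 / real (Suc n) * c))) / 2)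
     * (2 * (Suc n)\<^sup>2)) \<longlonglongrightarrow> - ((c * c * 2 - r * 2) / 2)"
      by real_asymp
    moreover have "- ((c * c * 2 - r * 2) / 2) = r - c\<^sup>2"
      by (simp add: field_simps power2_eq_square)
    ultimately have "(\<lambda>n. (1 - exp (- ((1 / real (Suc n))\<^sup>2 * r) / 2) * (exp (1 / real (Suc n) * c) + exp (- (1 / real (Suc n) * c))) / 2)
     * (2 * (Suc n)\<^sup>2)) \<longlonglongrightarrow> r - c\<^sup>2" by simp
    from tendsto_mult[OF this tendsto_const[of "exp (- s / 2)"]]
    show ?thesis
    proof (rule Lim_transform_eventually, intro always_eventually allI)
      fix n
      have e: "exp (- (s + (1 / real (Suc n))\<^sup>2 * r) / 2) = exp (- s / 2) * exp (- ((1 / real (Suc n))\<^sup>2 * r) / 2)"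
        by (simp add: exp_add[symmetric] field_simps)
      show "(1 - exp (- ((1 / real (Suc n))\<^sup>2 * r) / 2) * (exp (1 / real (Suc n) * c) + exp (- (1 / real (Suc n) * c))) / 2)
         * (2 * (Suc n)\<^sup>2) * exp (- s / 2) =
        (exp (- s / 2) - exp (- (s + (1 / real (Suc n))\<^sup>2 * r) / 2) * (exp (1 / real (Suc n) * c) + exp (- (1 / real (Suc n) * c))) / 2)
         * (2 * (Suc n)\<^sup>2)"
        unfolding e by (simp add: algebra_simps)
    qed
  qed
  with lim_cos_quotient[of "\<lambda>\<omega>. cos (Z \<omega>)"]
  show "expectation (\<lambda>\<omega>. cos (Z \<omega>) * (W \<omega>)\<^sup>2) = (r - c\<^sup>2) * exp (- s / 2)"
    unfolding E_cos_sin Ec by (intro LIMSEQ_unique) auto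
qed

end

text \<open>For \<open>z\<close> normal with mean \<open>0\<close> and variance \<open>s\<close> this is \<open>cos z + sin z\<close> without its components in
  the Hermite polynomials of degree at most two, which is why the exponential series of
  \<open>limit_kernel\<close> lacks its first three terms.\<close>

definition psi :: "real \<Rightarrow> real \<Rightarrow> real" where
  "psi s z = cos z + sin z - exp (- s / 2) - z * exp (- s / 2) + exp (- s / 2) / 2 * (z\<^sup>2 - s)"

lemma psi_measurable [measurable]: "psi s \<in> borel_measurable borel"
  unfolding psi_def by measurable

context normal_pair
begin

lemma int_trig_W: "integrable M (\<lambda>\<omega>. cos (Z \<omega>) * W \<omega> ^ k)" "integrable M (\<lambda>\<omega>. sin (Z \<omega>) * W \<omega> ^ k)"
proof -
  have *: "integrable M (\<lambda>\<omega>. \<bar>W \<omega> ^ k\<bar>)" using int_ZW[of 0 k] by simp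
  show "integrable M (\<lambda>\<omega>. cos (Z \<omega>) * W \<omega> ^ k)" "integrable M (\<lambda>\<omega>. sin (Z \<omega>) * W \<omega> ^ k)"
    by (rule Bochner_Integration.integrable_bound[OF *], simp,
        rule AE_I2, simp add: abs_mult mult_left_le_one_le)+
qed

lemma int_trig_trig:
  "integrable M (\<lambda>\<omega>. cos (Z \<omega>) * cos (W \<omega>))" "integrable M (\<lambda>\<omega>. cos (Z \<omega>) * sin (W \<omega>))"
  "integrable M (\<lambda>\<omega>. sin (Z \<omega>) * cos (W \<omega>))" "integrable M (\<lambda>\<omega>. sin (Z \<omega>) * sin (W \<omega>))"
  by (rule integrable_const_bound[of _ 1]; simp add: abs_mult mult_le_one)+

lemma psi_integrable: "integrable M (\<lambda>\<omega>. psi s (Z \<omega>))"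
  unfolding psi_def
  using int_ZW[of 1 0] int_ZW[of 2 0] integrable_cos_sin[OF measurable_ZW(1)]
  by (intro Bochner_Integration.integrable_add Bochner_Integration.integrable_diff integrable_mult_left
     integrable_mult_right integrable_const) auto

lemma E_psi: "expectation (\<lambda>\<omega>. psi s (Z \<omega>)) = 0"
  unfolding psi_def
  using int_ZW[of 1 0] int_ZW[of 2 0] integrable_cos_sin[OF measurable_ZW(1)]
    normal_var_cos[OF normal_Z, of 1] normal_var_sin[OF normal_Z, of 1]
    normal_var_moment_even[OF normal_Z, of 1] normal_var_moment_odd[OF normal_Z, of 1]
  by (simp add: prob_space)

text \<open>The trigonometric parts give exp c; the products with a polynomial factor cancel the
  terms 1, c and c^2 / 2 of its series.\<close>

lemma
  shows psi_psi_integrable: "integrable M (\<lambda>\<omega>. psi s (Z \<omega>) * psi r (W \<omega>))"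
    and E_psi_psi: "expectation (\<lambda>\<omega>. psi s (Z \<omega>) * psi r (W \<omega>)) =
      exp (- (s + r) / 2) * (exp c - 1 - c - c\<^sup>2 / 2)"
proof -
  interpret sw: normal_pair M W Z r c s by (rule swap)
  define e d where "e = exp (- s / 2)" and "d = exp (- r / 2)"
  \<comment> \<open>Both factors are combinations of five basis functions, so the mean is a sum of
    25 known moments. The third coefficient merges the two constant terms of
    \<open>psi\<close>.\<close>
  define z :: "nat \<Rightarrow> 'a \<Rightarrow> real" where
    "z i \<omega> = [cos (Z \<omega>), sin (Z \<omega>), 1, Z \<omega>, (Z \<omega>)\<^sup>2] ! i" for i \<omega>
  define w :: "nat \<Rightarrow> 'a \<Rightarrow> real" where
    "w i \<omega> = [cos (W \<omega>), sin (W \<omega>), 1, W \<omega>, (W \<omega>)\<^sup>2] ! i" for i \<omega>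
  define a where "a = (\<lambda>i. [1, 1, - e - e / 2 * s, - e, e / 2] ! i)"
  define b where "b = (\<lambda>i. [1, 1, - d - d / 2 * r, - d, d / 2] ! i)"
  have five: "{..<5::nat} = {0, 1, 2, 3, 4}" by auto
  have pz: "psi s (Z \<omega>) = (\<Sum>i<5. a i * z i \<omega>)" for \<omega>
    unfolding five psi_def a_def z_def e_def[symmetric] by simp (simp add: field_simps)
  have pw: "psi r (W \<omega>) = (\<Sum>i<5. b i * w i \<omega>)" for \<omega>
    unfolding five psi_def b_def w_def d_def[symmetric] by simp (simp add: field_simps)
  have prod: "psi s (Z \<omega>) * psi r (W \<omega>) = (\<Sum>i<5. \<Sum>j<5. a i * b j * (z i \<omega> * w j \<omega>))" for \<omega>
    unfolding pz pw sum_product by (simp add: ac_simps)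
  have int: "integrable M (\<lambda>\<omega>. z i \<omega> * w j \<omega>)" if "i < 5" "j < 5" for i j
  proof -
    have "i \<in> {0, 1, 2, 3, 4}" "j \<in> {0, 1, 2, 3, 4}" using that unfolding five[symmetric] by simp_all
    moreover have sw_int: "integrable M (\<lambda>\<omega>. Z \<omega> ^ k * cos (W \<omega>))" "integrable M (\<lambda>\<omega>. Z \<omega> ^ k * sin (W \<omega>))" for k
      using sw.int_trig_W[of k] by (simp_all only: mult.commute)
    note I = int_trig_trig int_trig_W[of 0, simplified] int_trig_W[of 1, simplified] int_trig_W[of 2]
      sw_int[of 0, simplified] sw_int[of 1, simplified] sw_int[of 2]
      int_ZW[of 1 0, simplified] int_ZW[of 2 0, simplified] int_ZW[of 0 1, simplified] int_ZW[of 0 2, simplified]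
      int_ZW[of 1 1, simplified] int_ZW[of 1 2, simplified] int_ZW[of 2 1, simplified] int_ZW[of 2 2]
    ultimately show ?thesis
      by (elim insertE emptyE) (simp_all add: z_def w_def I)
  qed
  show "integrable M (\<lambda>\<omega>. psi s (Z \<omega>) * psi r (W \<omega>))"
    unfolding prod by (intro Bochner_Integration.integrable_sum integrable_mult_right int) auto
  have "expectation (\<lambda>\<omega>. psi s (Z \<omega>) * psi r (W \<omega>)) =
      (\<Sum>i<5. \<Sum>j<5. a i * b j * expectation (\<lambda>\<omega>. z i \<omega> * w j \<omega>))"
    unfolding prod using int
    by (subst Bochner_Integration.integral_sum; (intro Bochner_Integration.integrable_sum integrable_mult_right sum.cong refl)?)
       (auto intro!: sum.cong simp: Bochner_Integration.integral_sum)
  also have "\<dots> = e * d * (exp c - 1 - c - c\<^sup>2 / 2)"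
  proof -
    have ez: "expectation (\<lambda>\<omega>. cos (Z \<omega>)) = e" "expectation (\<lambda>\<omega>. sin (Z \<omega>)) = 0"
       "expectation Z = 0" "expectation (\<lambda>\<omega>. (Z \<omega>)\<^sup>2) = s"
      using normal_var_cos[OF normal_Z, of 1] normal_var_sin[OF normal_Z, of 1]
        normal_var_moment_even[OF normal_Z, of 1] normal_var_moment_odd[OF normal_Z, of 1] by (auto simp: e_def)
    have ew: "expectation (\<lambda>\<omega>. cos (W \<omega>)) = d" "expectation (\<lambda>\<omega>. sin (W \<omega>)) = 0"
       "expectation W = 0" "expectation (\<lambda>\<omega>. (W \<omega>)\<^sup>2) = r"
      using normal_var_cos[OF normal_W, of 1] normal_var_sin[OF normal_W, of 1]
        normal_var_moment_even[OF normal_W, of 1] normal_var_moment_odd[OF normal_W, of 1] by (auto simp: d_def)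
    have ed: "exp (- (s + r) / 2) = e * d"
      by (simp add: e_def d_def exp_add[symmetric] field_simps)
    have tt: "expectation (\<lambda>\<omega>. sin (Z \<omega>) * sin (W \<omega>)) = e * d * (exp c - exp (- c)) / 2"
      "expectation (\<lambda>\<omega>. cos (Z \<omega>) * cos (W \<omega>)) = e * d * (exp c + exp (- c)) / 2"
      "expectation (\<lambda>\<omega>. cos (Z \<omega>) * sin (W \<omega>)) = 0"
      "expectation (\<lambda>\<omega>. sin (Z \<omega>) * cos (W \<omega>)) = 0"
      using E_cos_sin[of 1] ed by auto
    have sw': "expectation (\<lambda>\<omega>. Z \<omega> * sin (W \<omega>)) = c * d"
      "expectation (\<lambda>\<omega>. Z \<omega> * cos (W \<omega>)) = 0"
      "expectation (\<lambda>\<omega>. (Z \<omega>)\<^sup>2 * sin (W \<omega>)) = 0"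
      "expectation (\<lambda>\<omega>. (Z \<omega>)\<^sup>2 * cos (W \<omega>)) = (s - c\<^sup>2) * d"
      "expectation (\<lambda>\<omega>. (Z \<omega>)\<^sup>2 * W \<omega>) = 0"
      using sw.E_trig_W sw.E_ZWW by (simp_all add: mult.commute d_def)
    have tw: "expectation (\<lambda>\<omega>. sin (Z \<omega>) * W \<omega>) = c * e"
      "expectation (\<lambda>\<omega>. cos (Z \<omega>) * W \<omega>) = 0"
      "expectation (\<lambda>\<omega>. sin (Z \<omega>) * (W \<omega>)\<^sup>2) = 0"
      "expectation (\<lambda>\<omega>. cos (Z \<omega>) * (W \<omega>)\<^sup>2) = (r - c\<^sup>2) * e"
      using E_trig_W by (simp_all add: e_def)
    show ?thesis
      unfolding five z_def w_def a_def b_def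
      by (simp add: ez ew tt sw' tw E_ZW E_ZWW E_ZZWW prob_space)
         (simp add: field_simps power2_eq_square)
  qed
  finally show "expectation (\<lambda>\<omega>. psi s (Z \<omega>) * psi r (W \<omega>)) = exp (- (s + r) / 2) * (exp c - 1 - c - c\<^sup>2 / 2)"
    by (simp add: e_def d_def exp_add[symmetric] field_simps)
qed

end

section \<open>Weak convergence from Laplace transforms\<close>

text \<open>On the compact interval [0, 1] polynomials are uniformly dense in the continuous
  functions, so power moments control the integrals of all bounded continuous functions.\<close>

lemma weak_conv_m_if_power_moments:
  fixes U :: "nat \<Rightarrow> 'w \<Rightarrow> real" and V :: "'v \<Rightarrow> real"
  assumes M: "prob_space M" and N: "prob_space N"
    and U [measurable]: "\<And>n. U n \<in> borel_measurable M" and V [measurable]: "V \<in> borel_measurable N"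
    and U01: "\<And>n \<omega>. U n \<omega> \<in> {0..1}" and V01: "\<And>\<omega>. V \<omega> \<in> {0..1}"
    and lim: "\<And>k. (\<lambda>n. LINT \<omega>|M. U n \<omega> ^ k) \<longlonglongrightarrow> (LINT \<omega>|N. V \<omega> ^ k)"
  shows "weak_conv_m (\<lambda>n. distr M borel (U n)) (distr N borel V)"
proof -
  interpret M: prob_space M by (rule M)
  interpret N: prob_space N by (rule N)
  show ?thesis
  proof (rule integral_bdd_continuous_conv_imp_weak_conv)
    show "real_distribution (distr M borel (U n))" for n
      by (rule M.real_distribution_distr) simp
    show "real_distribution (distr N borel V)"
      by (rule N.real_distribution_distr) simp
    fix h :: "real \<Rightarrow> real"
    assume cont: "\<And>x. isCont h x" and bdd: "\<And>x. \<bar>h x\<bar> \<le> 1"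
    have cont': "continuous_on UNIV h"
      using cont by (simp add: continuous_at_imp_continuous_on)
    then have [measurable]: "h \<in> borel_measurable borel"
      by (rule borel_measurable_continuous_onI)
    have "(\<lambda>n. LINT \<omega>|M. h (U n \<omega>)) \<longlonglongrightarrow> (LINT \<omega>|N. h (V \<omega>))"
    proof (rule LIMSEQ_I)
      fix e :: real assume e: "0 < e"
      have "continuous_on {0..1} h"
        using cont' continuous_on_subset by blast
      \<comment> \<open>Two thirds of \<open>e\<close> pay for replacing h by p on either side, the
        last third for the convergence of the integrals of p.\<close>
      then obtain p where p: "real_polynomial_function p" "\<And>x. x \<in> {0..1} \<Longrightarrow> \<bar>h x - p x\<bar> < e / 3"
        using Stone_Weierstrass_real_polynomial_function[of "{0..1::real}" h "e / 3"] e by auto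
      obtain a m where pa: "p = (\<lambda>x. \<Sum>i\<le>(m::nat). a i * x ^ i)"
        using real_polynomial_function_imp_sum[OF p(1)] by blast
      have [measurable]: "p \<in> borel_measurable borel"
        unfolding pa by measurable
      have intU: "integrable M (\<lambda>\<omega>. U n \<omega> ^ i)" for n i
        using U01 by (intro M.integrable_const_bound[where B = 1]) (auto simp: power_le_one)
      have intV: "integrable N (\<lambda>\<omega>. V \<omega> ^ i)" for i
        using V01 by (intro N.integrable_const_bound[where B = 1]) (auto simp: power_le_one)
      have "(\<lambda>n. LINT \<omega>|M. p (U n \<omega>)) \<longlonglongrightarrow> (LINT \<omega>|N. p (V \<omega>))"
        unfolding pa using intU intV
        by (auto simp: Bochner_Integration.integral_sum intro!: tendsto_intros lim)
      then obtain n0 where n0: "\<And>n. n \<ge> n0 \<Longrightarrow> \<bar>(LINT \<omega>|M. p (U n \<omega>)) - (LINT \<omega>|N. p (V \<omega>))\<bar> < e / 3"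
        using LIMSEQ_D[of "\<lambda>n. LINT \<omega>|M. p (U n \<omega>)" "LINT \<omega>|N. p (V \<omega>)" "e / 3"] e
        unfolding real_norm_def by (metis divide_pos_pos zero_less_numeral)
      have dU: "\<bar>(LINT \<omega>|M. h (U n \<omega>)) - (LINT \<omega>|M. p (U n \<omega>))\<bar> \<le> e / 3" for n
      proof -
        have ih: "integrable M (\<lambda>\<omega>. h (U n \<omega>))"
          using bdd by (intro M.integrable_const_bound[where B = 1]) auto
        have ip: "integrable M (\<lambda>\<omega>. p (U n \<omega>))"
          unfolding pa using intU by auto
        have "\<bar>LINT \<omega>|M. (h (U n \<omega>) - p (U n \<omega>))\<bar> \<le> (LINT \<omega>|M. \<bar>h (U n \<omega>) - p (U n \<omega>)\<bar>)"
          by (rule integral_abs_bound)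
        also have "\<dots> \<le> (LINT \<omega>|M. e / 3)"
          using ih ip p(2) U01 by (intro integral_mono) (auto intro: less_imp_le)
        finally show ?thesis using ih ip by (simp add: M.prob_space)
      qed
      have dV: "\<bar>(LINT \<omega>|N. h (V \<omega>)) - (LINT \<omega>|N. p (V \<omega>))\<bar> \<le> e / 3"
      proof -
        have ih: "integrable N (\<lambda>\<omega>. h (V \<omega>))"
          using bdd by (intro N.integrable_const_bound[where B = 1]) auto
        have ip: "integrable N (\<lambda>\<omega>. p (V \<omega>))"
          unfolding pa using intV by auto
        have "\<bar>LINT \<omega>|N. (h (V \<omega>) - p (V \<omega>))\<bar> \<le> (LINT \<omega>|N. \<bar>h (V \<omega>) - p (V \<omega>)\<bar>)"
          by (rule integral_abs_bound)
        also have "\<dots> \<le> (LINT \<omega>|N. e / 3)"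
          using ih ip p(2) V01 by (intro integral_mono) (auto intro: less_imp_le)
        finally show ?thesis using ih ip by (simp add: N.prob_space)
      qed
      show "\<exists>n0. \<forall>n\<ge>n0. norm ((LINT \<omega>|M. h (U n \<omega>)) - (LINT \<omega>|N. h (V \<omega>))) < e"
      proof (intro exI[of _ n0] allI impI)
        fix n assume "n0 \<le> n"
        from n0[OF this] dU[of n] dV
        show "norm ((LINT \<omega>|M. h (U n \<omega>)) - (LINT \<omega>|N. h (V \<omega>))) < e"
          unfolding real_norm_def by linarith
      qed
    qed
    then show "(\<lambda>n. integral\<^sup>L (distr M borel (U n)) h) \<longlonglongrightarrow> integral\<^sup>L (distr N borel V) h"
      by (simp add: integral_distr)
  qed
qed

text \<open>The substitution u = exp(- y) maps the half-line into (0, 1] and turns the Laplace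
  transform at k into the k-th power moment.\<close>

lemma weak_conv_m_if_laplace:
  fixes Y :: "nat \<Rightarrow> 'w \<Rightarrow> real" and Z :: "'v \<Rightarrow> real"
  assumes M: "prob_space M" and N: "prob_space N"
    and Y [measurable]: "\<And>n. Y n \<in> borel_measurable M" and Z [measurable]: "Z \<in> borel_measurable N"
    and Y0: "\<And>n \<omega>. 0 \<le> Y n \<omega>" and Z0: "\<And>\<omega>. 0 \<le> Z \<omega>"
    and lim: "\<And>k::nat. (\<lambda>n. LINT \<omega>|M. exp (- (real k * Y n \<omega>))) \<longlonglongrightarrow> (LINT \<omega>|N. exp (- (real k * Z \<omega>)))"
  shows "weak_conv_m (\<lambda>n. distr M borel (Y n)) (distr N borel Z)"
proof -
  interpret M: prob_space M by (rule M)
  interpret N: prob_space N by (rule N)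
  have wU: "weak_conv_m (\<lambda>n. distr M borel (\<lambda>\<omega>. exp (- Y n \<omega>))) (distr N borel (\<lambda>\<omega>. exp (- Z \<omega>)))"
    using Y0 Z0 lim by (intro weak_conv_m_if_power_moments M N) (auto simp: exp_of_nat_mult[symmetric])
  show ?thesis
  proof (rule integral_bdd_continuous_conv_imp_weak_conv)
    show "real_distribution (distr M borel (Y n))" for n
      by (rule M.real_distribution_distr) simp
    show "real_distribution (distr N borel Z)"
      by (rule N.real_distribution_distr) simp
    fix h :: "real \<Rightarrow> real"
    assume cont: "\<And>x. isCont h x" and bdd: "\<And>x. \<bar>h x\<bar> \<le> 1"
    have cont': "continuous_on UNIV h"
      using cont by (simp add: continuous_at_imp_continuous_on)
    then have [measurable]: "h \<in> borel_measurable borel"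
      by (rule borel_measurable_continuous_onI)
    \<comment> \<open>The pull-back of h along - ln. It can be discontinuous only at 0, the image of
      y = infinity, and exp(- Z) never takes this value.\<close>
    define f where "f u = (if 0 < u then h (- ln u) else 0)" for u :: real
    have [measurable]: "f \<in> borel_measurable borel"
      unfolding f_def by measurable
    have isC: "isCont f u" if "u \<noteq> 0" for u
    proof (cases "0 < u")
      case True
      have "isCont (\<lambda>u. h (- ln u)) u"
        using True by (intro isCont_o2[OF _ cont] continuous_intros) auto
      moreover have "\<forall>\<^sub>F x in nhds u. f x = h (- ln x)"
        using eventually_nhds_in_open[of "{0<..}" u] True by (auto elim!: eventually_mono simp: f_def)
      ultimately show ?thesis using isCont_cong by fastforce
    next
      case False
      have "\<forall>\<^sub>F x in nhds u. f x = 0"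
        using eventually_nhds_in_open[of "{..<0}" u] False that by (auto elim!: eventually_mono simp: f_def)
      then show ?thesis using isCont_cong[of f "\<lambda>_. 0" u] by simp
    qed
    have "(\<lambda>n. integral\<^sup>L (distr M borel (\<lambda>\<omega>. exp (- Y n \<omega>))) f) \<longlonglongrightarrow> integral\<^sup>L (distr N borel (\<lambda>\<omega>. exp (- Z \<omega>))) f"
    proof (rule weak_conv_imp_bdd_ae_continuous_conv[OF _ _ wU])
      show "real_distribution (distr M borel (\<lambda>\<omega>. exp (- Y n \<omega>)))" for n
        by (rule M.real_distribution_distr) simp
      show "real_distribution (distr N borel (\<lambda>\<omega>. exp (- Z \<omega>)))"
        by (rule N.real_distribution_distr) simp
      show "norm (f x) \<le> 1" for x
        using bdd by (simp add: f_def)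
      have "{x. \<not> isCont f x} \<subseteq> {0}" using isC by auto
      then have "emeasure (distr N borel (\<lambda>\<omega>. exp (- Z \<omega>))) {x. \<not> isCont f x} \<le>
          emeasure (distr N borel (\<lambda>\<omega>. exp (- Z \<omega>))) {0}"
        by (intro emeasure_mono) auto
      also have "\<dots> = emeasure N ((\<lambda>\<omega>. exp (- Z \<omega>)) -` {0} \<inter> space N)" by (subst emeasure_distr) auto
      also have "(\<lambda>\<omega>. exp (- Z \<omega>)) -` {0} \<inter> space N = {}" by auto
      also have "emeasure N {} = 0" by simp
      finally show "emeasure (distr N borel (\<lambda>\<omega>. exp (- Z \<omega>))) {x. \<not> isCont f x} = 0" by simp
    qed simp
    moreover have "integral\<^sup>L (distr M borel (\<lambda>\<omega>. exp (- Y n \<omega>))) f = integral\<^sup>L (distr M borel (Y n)) h" for n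
      by (simp add: integral_distr f_def)
    moreover have "integral\<^sup>L (distr N borel (\<lambda>\<omega>. exp (- Z \<omega>))) f = integral\<^sup>L (distr N borel Z) h"
      by (simp add: integral_distr f_def)
    ultimately show "(\<lambda>n. integral\<^sup>L (distr M borel (Y n)) h) \<longlonglongrightarrow> integral\<^sup>L (distr N borel Z) h"
      by simp
  qed
qed

section \<open>Gaussian processes on a countable set\<close>

lemma (in prob_space) normal_var_iff_char:
  fixes Z :: "'a \<Rightarrow> real"
  assumes [measurable]: "Z \<in> borel_measurable M"
  shows "normal_var M Z s \<longleftrightarrow> 0 \<le> s \<and> (\<forall>t. char (distr M borel Z) t = of_real (exp (- (s * t\<^sup>2) / 2)))"
proof -
  have "char (distr M borel Z) t = (LINT \<omega>|M. iexp (t * Z \<omega>))" for t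
    unfolding char_def by (subst integral_distr) simp_all
  then show ?thesis by (simp only: normal_var_def assms simp_thms)
qed

lemma (in prob_space) normal_var_sum:
  fixes Z :: "'i \<Rightarrow> 'a \<Rightarrow> real"
  assumes ind: "indep_vars (\<lambda>_. borel) Z A" and "finite A" and Z: "\<And>i. i \<in> A \<Longrightarrow> normal_var M (Z i) (s i)"
  shows "normal_var M (\<lambda>\<omega>. \<Sum>i\<in>A. Z i \<omega>) (\<Sum>i\<in>A. s i)"
proof -
  have [measurable]: "Z i \<in> borel_measurable M" if "i \<in> A" for i
    using normal_var_measurable[OF Z[OF that]] .
  have s: "0 \<le> s i" if "i \<in> A" for i
    using Z[OF that] by (simp add: normal_var_def)
  have "char (distr M borel (\<lambda>\<omega>. \<Sum>i\<in>A. Z i \<omega>)) t = of_real (exp (- ((\<Sum>i\<in>A. s i) * t\<^sup>2) / 2))" for t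
  proof -
    have "char (distr M borel (\<lambda>\<omega>. \<Sum>i\<in>A. Z i \<omega>)) t = (\<Prod>i\<in>A. char (distr M borel (Z i)) t)"
      by (rule char_distr_sum[OF ind])
    also have "\<dots> = (\<Prod>i\<in>A. of_real (exp (- (s i * t\<^sup>2) / 2)))"
      using Z by (intro prod.cong refl) (simp add: normal_var_iff_char)
    also have "\<dots> = of_real (exp (\<Sum>i\<in>A. - (s i * t\<^sup>2) / 2))"
      using \<open>finite A\<close> by (simp add: exp_sum del: of_real_exp)
    also have "(\<Sum>i\<in>A. - (s i * t\<^sup>2) / 2) = - ((\<Sum>i\<in>A. s i) * t\<^sup>2) / 2"
      by (simp add: sum_distrib_right sum_divide_distrib sum_negf)
    finally show ?thesis .
  qed
  then show ?thesis
    using s by (subst normal_var_iff_char) (auto intro: sum_nonneg)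
qed

lemma normal_var_scale:
  assumes "normal_var M Z s"
  shows "normal_var M (\<lambda>\<omega>. c * Z \<omega>) (c\<^sup>2 * s)"
  unfolding normal_var_def
proof (intro conjI allI)
  have *: "Z \<in> borel_measurable M" "0 \<le> s"
    "\<And>t. (LINT \<omega>|M. iexp (t * Z \<omega>)) = of_real (exp (- (s * t\<^sup>2) / 2))"
    using assms by (auto simp: normal_var_def)
  show "(\<lambda>\<omega>. c * Z \<omega>) \<in> borel_measurable M" using *(1) by simp
  show "0 \<le> c\<^sup>2 * s" using *(2) by simp
  show "(LINT \<omega>|M. iexp (t * (c * Z \<omega>))) = of_real (exp (- (c\<^sup>2 * s * t\<^sup>2) / 2))" for t
    using *(3)[of "t * c"] by (simp only: mult.assoc power_mult_distrib ac_simps)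
qed

lemma prob_space_PiM_std_normal: "prob_space (\<Pi>\<^sub>M i\<in>(UNIV::'i set). std_normal_distribution)"
  using real_dist_normal_dist by (intro prob_space_PiM) (auto simp: real_distribution_def)

lemma
  fixes \<iota> :: "'j \<Rightarrow> 'i"
  defines "P \<equiv> \<Pi>\<^sub>M i\<in>(UNIV::'i set). std_normal_distribution"
  shows indep_vars_PiM_std_normal: "inj_on \<iota> J \<Longrightarrow> prob_space.indep_vars P (\<lambda>_. borel) (\<lambda>j \<omega>. \<omega> (\<iota> j)) J"
    and normal_var_PiM_std_normal: "normal_var P (\<lambda>\<omega>. \<omega> i) 1"
proof -
  interpret N: real_distribution std_normal_distribution by (rule real_dist_normal_dist)
  interpret P: prob_space P unfolding P_def by (rule prob_space_PiM_std_normal)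
  have dist: "distr P borel (\<lambda>\<omega>. \<omega> i) = std_normal_distribution" for i :: 'i
  proof -
    have "distr P borel (\<lambda>\<omega>. \<omega> i) = distr P std_normal_distribution (\<lambda>\<omega>. \<omega> i)"
      by (intro distr_cong) simp_all
    also have "\<dots> = std_normal_distribution"
      unfolding P_def using N.prob_space_axioms by (intro distr_PiM_component) auto
    finally show ?thesis .
  qed
  have [measurable]: "(\<lambda>\<omega>. \<omega> i) \<in> borel_measurable P" for i :: 'i
  proof -
    have "(\<lambda>\<omega>. \<omega> i) \<in> measurable P std_normal_distribution"
      unfolding P_def by (rule measurable_component_singleton) simp
    then show ?thesis by (simp cong: measurable_cong_sets)
  qed
  show "normal_var P (\<lambda>\<omega>. \<omega> i) 1"
    by (subst P.normal_var_iff_char) (simp_all add: dist char_std_normal_distribution)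
  show "P.indep_vars (\<lambda>_. borel) (\<lambda>j \<omega>. \<omega> (\<iota> j)) J" if inj: "inj_on \<iota> J"
  proof (cases "J = {}")
    case False
    then show ?thesis
    proof (subst P.indep_vars_iff_distr_eq_PiM')
      have s: "sets (\<Pi>\<^sub>M j\<in>J. (borel::real measure)) = sets (\<Pi>\<^sub>M j\<in>J. std_normal_distribution)"
        by (intro sets_PiM_cong) simp_all
      have "distr P (\<Pi>\<^sub>M j\<in>J. borel) (\<lambda>x. \<lambda>j\<in>J. x (\<iota> j)) =
          distr P (\<Pi>\<^sub>M j\<in>J. std_normal_distribution) (\<lambda>x. \<lambda>j\<in>J. x (\<iota> j))"
        by (intro distr_cong s) auto
      also have "\<dots> = (\<Pi>\<^sub>M j\<in>J. std_normal_distribution)"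
        unfolding P_def using N.prob_space_axioms inj by (intro distr_PiM_reindex) auto
      finally show "distr P (\<Pi>\<^sub>M j\<in>J. borel) (\<lambda>x. \<lambda>j\<in>J. x (\<iota> j)) =
          (\<Pi>\<^sub>M j\<in>J. distr P borel (\<lambda>\<omega>. \<omega> (\<iota> j)))"
        unfolding dist .
    qed simp_all
  qed (simp add: P.indep_vars_def P.indep_sets_def)
qed

text \<open>Cholesky factorisation: \<open>schur_compl k n\<close> eliminates the first \<open>n\<close> coordinates. A vanishing
  pivot is harmless because of \<open>x / 0 = 0\<close>.\<close>

definition schur_step :: "(nat \<Rightarrow> nat \<Rightarrow> real) \<Rightarrow> nat \<Rightarrow> nat \<Rightarrow> nat \<Rightarrow> real" where
  [simp]: "schur_step k n i j = k i j - k i n * k j n / k n n"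

primrec schur_compl :: "(nat \<Rightarrow> nat \<Rightarrow> real) \<Rightarrow> nat \<Rightarrow> nat \<Rightarrow> nat \<Rightarrow> real" where
  "schur_compl k 0 = k"
| "schur_compl k (Suc n) = schur_step (schur_compl k n) n"

definition psd :: "('i \<Rightarrow> 'i \<Rightarrow> real) \<Rightarrow> bool" where
  "psd k \<longleftrightarrow> (\<forall>i j. k i j = k j i) \<and> (\<forall>A c. finite A \<longrightarrow> 0 \<le> (\<Sum>i\<in>A. \<Sum>j\<in>A. c i * c j * k i j))"

lemma psdD:
  "psd k \<Longrightarrow> finite A \<Longrightarrow> 0 \<le> (\<Sum>i\<in>A. \<Sum>j\<in>A. c i * c j * k i j)"
  by (simp add: psd_def)

text \<open>The quadratic form at the vector c + t e_n. Adding a multiple of a unit vector, instead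
  of enlarging the index set, covers the case that n belongs to A. As a polynomial in t it yields
  inequalities of Cauchy-Schwarz type and the Schur complement.\<close>

lemma psd_extend:
  fixes k :: "'i \<Rightarrow> 'i \<Rightarrow> real"
  assumes k: "psd k" and A: "finite A"
  shows "0 \<le> (\<Sum>i\<in>A. \<Sum>j\<in>A. c i * c j * k i j) + 2 * t * (\<Sum>i\<in>A. c i * k i n) + t\<^sup>2 * k n n"
proof -
  have sym: "k i j = k j i" for i j using k by (simp add: psd_def)
  let ?A = "insert n A" and ?c = "\<lambda>i. if i \<in> A then c i else 0" and ?e = "\<lambda>i. if i = n then t else 0"
  have s1: "(\<Sum>i\<in>?A. ?c i * F i) = (\<Sum>i\<in>A. c i * F i)" for F :: "'i \<Rightarrow> real"
    using A by (intro sum.mono_neutral_cong_right) auto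
  have s2: "(\<Sum>i\<in>?A. ?e i * F i) = t * F n" for F :: "'i \<Rightarrow> real"
    using A by (subst sum.remove[of _ n]) (auto intro!: sum.neutral)
  have "0 \<le> (\<Sum>i\<in>?A. \<Sum>j\<in>?A. (?c i + ?e i) * (?c j + ?e j) * k i j)"
    by (rule psdD[OF k, of ?A "\<lambda>i. ?c i + ?e i"]) (simp add: A)
  also have "\<dots> = (\<Sum>i\<in>?A. (?c i + ?e i) * (\<Sum>j\<in>?A. ?c j * k i j + ?e j * k i j))"
    by (simp only: sum_distrib_left distrib_left distrib_right mult.assoc)
  also have "\<dots> = (\<Sum>i\<in>?A. ?c i * ((\<Sum>j\<in>A. c j * k i j) + t * k i n) + ?e i * ((\<Sum>j\<in>A. c j * k i j) + t * k i n))"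
    by (simp only: sum.distrib s1 s2 distrib_right)
  also have "\<dots> = (\<Sum>i\<in>A. c i * ((\<Sum>j\<in>A. c j * k i j) + t * k i n)) + t * ((\<Sum>j\<in>A. c j * k n j) + t * k n n)"
    by (simp only: sum.distrib s1 s2)
  also have "\<dots> = (\<Sum>i\<in>A. \<Sum>j\<in>A. c i * c j * k i j) + 2 * t * (\<Sum>i\<in>A. c i * k i n) + t\<^sup>2 * k n n"
  proof -
    have b: "(\<Sum>j\<in>A. c j * k n j) = (\<Sum>i\<in>A. c i * k i n)"
      by (intro sum.cong refl arg_cong2[where f = "(*)"] sym)
    have "(\<Sum>i\<in>A. c i * ((\<Sum>j\<in>A. c j * k i j) + t * k i n)) =
        (\<Sum>i\<in>A. \<Sum>j\<in>A. c i * c j * k i j) + t * (\<Sum>i\<in>A. c i * k i n)"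
      by (simp add: sum.distrib distrib_left sum_distrib_left mult.assoc mult.left_commute)
    then show ?thesis
      unfolding b by (simp add: power2_eq_square algebra_simps)
  qed
  finally show ?thesis .
qed

lemma psd_diag_nonneg: "psd k \<Longrightarrow> 0 \<le> k n n"
  using psd_extend[of k "{}" _ 1 n] by simp

lemma psd_diag_zero:
  assumes "psd k" "k n n = 0"
  shows "k i n = 0"
proof (rule ccontr)
  assume nz: "k i n \<noteq> 0"
  have "0 \<le> k i i + 2 * t * k i n" for t
    using psd_extend[OF assms(1), of "{i}" "\<lambda>_. 1" t n] assms(2) by simp
  \<comment> \<open>At this t the linear function takes the value - 1.\<close>
  from this[of "- (k i i + 1) / (2 * k i n)"] show False using nz by (simp add: field_simps)
qed

lemma psd_schur_compl: "psd k \<Longrightarrow> psd (schur_compl k n)"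
proof (induction n)
  case (Suc n)
  let ?S = "schur_compl k n"
  have psd: "psd ?S" by (rule Suc.IH[OF Suc.prems])
  show ?case
    unfolding psd_def
  proof (intro conjI allI impI)
    show "schur_compl k (Suc n) i j = schur_compl k (Suc n) j i" for i j
      using psd by (simp add: psd_def mult.commute)
    fix A :: "nat set" and c :: "nat \<Rightarrow> real" assume A: "finite A"
    define b where "b = (\<Sum>i\<in>A. c i * ?S i n)"
    define d where "d = ?S n n"
    have "(\<Sum>i\<in>A. \<Sum>j\<in>A. c i * c j * schur_compl k (Suc n) i j) =
        (\<Sum>i\<in>A. \<Sum>j\<in>A. c i * c j * ?S i j) - (\<Sum>i\<in>A. \<Sum>j\<in>A. (c i * ?S i n) * (c j * ?S j n) / d)"
      unfolding d_def by (simp add: right_diff_distrib sum_subtractf ac_simps)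
    also have "(\<Sum>i\<in>A. \<Sum>j\<in>A. (c i * ?S i n) * (c j * ?S j n) / d) = b * b / d"
      unfolding b_def by (simp add: sum_product sum_divide_distrib)
    also have "0 \<le> (\<Sum>i\<in>A. \<Sum>j\<in>A. c i * c j * ?S i j) - b * b / d"
      \<comment> \<open>For d > 0 this t minimises the form over the eliminated coordinate; for d =
        0 both t and b * b / d are 0.\<close>
      using psd_extend[OF psd A, of c "- b / d" n] unfolding b_def[symmetric] d_def[symmetric]
      by (cases "d = 0") (simp_all add: power2_eq_square field_simps)
    finally show "0 \<le> (\<Sum>i\<in>A. \<Sum>j\<in>A. c i * c j * schur_compl k (Suc n) i j)" by simp
  qed
qed simp

text \<open>The pivot row is cancelled by its own step unless the pivot is zero, and in that case
  the row was zero already by \<open>psd_diag_zero\<close>.\<close>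

lemma schur_compl_zero: "psd k \<Longrightarrow> i < n \<Longrightarrow> schur_compl k n i j = 0"
proof (induction n arbitrary: i j)
  case (Suc n)
  let ?S = "schur_compl k n"
  have psd: "psd ?S" by (rule psd_schur_compl[OF Suc.prems(1)])
  show ?case
  proof (cases "i = n")
    case True
    have "?S n j = ?S j n" using psd by (simp add: psd_def)
    then show ?thesis using psd_diag_zero[OF psd, of n j] True by (cases "?S n n = 0") simp_all
  next
    case False
    then show ?thesis using Suc.IH[OF Suc.prems(1)] Suc.prems(2) by simp
  qed
qed simp

text \<open>Each elimination step subtracts one product \<open>L i l * L j l\<close>, and after m >
  i steps row i is exhausted. The freedom in m encodes that L is lower triangular.\<close>

lemma cholesky:
  fixes k :: "nat \<Rightarrow> nat \<Rightarrow> real"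
  assumes k: "psd k"
  obtains L :: "nat \<Rightarrow> nat \<Rightarrow> real" where "\<And>i j m. i < m \<Longrightarrow> k i j = (\<Sum>l<m. L i l * L j l)"
proof
  define L where "L i l = schur_compl k l i l / sqrt (schur_compl k l l l)" for i l
  have step: "schur_compl k n i j = (\<Sum>l<m. L i (n + l) * L j (n + l)) + schur_compl k (n + m) i j" for n m i j
  proof (induction m)
    case (Suc m)
    have "0 \<le> schur_compl k (n + m) (n + m) (n + m)"
      by (rule psd_diag_nonneg[OF psd_schur_compl[OF k]])
    then show ?case using Suc by (simp add: L_def)
  qed simp
  show "k i j = (\<Sum>l<m. L i l * L j l)" if "i < m" for i j m
    using step[of 0 i j m] schur_compl_zero[OF k that] by simp
qed

text \<open>A row of the Cholesky factor combines finitely many independent standard normal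
  coordinates into one variable of the process; the injection \<open>\<iota>\<close> selects the
  coordinates.\<close>

lemma gaussian_process_countable:
  fixes K :: "'a \<Rightarrow> 'a \<Rightarrow> real" and \<iota> :: "nat \<Rightarrow> 'i"
  assumes K: "psd K" and D: "countable D" and \<iota>: "inj \<iota>"
  obtains g :: "'a \<Rightarrow> ('i \<Rightarrow> real) \<Rightarrow> real" where
    "\<And>A c. finite A \<Longrightarrow> A \<subseteq> D \<Longrightarrow>
      normal_var (\<Pi>\<^sub>M i\<in>UNIV. std_normal_distribution) (\<lambda>\<omega>. \<Sum>x\<in>A. c x * g x \<omega>) (\<Sum>x\<in>A. \<Sum>y\<in>A. c x * c y * K x y)"
proof -
  let ?P = "\<Pi>\<^sub>M i\<in>(UNIV::'i set). std_normal_distribution"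
  interpret P: prob_space ?P by (rule prob_space_PiM_std_normal)
  \<comment> \<open>The kernel is transported to the natural numbers along the enumeration of D and
    extended by zero, since D may be finite.\<close>
  define k where "k i j = (if i \<in> to_nat_on D ` D \<and> j \<in> to_nat_on D ` D then K (from_nat_into D i) (from_nat_into D j) else 0)" for i j
  have "psd k"
    unfolding psd_def
  proof (intro conjI allI impI)
    show "k i j = k j i" for i j using K by (auto simp: k_def psd_def)
    fix A :: "nat set" and c :: "nat \<Rightarrow> real" assume A: "finite A"
    define B where "B = {x\<in>D. to_nat_on D x \<in> A}"
    have inj: "inj_on (to_nat_on D) B"
      using inj_on_to_nat_on[OF D] by (rule inj_on_subset) (auto simp: B_def)
    have B: "finite B"
      by (rule finite_imageD[OF finite_subset[OF _ A] inj]) (auto simp: B_def)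
    have im: "to_nat_on D ` B = A \<inter> to_nat_on D ` D" by (auto simp: B_def)
    have red: "(\<Sum>i\<in>A. F i) = (\<Sum>x\<in>B. F (to_nat_on D x))" if "\<And>i. i \<notin> to_nat_on D ` D \<Longrightarrow> F i = 0" for F :: "nat \<Rightarrow> real"
    proof -
      have "(\<Sum>i\<in>A. F i) = (\<Sum>i\<in>to_nat_on D ` B. F i)"
        unfolding im using A that by (intro sum.mono_neutral_right) auto
      then show ?thesis using sum.reindex[OF inj] by simp
    qed
    have "(\<Sum>i\<in>A. \<Sum>j\<in>A. c i * c j * k i j) = (\<Sum>x\<in>B. \<Sum>y\<in>B. c (to_nat_on D x) * c (to_nat_on D y) * k (to_nat_on D x) (to_nat_on D y))"
      by (subst red, simp add: k_def, rule sum.cong, simp, rule red, simp add: k_def)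
    also have "\<dots> = (\<Sum>x\<in>B. \<Sum>y\<in>B. c (to_nat_on D x) * c (to_nat_on D y) * K x y)"
      using D by (intro sum.cong refl) (auto simp: k_def B_def)
    also have "0 \<le> \<dots>" by (rule psdD[OF K B])
    finally show "0 \<le> (\<Sum>i\<in>A. \<Sum>j\<in>A. c i * c j * k i j)" .
  qed
  then obtain L where L: "\<And>i j m. i < m \<Longrightarrow> k i j = (\<Sum>l<m. L i l * L j l)" using cholesky by blast
  define g where "g x \<omega> = (\<Sum>l<Suc (to_nat_on D x). L (to_nat_on D x) l * \<omega> (\<iota> l))" for x and \<omega> :: "'i \<Rightarrow> real"
  show thesis
  proof (rule that[of g])
    fix A :: "'a set" and c :: "'a \<Rightarrow> real" assume A: "finite A" "A \<subseteq> D"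
    define m where "m = Suc (Max (insert 0 (to_nat_on D ` A)))"
    have m: "to_nat_on D x < m" if "x \<in> A" for x
      unfolding m_def less_Suc_eq_le using A that by (intro Max_ge) auto
    \<comment> \<open>The factorisations of \<open>k i i\<close> with l and with
      \<open>Suc l\<close> terms differ by the square of \<open>L i l\<close>.\<close>
    have L0: "L i l = 0" if "i < l" for i l
    proof -
      have "(\<Sum>l'<Suc l. L i l' * L i l') = (\<Sum>l'<l. L i l' * L i l')"
        using L[of i l i] L[of i "Suc l" i] that by simp
      then show ?thesis by simp
    qed
    have gm: "g x \<omega> = (\<Sum>l<m. L (to_nat_on D x) l * \<omega> (\<iota> l))" if "x \<in> A" for x \<omega>
      unfolding g_def using m[OF that] L0 by (intro sum.mono_neutral_left) auto
    define b where "b l = (\<Sum>x\<in>A. c x * L (to_nat_on D x) l)" for l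
    have lin: "(\<Sum>x\<in>A. c x * g x \<omega>) = (\<Sum>l<m. b l * \<omega> (\<iota> l))" for \<omega>
      unfolding b_def sum_distrib_right
      by (subst sum.swap) (simp add: gm sum_distrib_left mult.assoc)
    have var: "(\<Sum>x\<in>A. \<Sum>y\<in>A. c x * c y * K x y) = (\<Sum>l<m. (b l)\<^sup>2 * 1)"
    proof -
      have "(\<Sum>l<m. (b l)\<^sup>2 * 1) = (\<Sum>l<m. \<Sum>x\<in>A. \<Sum>y\<in>A. c x * c y * (L (to_nat_on D x) l * L (to_nat_on D y) l))"
        unfolding b_def power2_eq_square sum_product by (simp add: ac_simps)
      also have "\<dots> = (\<Sum>x\<in>A. \<Sum>y\<in>A. \<Sum>l<m. c x * c y * (L (to_nat_on D x) l * L (to_nat_on D y) l))"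
        by (subst sum.swap, rule sum.cong, simp, rule sum.swap)
      also have "\<dots> = (\<Sum>x\<in>A. \<Sum>y\<in>A. c x * c y * k (to_nat_on D x) (to_nat_on D y))"
        by (intro sum.cong refl) (simp add: L[OF m] sum_distrib_left)
      also have "\<dots> = (\<Sum>x\<in>A. \<Sum>y\<in>A. c x * c y * K x y)"
        using D A by (intro sum.cong refl) (auto simp: k_def subset_iff)
      finally show ?thesis by simp
    qed
    show "normal_var ?P (\<lambda>\<omega>. \<Sum>x\<in>A. c x * g x \<omega>) (\<Sum>x\<in>A. \<Sum>y\<in>A. c x * c y * K x y)"
      unfolding lin var
    proof (rule P.normal_var_sum)
      have "inj_on \<iota> {..<m}" using \<iota> by (rule inj_on_subset) simp
      from P.indep_vars_compose2[OF indep_vars_PiM_std_normal[OF this], of "\<lambda>l x. b l * x" "\<lambda>_. borel"]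
      show "P.indep_vars (\<lambda>_. borel) (\<lambda>l \<omega>. b l * \<omega> (\<iota> l)) {..<m}" by simp
      show "normal_var ?P (\<lambda>\<omega>. b l * \<omega> (\<iota> l)) ((b l)\<^sup>2 * 1)" for l
        by (intro normal_var_scale normal_var_PiM_std_normal)
    qed simp
  qed
qed

section \<open>Square-integrable Gaussian processes with a given kernel\<close>

lemma power2_norm_L2: "(norm_L2 M f)\<^sup>2 = (LINT x|M. (f x)\<^sup>2)"
  by (simp add: norm_L2_def inner_L2_def power2_eq_square[symmetric])

lemma norm_L2_nonneg: "0 \<le> norm_L2 M f"
  by (simp add: norm_L2_def inner_L2_def)

text \<open>The two sides differ by (a - 2 b + c)^2. In this squared form the triangle inequality
  costs a factor 2 but passes directly through integrals.\<close>

lemma power2_diff_le: "(a - c)\<^sup>2 \<le> 2 * (a - b)\<^sup>2 + 2 * (b - c)\<^sup>2" for a b c :: real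
  using zero_le_power2[of "a - 2 * b + c"] by (simp add: power2_eq_square algebra_simps)

lemma norm_L2_diff_le:
  assumes "f \<in> L2 M" "g \<in> L2 M" "h \<in> L2 M"
  shows "(norm_L2 M (\<lambda>x. f x - h x))\<^sup>2 \<le> 2 * (norm_L2 M (\<lambda>x. f x - g x))\<^sup>2 + 2 * (norm_L2 M (\<lambda>x. g x - h x))\<^sup>2"
proof -
  have "integrable M (\<lambda>x. (u x - v x)\<^sup>2)" if "u \<in> L2 M" "v \<in> L2 M" for u v :: "'a \<Rightarrow> real"
    using L2_diff[OF that] by (simp add: L2_def)
  note int = this
  have "(LINT x|M. (f x - h x)\<^sup>2) \<le> (LINT x|M. 2 * (f x - g x)\<^sup>2 + 2 * (g x - h x)\<^sup>2)"
    using int assms by (intro integral_mono power2_diff_le) auto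
  also have "\<dots> = 2 * (LINT x|M. (f x - g x)\<^sup>2) + 2 * (LINT x|M. (g x - h x)\<^sup>2)"
    using int assms by simp
  finally show ?thesis unfolding power2_norm_L2 .
qed

text \<open>V lies in an open set exactly if it lies in one of countably many balls inside that set,
  with centres in W and radii 1 / (n + 1). Density of W is asked only along the values of V, and
  this is what the discretised paths provide.\<close>

lemma measurable_borel_L2I:
  assumes V: "\<And>\<omega>. \<omega> \<in> space P \<Longrightarrow> V \<omega> \<in> L2 M"
    and meas: "\<And>w. w \<in> L2 M \<Longrightarrow> (\<lambda>\<omega>. norm_L2 M (\<lambda>x. V \<omega> x - w x)) \<in> borel_measurable P"
    and W: "countable W" "W \<subseteq> L2 M"
    and dense: "\<And>\<omega> e. \<omega> \<in> space P \<Longrightarrow> 0 < e \<Longrightarrow> \<exists>w\<in>W. norm_L2 M (\<lambda>x. V \<omega> x - w x) < e"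
  shows "V \<in> measurable P (borel_L2 M)"
  unfolding borel_L2_def
proof (rule measurable_measure_of)
  fix U
  assume "U \<in> {U. U \<subseteq> L2 M \<and> (\<forall>f\<in>U. \<exists>\<epsilon>>0. \<forall>g\<in>L2 M. norm_L2 M (\<lambda>x. g x - f x) < \<epsilon> \<longrightarrow> g \<in> U)}"
  then have U: "U \<subseteq> L2 M" and op: "\<And>f. f \<in> U \<Longrightarrow> \<exists>\<epsilon>>0. \<forall>g\<in>L2 M. norm_L2 M (\<lambda>x. g x - f x) < \<epsilon> \<longrightarrow> g \<in> U"
    by auto
  define B where "B w n = {h\<in>L2 M. norm_L2 M (\<lambda>x. h x - w x) < 1 / real (Suc n)}" for w and n :: nat
  define I where "I = {(w, n). w \<in> W \<and> B w n \<subseteq> U}"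
  have "V -` U \<inter> space P = (\<Union>(w, n)\<in>I. {\<omega>\<in>space P. norm_L2 M (\<lambda>x. V \<omega> x - w x) < 1 / real (Suc n)})"
  proof (intro set_eqI iffI)
    fix \<omega> assume \<omega>: "\<omega> \<in> V -` U \<inter> space P"
    then obtain e where e: "0 < e" "\<And>g. g \<in> L2 M \<Longrightarrow> norm_L2 M (\<lambda>x. g x - V \<omega> x) < e \<Longrightarrow> g \<in> U"
      using op[of "V \<omega>"] by auto
    \<comment> \<open>Half of e, because a ball of radius r that contains V \<omega> lies within
      distance 2 r of V \<omega>.\<close>
    obtain n where n: "1 / real (Suc n) < e / 2"
      using e(1) by (metis half_gt_zero nat_approx_posE)
    obtain w where w: "w \<in> W" "norm_L2 M (\<lambda>x. V \<omega> x - w x) < 1 / real (Suc n)"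
      using dense[of \<omega> "1 / real (Suc n)"] \<omega> by auto
    have "h \<in> U" if h: "h \<in> B w n" for h
    proof (rule e(2))
      have hL: "h \<in> L2 M" and hw: "norm_L2 M (\<lambda>x. h x - w x) < 1 / real (Suc n)" using h by (auto simp: B_def)
      show "h \<in> L2 M" by (rule hL)
      have wL: "w \<in> L2 M" using w W by auto
      have "(norm_L2 M (\<lambda>x. h x - V \<omega> x))\<^sup>2 \<le> 2 * (norm_L2 M (\<lambda>x. h x - w x))\<^sup>2 + 2 * (norm_L2 M (\<lambda>x. w x - V \<omega> x))\<^sup>2"
        using V \<omega> by (intro norm_L2_diff_le hL wL) auto
      also have "norm_L2 M (\<lambda>x. w x - V \<omega> x) = norm_L2 M (\<lambda>x. V \<omega> x - w x)"
        by (simp add: norm_L2_def inner_L2_def power2_eq_square[symmetric] power2_commute)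
      also have "2 * (norm_L2 M (\<lambda>x. h x - w x))\<^sup>2 + 2 * (norm_L2 M (\<lambda>x. V \<omega> x - w x))\<^sup>2 \<le>
          2 * (1 / real (Suc n))\<^sup>2 + 2 * (1 / real (Suc n))\<^sup>2"
        using hw w(2) norm_L2_nonneg by (intro add_mono mult_left_mono power_mono) auto
      also have "\<dots> = (2 * (1 / real (Suc n)))\<^sup>2" by (simp add: power2_eq_square)
      finally have "norm_L2 M (\<lambda>x. h x - V \<omega> x) \<le> 2 * (1 / real (Suc n))"
        by (rule power2_le_imp_le) simp
      then show "norm_L2 M (\<lambda>x. h x - V \<omega> x) < e" using n by linarith
    qed
    then have "(w, n) \<in> I" using w by (auto simp: I_def)
    then show "\<omega> \<in> (\<Union>(w, n)\<in>I. {\<omega>\<in>space P. norm_L2 M (\<lambda>x. V \<omega> x - w x) < 1 / real (Suc n)})"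
      using w \<omega> by (intro UN_I[of "(w, n)"]) auto
  next
    fix \<omega> assume "\<omega> \<in> (\<Union>(w, n)\<in>I. {\<omega>\<in>space P. norm_L2 M (\<lambda>x. V \<omega> x - w x) < 1 / real (Suc n)})"
    then show "\<omega> \<in> V -` U \<inter> space P"
      using V by (auto simp: I_def B_def)
  qed
  also have "\<dots> \<in> sets P"
  proof (rule sets.countable_UN'')
    have "countable (W \<times> (UNIV :: nat set))" using W(1) by simp
    then show "countable I" by (rule countable_subset[rotated]) (auto simp: I_def)
    show "(case p of (w, n) \<Rightarrow> {\<omega>\<in>space P. norm_L2 M (\<lambda>x. V \<omega> x - w x) < 1 / real (Suc n)}) \<in> sets P" if "p \<in> I" for p
    proof -
      obtain w n where p: "p = (w, n)" by (cases p)
      then have [measurable]: "(\<lambda>\<omega>. norm_L2 M (\<lambda>x. V \<omega> x - w x)) \<in> borel_measurable P"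
        using that W(2) by (intro meas) (auto simp: I_def)
      show ?thesis unfolding p by simp
    qed
  qed
  finally show "V -` U \<inter> space P \<in> sets P" .
qed (use V in auto)

text \<open>The properties of \<open>limit_kernel\<close> on which the construction rests. The bound
  dominates all integrals against K, and continuity allows the arguments to be replaced by simple
  approximations.\<close>

locale cov_kernel = Q: prob_space Q
  for Q :: "'a::{metric_space, second_countable_topology} measure" +
  fixes K :: "'a \<Rightarrow> 'a \<Rightarrow> real"
  assumes sets_Q [measurable_cong]: "sets Q = sets borel"
    and K_psd: "psd K"
    and K_bound: "\<And>x y. \<bar>K x y\<bar> \<le> 1"
    and K_tendsto: "\<And>X Y x y. X \<longlonglongrightarrow> x \<Longrightarrow> Y \<longlonglongrightarrow> y \<Longrightarrow> (\<lambda>n. K (X n) (Y n)) \<longlonglongrightarrow> K x y"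
begin

lemma space_Q [simp]: "space Q = UNIV"
  using sets_eq_imp_space_eq[OF sets_Q] by simp

lemma K_sym: "K x y = K y x"
  using K_psd by (simp add: psd_def)

lemma K_measurable [measurable]: "(\<lambda>z. K (fst z) (snd z)) \<in> borel_measurable (Q \<Otimes>\<^sub>M Q)"
proof -
  have "continuous_on UNIV (\<lambda>z. K (fst z) (snd z))"
    unfolding continuous_on_sequentially comp_def
    by (auto intro!: K_tendsto) (metis fst_conv tendsto_fst, metis snd_conv tendsto_snd)
  then have "(\<lambda>z. K (fst z) (snd z)) \<in> borel_measurable (borel \<Otimes>\<^sub>M borel)"
    unfolding borel_prod by (rule borel_measurable_continuous_onI)
  then show ?thesis
    unfolding measurable_cong_sets[OF sets_pair_measure_cong[OF sets_Q sets_Q] refl] .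
qed

lemma K_measurable_diag [measurable (raw)]:
  "X \<in> measurable N Q \<Longrightarrow> Y \<in> measurable N Q \<Longrightarrow> (\<lambda>\<omega>. K (X \<omega>) (Y \<omega>)) \<in> borel_measurable N"
  using measurable_compose[OF measurable_Pair K_measurable, of X N Y] by simp

text \<open>The mean square distance between the values at x and y of a centred process with
  covariance K.\<close>

definition kdist :: "'a \<Rightarrow> 'a \<Rightarrow> real" where
  "kdist x y = K x x + K y y - 2 * K x y"

lemma kdist_nonneg: "0 \<le> kdist x y"
  using psd_extend[OF K_psd, of "{x}" "\<lambda>_. 1" "- 1" y] by (simp add: kdist_def)

lemma kdist_le4: "kdist x y \<le> 4"
  using K_bound[of x x] K_bound[of y y] K_bound[of x y] by (simp add: kdist_def abs_le_iff)

text \<open>The form with weights 1, 1, - 2 at x, y, z is nonnegative. For the process behind K this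
  is \<open>power2_diff_le\<close> in the mean.\<close>

lemma kdist_triangle: "kdist x y \<le> 2 * kdist z x + 2 * kdist z y"
proof -
  have "0 \<le> (\<Sum>i<3::nat. \<Sum>j<3::nat. [1, 1, -2] ! i * [1, 1, -2] ! j * K ([x, y, z] ! i) ([x, y, z] ! j))"
  proof -
    let ?A = "{x, y, z}"
    \<comment> \<open>A sum of three conditionals gives the right total weights also when some of
      the points coincide.\<close>
    let ?c = "\<lambda>u. (if u = x then 1 else 0) + (if u = y then 1 else 0) + (if u = z then - 2 else (0::real))"
    have s: "(\<Sum>i\<in>?A. ?c i * F i) = F x + F y - 2 * F z" for F :: "'a \<Rightarrow> real"
    proof -
      have d: "(\<Sum>i\<in>?A. (if i = u then a else 0) * F i) = a * F u" if "u \<in> ?A" for u and a :: real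
      proof -
        have "(\<Sum>i\<in>?A. (if i = u then a else 0) * F i) = (\<Sum>i\<in>?A. if i = u then a * F i else 0)"
          by (intro sum.cong) auto
        then show ?thesis using that by (simp add: sum.delta)
      qed
      have "(\<Sum>i\<in>?A. ?c i * F i) = (\<Sum>i\<in>?A. (if i = x then 1 else 0) * F i) +
         (\<Sum>i\<in>?A. (if i = y then 1 else 0) * F i) + (\<Sum>i\<in>?A. (if i = z then - 2 else 0) * F i)"
        by (simp only: sum.distrib distrib_right)
      also have "\<dots> = F x + F y - 2 * F z"
        by (subst (1 2 3) d) auto
      finally show ?thesis .
    qed
    have "0 \<le> (\<Sum>i\<in>?A. \<Sum>j\<in>?A. ?c i * ?c j * K i j)"
      by (rule psdD[OF K_psd]) simp
    also have "\<dots> = (\<Sum>i\<in>?A. ?c i * (\<Sum>j\<in>?A. ?c j * K i j))"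
      by (simp only: sum_distrib_left mult.assoc)
    also have "\<dots> = K x x + K x y - 2 * K x z + (K y x + K y y - 2 * K y z) - 2 * (K z x + K z y - 2 * K z z)"
      by (simp only: s)
    finally show ?thesis
      by (simp add: eval_nat_numeral lessThan_Suc algebra_simps)
  qed
  then show ?thesis
    using K_sym[of x y] K_sym[of x z] K_sym[of y z]
    by (simp add: eval_nat_numeral lessThan_Suc kdist_def)
qed

lemma kdist_tendsto: "X \<longlonglongrightarrow> x \<Longrightarrow> (\<lambda>n. kdist x (X n)) \<longlonglongrightarrow> 0"
proof -
  assume X: "X \<longlonglongrightarrow> x"
  have "(\<lambda>n. kdist x (X n)) \<longlonglongrightarrow> K x x + K x x - 2 * K x x"
    unfolding kdist_def by (intro tendsto_intros K_tendsto X)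
  then show ?thesis by simp
qed

section \<open>Bilinear form and integral operator of the kernel\<close>

lemma integrable_L2: "h \<in> L2 Q \<Longrightarrow> integrable Q h"
  unfolding L2_def by (auto intro: Q.square_integrable_imp_integrable)

lemma measurable_L2: "h \<in> L2 Q \<Longrightarrow> h \<in> borel_measurable Q"
  by (simp add: L2_def)

definition kform :: "('a \<Rightarrow> real) \<Rightarrow> ('a \<Rightarrow> real) \<Rightarrow> real" where
  "kform h h' = (LINT f|Q. LINT g|Q. K f g * h f * h' g)"

definition kop :: "('a \<Rightarrow> real) \<Rightarrow> 'a \<Rightarrow> real" where
  "kop h f = (LINT g|Q. K f g * h g)"

lemma K_mult_le: "\<bar>K x y * a\<bar> \<le> \<bar>a\<bar>"
  using mult_right_mono[OF K_bound[of x y], of "\<bar>a\<bar>"] by (simp add: abs_mult)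

lemma K_mult_integrable: "h \<in> L2 Q \<Longrightarrow> integrable Q (\<lambda>g. K f g * h g)"
proof -
  assume h: "h \<in> L2 Q"
  note [measurable] = measurable_L2[OF h]
  show ?thesis
    by (rule Bochner_Integration.integrable_bound[OF integrable_L2[OF h]]) (use K_mult_le in auto)
qed

lemma kop_measurable: "h \<in> L2 Q \<Longrightarrow> kop h \<in> borel_measurable Q"
proof -
  assume h: "h \<in> L2 Q"
  note [measurable] = measurable_L2[OF h]
  show ?thesis unfolding kop_def by measurable
qed

lemma kop_le: "h \<in> L2 Q \<Longrightarrow> \<bar>kop h f\<bar> \<le> (LINT g|Q. \<bar>h g\<bar>)"
proof -
  assume h: "h \<in> L2 Q"
  have "\<bar>kop h f\<bar> \<le> (LINT g|Q. \<bar>K f g * h g\<bar>)"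
    unfolding kop_def by (rule integral_abs_bound)
  also have "\<dots> \<le> (LINT g|Q. \<bar>h g\<bar>)"
    using K_mult_integrable[OF h] integrable_L2[OF h] K_mult_le by (intro integral_mono) auto
  finally show ?thesis .
qed

lemma kop_L2: "h \<in> L2 Q \<Longrightarrow> kop h \<in> L2 Q"
proof -
  assume h: "h \<in> L2 Q"
  have "(\<lambda>_. LINT g|Q. \<bar>h g\<bar>) \<in> L2 Q" by (simp add: L2_def)
  moreover have "(kop h f)\<^sup>2 \<le> (LINT g|Q. \<bar>h g\<bar>)\<^sup>2" for f
    using kop_le[OF h, of f] by (metis abs_ge_zero power2_abs power_mono)
  ultimately show ?thesis
    unfolding L2_def using kop_measurable[OF h]
    by (auto intro!: Q.integrable_const_bound[where B = "(LINT g|Q. \<bar>h g\<bar>)\<^sup>2"])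
qed

lemma kform_eq_inner: "kform h h' = inner_L2 Q (kop h') h"
proof -
  have "(LINT g|Q. K f g * h f * h' g) = kop h' f * h f" for f
    unfolding kop_def integral_mult_left_zero[symmetric]
    by (intro Bochner_Integration.integral_cong) (auto simp: ac_simps)
  then show ?thesis by (simp add: kform_def inner_L2_def)
qed

lemma inner_L2_commute: "inner_L2 M h h' = inner_L2 M h' h"
  by (simp add: inner_L2_def mult.commute)

lemma kform_sym:
  assumes h: "h \<in> L2 Q" and h': "h' \<in> L2 Q"
  shows "kform h h' = kform h' h"
proof -
  note [measurable] = measurable_L2[OF h] measurable_L2[OF h']
  interpret QQ: pair_prob_space Q Q ..
  have "integrable (Q \<Otimes>\<^sub>M Q) (\<lambda>(f, g). K f g * h f * h' g)"
  proof (rule Bochner_Integration.integrable_bound)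
    show "integrable (Q \<Otimes>\<^sub>M Q) (\<lambda>(f, g). h f * h' g)"
      using integrable_L2[OF h] integrable_L2[OF h']
      by (intro QQ.Fubini_integrable) (auto simp: abs_mult)
    have "\<bar>K f g * h f * h' g\<bar> \<le> \<bar>h f * h' g\<bar>" for f g
      using K_mult_le[of f g "h f * h' g"] by (simp add: mult.assoc)
    then show "AE z in Q \<Otimes>\<^sub>M Q. norm (case z of (f, g) \<Rightarrow> K f g * h f * h' g) \<le> norm (case z of (f, g) \<Rightarrow> h f * h' g)"
      by (auto simp: split_beta')
  qed measurable
  from QQ.Fubini_integral[OF this]
  have "kform h h' = (LINT g|Q. LINT f|Q. K f g * h f * h' g)"
    by (simp add: kform_def)
  also have "\<dots> = (LINT g|Q. LINT f|Q. K g f * h' g * h f)"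
    by (intro Bochner_Integration.integral_cong refl) (simp add: K_sym[of _ "_::'a"] ac_simps)
  finally show ?thesis by (simp add: kform_def)
qed

lemma kop_linear:
  assumes h: "h \<in> L2 Q" and h': "h' \<in> L2 Q"
  shows "kop (\<lambda>x. a * h x + b * h' x) f = a * kop h f + b * kop h' f"
proof -
  have "kop (\<lambda>x. a * h x + b * h' x) f = (LINT g|Q. a * (K f g * h g) + b * (K f g * h' g))"
    unfolding kop_def by (intro Bochner_Integration.integral_cong) (auto simp: algebra_simps)
  also have "\<dots> = a * kop h f + b * kop h' f"
    unfolding kop_def using K_mult_integrable[OF h] K_mult_integrable[OF h'] by simp
  finally show ?thesis .
qed

lemma inner_L2_linear:
  assumes "u \<in> L2 M" "h \<in> L2 M" "h' \<in> L2 M"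
  shows "inner_L2 M u (\<lambda>x. a * h x + b * h' x) = a * inner_L2 M u h + b * inner_L2 M u h'"
proof -
  have "inner_L2 M u (\<lambda>x. a * h x + b * h' x) = (LINT x|M. a * (u x * h x) + b * (u x * h' x))"
    unfolding inner_L2_def by (intro Bochner_Integration.integral_cong) (auto simp: algebra_simps)
  then show ?thesis
    unfolding inner_L2_def using assms by (simp add: L2_mult_integrable)
qed

lemma kform_quadratic:
  assumes h: "h \<in> L2 Q" and h': "h' \<in> L2 Q"
  shows "kform (\<lambda>x. a * h x + b * h' x) (\<lambda>x. a * h x + b * h' x) =
     a\<^sup>2 * kform h h + 2 * a * b * kform h h' + b\<^sup>2 * kform h' h'"
proof -
  let ?v = "\<lambda>x. a * h x + b * h' x"
  have v: "?v \<in> L2 Q" by (intro L2_add L2_scale h h')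
  have e: "kop ?v = (\<lambda>f. a * kop h f + b * kop h' f)"
    by (intro ext kop_linear h h')
  have "kform ?v ?v = inner_L2 Q (\<lambda>f. a * kop h f + b * kop h' f) ?v"
    unfolding kform_eq_inner e ..
  also have "\<dots> = a * inner_L2 Q (\<lambda>f. a * kop h f + b * kop h' f) h + b * inner_L2 Q (\<lambda>f. a * kop h f + b * kop h' f) h'"
    by (intro inner_L2_linear L2_add L2_scale kop_L2 h h')
  also have "\<dots> = a * (a * kform h h + b * kform h h') + b * (a * kform h' h + b * kform h' h')"
    by (subst (1 2) inner_L2_commute, subst (1 2) inner_L2_linear)
       (auto intro!: kop_L2 h h' simp: kform_eq_inner inner_L2_commute[of _ h] inner_L2_commute[of _ h'])
  also have "kform h' h = kform h h'" by (rule kform_sym[OF h' h])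
  finally show ?thesis by (simp add: power2_eq_square algebra_simps)
qed

end

text \<open>The functions t m discretise the identity, and g is a Gaussian process on the countable
  set of their values. The rate (1 / 16)^m is chosen to outweigh the factor 4^m in
  \<open>dom\<close>.\<close>

locale gaussian_approx = cov_kernel Q K + P: prob_space P
  for Q :: "'a::{metric_space, second_countable_topology} measure" and K
  and P :: "'w measure" +
  fixes t :: "nat \<Rightarrow> 'a \<Rightarrow> 'a" and g :: "'a \<Rightarrow> 'w \<Rightarrow> real"
  assumes simple: "\<And>m. simple_function Q (t m)"
    and t_tendsto: "\<And>x. (\<lambda>m. t m x) \<longlonglongrightarrow> x"
    and fast: "\<And>m. (LINT x|Q. kdist x (t m x)) \<le> (1 / 16) ^ m"
    and normal: "\<And>A c. finite A \<Longrightarrow> A \<subseteq> (\<Union>m. range (t m)) \<Longrightarrow>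
      normal_var P (\<lambda>\<omega>. \<Sum>x\<in>A. c x * g x \<omega>) (\<Sum>x\<in>A. \<Sum>y\<in>A. c x * c y * K x y)"
begin

sublocale PQ: pair_prob_space P Q ..

lemma Q_prob_UNIV [simp]: "measure Q UNIV = 1"
  using Q.prob_space by simp

lemma t_measurable [measurable]: "t m \<in> measurable Q Q"
proof -
  have "t m \<in> borel_measurable Q"
    by (rule borel_measurable_simple_function[OF simple])
  then show ?thesis by (simp cong: measurable_cong_sets add: sets_Q)
qed

lemma finite_range_t: "finite (range (t m))"
  using simple_functionD(1)[OF simple[of m]] by simp

lemma sets_t_eq [measurable]: "{x. t m x = y} \<in> sets Q"
  using simple_functionD(2)[OF simple[of m], of "{y}"] by (simp add: vimage_def)

lemma normal_g: "x \<in> range (t m) \<Longrightarrow> normal_var P (g x) (K x x)"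
  using normal[of "{x}" "\<lambda>_. 1"] by auto

lemma g_measurable [measurable]: "g (t m x) \<in> borel_measurable P"
  using normal_var_measurable[OF normal_g] by blast

text \<open>A function of t m x becomes a finite sum of indicators in x with coefficients free of x.
  Joint measurability in (\<omega>, x) rests on this, as do the finite linear and quadratic forms
  below.\<close>

lemma range_t_sum: "F (t m x) = (\<Sum>y\<in>range (t m). indicator {x. t m x = y} x * F y)" for F :: "'a \<Rightarrow> real"
proof -
  have "(\<Sum>y\<in>range (t m). indicator {x. t m x = y} x * F y) = (\<Sum>y\<in>{t m x}. F y)"
    by (rule sum.mono_neutral_cong_right) (auto simp: finite_range_t split: split_indicator)
  then show ?thesis by simp
qed

definition U :: "nat \<Rightarrow> 'w \<Rightarrow> 'a \<Rightarrow> real" where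
  "U m \<omega> x = g (t m x) \<omega>"

lemma U_measurable_pair [measurable]: "(\<lambda>(\<omega>, x). U m \<omega> x) \<in> borel_measurable (P \<Otimes>\<^sub>M Q)"
proof -
  have "(\<lambda>(\<omega>, x). U m \<omega> x) = (\<lambda>z. \<Sum>y\<in>range (t m). indicator {x. t m x = y} (snd z) * g y (fst z))"
    unfolding U_def using range_t_sum[of "\<lambda>y. g y _" m] by (auto simp: split_beta')
  moreover have "(\<lambda>z. \<Sum>y\<in>range (t m). indicator {x. t m x = y} (snd z) * g y (fst z)) \<in> borel_measurable (P \<Otimes>\<^sub>M Q)"
  proof (rule borel_measurable_sum)
    fix y assume "y \<in> range (t m)"
    then have [measurable]: "g y \<in> borel_measurable P" by auto
    show "(\<lambda>z. indicator {x. t m x = y} (snd z) * g y (fst z)) \<in> borel_measurable (P \<Otimes>\<^sub>M Q)" by measurable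
  qed
  ultimately show ?thesis by simp
qed

lemma U_measurable [measurable]: "\<omega> \<in> space P \<Longrightarrow> U m \<omega> \<in> borel_measurable Q" "(\<lambda>\<omega>. U m \<omega> x) \<in> borel_measurable P"
  using measurable_compose[OF measurable_Pair1' U_measurable_pair, of \<omega> m] by (simp_all add: U_def[abs_def])

lemma U_L2: "\<omega> \<in> space P \<Longrightarrow> U m \<omega> \<in> L2 Q"
proof -
  assume \<omega>: "\<omega> \<in> space P"
  have "finite ((\<lambda>y. (g y \<omega>)\<^sup>2) ` range (t m))" using finite_range_t by blast
  then have "(U m \<omega> x)\<^sup>2 \<le> Max ((\<lambda>y. (g y \<omega>)\<^sup>2) ` range (t m))" for x
    by (rule Max_ge) (auto simp: U_def)
  then show ?thesis
    unfolding L2_def using U_measurable(1)[OF \<omega>]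
    by (auto intro!: Q.integrable_const_bound[where B = "Max ((\<lambda>y. (g y \<omega>)\<^sup>2) ` range (t m))"])
qed

lemma moment_diff:
  assumes "x \<in> range (t m)" "y \<in> range (t n)"
  shows "(\<integral>\<^sup>+\<omega>. ennreal ((g x \<omega> - g y \<omega>)\<^sup>2) \<partial>P) = ennreal (kdist x y)"
proof (cases "x = y")
  case True
  then show ?thesis by (simp add: kdist_def)
next
  case False
  have n: "normal_var P (\<lambda>\<omega>. g x \<omega> - g y \<omega>) (kdist x y)"
    using normal[of "{x, y}" "\<lambda>z. if z = x then 1 else - 1"] False assms K_sym[of x y]
    by (auto simp: kdist_def algebra_simps)
  show ?thesis
    using P.normal_var_integrable_power[OF n, of 2] P.normal_var_moment_even[OF n, of 1]
    by (subst nn_integral_eq_integral) simp_all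
qed

lemma moment: "x \<in> range (t m) \<Longrightarrow> (\<integral>\<^sup>+\<omega>. ennreal ((g x \<omega>)\<^sup>2) \<partial>P) = ennreal (K x x)"
  using P.normal_var_integrable_power[OF normal_g, of x m 2] P.normal_var_moment_even[OF normal_g, of x m 1]
  by (subst nn_integral_eq_integral) simp_all

section \<open>Convergence of the discretised processes\<close>

definition dU :: "nat \<Rightarrow> 'w \<Rightarrow> 'a \<Rightarrow> real" where
  "dU m \<omega> x = U (Suc m) \<omega> x - U m \<omega> x"

lemma dU_measurable_pair [measurable]: "(\<lambda>(\<omega>, x). dU m \<omega> x) \<in> borel_measurable (P \<Otimes>\<^sub>M Q)"
  unfolding dU_def by measurable

lemma kdist_t_integrable: "integrable Q (\<lambda>x. kdist x (t m x))"
proof (rule Q.integrable_const_bound[where B = 4])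
  show "AE x in Q. norm (kdist x (t m x)) \<le> 4"
    using kdist_nonneg kdist_le4 by auto
  show "(\<lambda>x. kdist x (t m x)) \<in> borel_measurable Q"
    unfolding kdist_def by measurable
qed

lemma dU_moment: "(\<integral>\<^sup>+\<omega>. \<integral>\<^sup>+x. ennreal ((dU m \<omega> x)\<^sup>2) \<partial>Q \<partial>P) \<le> ennreal (4 * (1 / 16) ^ m)"
proof -
  have "(\<integral>\<^sup>+\<omega>. \<integral>\<^sup>+x. ennreal ((dU m \<omega> x)\<^sup>2) \<partial>Q \<partial>P) = (\<integral>\<^sup>+x. \<integral>\<^sup>+\<omega>. ennreal ((dU m \<omega> x)\<^sup>2) \<partial>P \<partial>Q)"
    by (rule PQ.Fubini'[symmetric]) measurable
  also have "\<dots> = (\<integral>\<^sup>+x. ennreal (kdist (t (Suc m) x) (t m x)) \<partial>Q)"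
    unfolding dU_def U_def by (intro nn_integral_cong moment_diff) auto
  also have "\<dots> \<le> (\<integral>\<^sup>+x. ennreal (2 * kdist x (t (Suc m) x) + 2 * kdist x (t m x)) \<partial>Q)"
    by (intro nn_integral_mono ennreal_leI kdist_triangle)
  also have "\<dots> = ennreal (LINT x|Q. 2 * kdist x (t (Suc m) x) + 2 * kdist x (t m x))"
    using kdist_t_integrable kdist_nonneg by (intro nn_integral_eq_integral) auto
  also have "(LINT x|Q. 2 * kdist x (t (Suc m) x) + 2 * kdist x (t m x)) =
      2 * (LINT x|Q. kdist x (t (Suc m) x)) + 2 * (LINT x|Q. kdist x (t m x))"
    using kdist_t_integrable by simp
  also have "ennreal \<dots> \<le> ennreal (4 * (1 / 16) ^ m)"
  proof (rule ennreal_leI)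
    have "(1 / 16) ^ Suc m \<le> ((1 / 16) ^ m :: real)" by (rule power_decreasing) auto
    then show "2 * (LINT x|Q. kdist x (t (Suc m) x)) + 2 * (LINT x|Q. kdist x (t m x)) \<le> 4 * (1 / 16) ^ m"
      using fast[of m] fast[of "Suc m"] by linarith
  qed
  finally show ?thesis .
qed

text \<open>A finite value of \<open>dom\<close> bounds \<open>\<bar>dU m\<bar>\<close> by a multiple of \<open>(1 / 2) ^ m\<close>.\<close>

definition dom :: "'w \<Rightarrow> 'a \<Rightarrow> ennreal" where
  "dom \<omega> x = (\<Sum>m. ennreal (4 ^ m * (dU m \<omega> x)\<^sup>2))"

lemma dom_measurable_pair [measurable]: "(\<lambda>(\<omega>, x). dom \<omega> x) \<in> borel_measurable (P \<Otimes>\<^sub>M Q)"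
  unfolding dom_def by measurable

lemma dom_measurable: "\<omega> \<in> space P \<Longrightarrow> dom \<omega> \<in> borel_measurable Q"
  using measurable_compose[OF measurable_Pair1' dom_measurable_pair, of \<omega>] by simp

definition tot :: "'w \<Rightarrow> ennreal" where
  "tot \<omega> = (\<integral>\<^sup>+x. dom \<omega> x \<partial>Q)"

lemma tot_measurable [measurable]: "tot \<in> borel_measurable P"
  unfolding tot_def by measurable

text \<open>By Tonelli and \<open>dU_moment\<close> the m-th summand contributes at most 4^m times 4
  / 16^m, and 4 / 4^m is summable.\<close>

lemma tot_finite: "(\<integral>\<^sup>+\<omega>. tot \<omega> \<partial>P) < \<infinity>"
proof -
  have "(\<integral>\<^sup>+\<omega>. tot \<omega> \<partial>P) = (\<integral>\<^sup>+z. (case z of (\<omega>, x) \<Rightarrow> dom \<omega> x) \<partial>(P \<Otimes>\<^sub>M Q))"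
    unfolding tot_def by (subst Q.nn_integral_fst[symmetric]) simp_all
  also have "\<dots> = (\<Sum>m. \<integral>\<^sup>+z. (case z of (\<omega>, x) \<Rightarrow> ennreal (4 ^ m * (dU m \<omega> x)\<^sup>2)) \<partial>(P \<Otimes>\<^sub>M Q))"
    unfolding dom_def split_beta' by (rule nn_integral_suminf) measurable
  also have "\<dots> = (\<Sum>m. \<integral>\<^sup>+\<omega>. \<integral>\<^sup>+x. ennreal (4 ^ m * (dU m \<omega> x)\<^sup>2) \<partial>Q \<partial>P)"
    by (intro suminf_cong) (subst Q.nn_integral_fst[symmetric], simp_all)
  also have "\<dots> = (\<Sum>m. ennreal (4 ^ m) * (\<integral>\<^sup>+\<omega>. \<integral>\<^sup>+x. ennreal ((dU m \<omega> x)\<^sup>2) \<partial>Q \<partial>P))"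
  proof (intro suminf_cong)
    fix m
    have "(\<integral>\<^sup>+x. ennreal (4 ^ m * (dU m \<omega> x)\<^sup>2) \<partial>Q) = ennreal (4 ^ m) * (\<integral>\<^sup>+x. ennreal ((dU m \<omega> x)\<^sup>2) \<partial>Q)"
      if "\<omega> \<in> space P" for \<omega>
      using that unfolding dU_def by (subst nn_integral_cmult[symmetric]) (auto simp: ennreal_mult)
    then have "(\<integral>\<^sup>+\<omega>. \<integral>\<^sup>+x. ennreal (4 ^ m * (dU m \<omega> x)\<^sup>2) \<partial>Q \<partial>P) =
        (\<integral>\<^sup>+\<omega>. ennreal (4 ^ m) * (\<integral>\<^sup>+x. ennreal ((dU m \<omega> x)\<^sup>2) \<partial>Q) \<partial>P)"
      by (intro nn_integral_cong)
    also have "\<dots> = ennreal (4 ^ m) * (\<integral>\<^sup>+\<omega>. \<integral>\<^sup>+x. ennreal ((dU m \<omega> x)\<^sup>2) \<partial>Q \<partial>P)"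
      by (rule nn_integral_cmult) measurable
    finally show "(\<integral>\<^sup>+\<omega>. \<integral>\<^sup>+x. ennreal (4 ^ m * (dU m \<omega> x)\<^sup>2) \<partial>Q \<partial>P) =
      ennreal (4 ^ m) * (\<integral>\<^sup>+\<omega>. \<integral>\<^sup>+x. ennreal ((dU m \<omega> x)\<^sup>2) \<partial>Q \<partial>P)" .
  qed
  also have "\<dots> \<le> (\<Sum>m. ennreal (4 * (1 / 4) ^ m))"
  proof (intro suminf_le summableI)
    fix m
    have "ennreal (4 ^ m) * (\<integral>\<^sup>+\<omega>. \<integral>\<^sup>+x. ennreal ((dU m \<omega> x)\<^sup>2) \<partial>Q \<partial>P) \<le> ennreal (4 ^ m) * ennreal (4 * (1 / 16) ^ m)"
      by (intro mult_left_mono dU_moment) simp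
    also have "\<dots> = ennreal (4 ^ m * (4 * (1 / 16) ^ m))"
      by (simp add: ennreal_mult)
    also have "4 ^ m * (4 * (1 / 16) ^ m) = 4 * (1 / 4 :: real) ^ m"
      using power_mult_distrib[of 4 "1 / 16 :: real" m] by simp
    finally show "ennreal (4 ^ m) * (\<integral>\<^sup>+\<omega>. \<integral>\<^sup>+x. ennreal ((dU m \<omega> x)\<^sup>2) \<partial>Q \<partial>P) \<le> ennreal (4 * (1 / 4) ^ m)" .
  qed
  also have "\<dots> = ennreal (\<Sum>m. 4 * (1 / 4) ^ m)"
    by (intro suminf_ennreal_eq summable_sums summable_mult summable_geometric) auto
  also have "\<dots> < \<infinity>" by simp
  finally show ?thesis .
qed

lemma AE_tot_finite: "AE \<omega> in P. tot \<omega> < \<infinity>"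
  using nn_integral_PInf_AE[of tot P] tot_finite by (simp add: less_top)

text \<open>The limit of U m, with value 0 on exceptional sets: a path with infinite
  \<open>tot\<close> vanishes altogether, and on the other paths the points with infinite
  \<open>dom\<close> form a Q-null set. In this way every path, not only almost every one, lies in
  \<open>L2 Q\<close>.\<close>

definition V :: "'w \<Rightarrow> 'a \<Rightarrow> real" where
  "V \<omega> x = (if tot \<omega> < \<infinity> \<and> dom \<omega> x < \<infinity> then U 0 \<omega> x + (\<Sum>m. dU m \<omega> x) else 0)"

lemma V_measurable_pair [measurable]: "(\<lambda>(\<omega>, x). V \<omega> x) \<in> borel_measurable (P \<Otimes>\<^sub>M Q)"
  unfolding V_def split_beta' by measurable

lemma V_measurable: "\<omega> \<in> space P \<Longrightarrow> V \<omega> \<in> borel_measurable Q"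
  using measurable_compose[OF measurable_Pair1' V_measurable_pair, of \<omega>] by simp

text \<open>With D the value of \<open>dom\<close>, the i-th increment is at most sqrt D / 2^i in
  modulus. The tail from m on is a geometric series with sum 2 sqrt D / 2^m, whose square is the
  bound.\<close>

lemma U_V_bound:
  assumes "tot \<omega> < \<infinity>" "dom \<omega> x < \<infinity>"
  shows "(U m \<omega> x - V \<omega> x)\<^sup>2 \<le> 4 * (1 / 4) ^ m * enn2real (dom \<omega> x)"
proof -
  define D where "D = enn2real (dom \<omega> x)"
  have D: "dom \<omega> x = ennreal D" "0 \<le> D" using assms(2) by (simp_all add: D_def)
  have d: "\<bar>dU i \<omega> x\<bar> \<le> (1 / 2) ^ i * sqrt D" for i
  proof -
    have "(\<Sum>j\<in>{i}. ennreal (4 ^ j * (dU j \<omega> x)\<^sup>2)) \<le> dom \<omega> x"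
      unfolding dom_def by (intro sum_le_suminf summableI) auto
    then have "4 ^ i * (dU i \<omega> x)\<^sup>2 \<le> D" using D by simp
    then have "(dU i \<omega> x)\<^sup>2 \<le> (1 / 4) ^ i * D" by (simp add: field_simps)
    also have "\<dots> = ((1 / 2) ^ i * sqrt D)\<^sup>2"
    proof -
      have "((1 / 2) ^ i)\<^sup>2 = ((1 / 4) ^ i :: real)"
        unfolding power_even_eq[symmetric] power_mult by (simp add: power2_eq_square)
      then show ?thesis using D(2) by (simp add: power_mult_distrib)
    qed
    finally have "(dU i \<omega> x)\<^sup>2 \<le> ((1 / 2) ^ i * sqrt D)\<^sup>2" .
    then show ?thesis using D(2) by (simp add: abs_le_square_iff[symmetric])
  qed
  have sm: "summable (\<lambda>i. (1 / 2) ^ (i + m) * sqrt D)"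
    by (simp add: power_add summable_mult2 summable_geometric)
  have sum1: "summable (\<lambda>i. dU i \<omega> x)"
    by (rule summable_comparison_test[of _ "\<lambda>i. (1 / 2) ^ i * sqrt D"])
       (use d in \<open>auto intro!: summable_mult2 summable_geometric\<close>)
  have sum2: "summable (\<lambda>i. \<bar>dU (i + m) \<omega> x\<bar>)"
    by (rule summable_comparison_test[OF _ sm]) (use d in auto)
  have Um: "U m \<omega> x = U 0 \<omega> x + (\<Sum>i<m. dU i \<omega> x)"
    by (induction m) (simp_all add: dU_def)
  have "V \<omega> x - U m \<omega> x = (\<Sum>i. dU (i + m) \<omega> x)"
    using assms suminf_split_initial_segment[OF sum1, of m] by (simp add: V_def Um)
  then have "\<bar>U m \<omega> x - V \<omega> x\<bar> = \<bar>\<Sum>i. dU (i + m) \<omega> x\<bar>" by (simp add: abs_minus_commute)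
  also have "\<dots> \<le> (\<Sum>i. \<bar>dU (i + m) \<omega> x\<bar>)"
    by (rule summable_rabs[OF sum2])
  also have "\<dots> \<le> (\<Sum>i. (1 / 2) ^ (i + m) * sqrt D)"
    by (rule suminf_le[OF d sum2 sm])
  also have "\<dots> = 2 * (1 / 2) ^ m * sqrt D"
    using suminf_geometric[of "1 / 2 :: real"]
      suminf_mult2[of "\<lambda>i. (1 / 2 :: real) ^ i" "(1 / 2) ^ m * sqrt D"]
    by (simp add: power_add mult.assoc summable_geometric)
  finally have "\<bar>U m \<omega> x - V \<omega> x\<bar>\<^sup>2 \<le> (2 * (1 / 2) ^ m * sqrt D)\<^sup>2"
    by (intro power_mono) auto
  also have "\<dots> = 4 * (1 / 4) ^ m * D"
  proof -
    have "((1 / 2) ^ m)\<^sup>2 = ((1 / 4) ^ m :: real)"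
      unfolding power_even_eq[symmetric] power_mult by (simp add: power2_eq_square)
    then show ?thesis using D(2) by (simp add: power_mult_distrib)
  qed
  finally show ?thesis by (simp add: D_def)
qed

text \<open>Paths with infinite \<open>tot\<close> are set to zero as for V, so that the estimates
  below hold at every point of the sample space; the measurability of V as a map into
  \<open>L2 Q\<close> is proved from them.\<close>

definition U' :: "nat \<Rightarrow> 'w \<Rightarrow> 'a \<Rightarrow> real" where
  "U' m \<omega> x = (if tot \<omega> < \<infinity> then U m \<omega> x else 0)"

lemma U'_measurable_pair [measurable]: "(\<lambda>(\<omega>, x). U' m \<omega> x) \<in> borel_measurable (P \<Otimes>\<^sub>M Q)"
  unfolding U'_def split_beta' by measurable

lemma U'_L2: "\<omega> \<in> space P \<Longrightarrow> U' m \<omega> \<in> L2 Q"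
  using U_L2[of \<omega> m] L2_zero[of Q] by (cases "tot \<omega> < \<infinity>") (simp_all add: U'_def[abs_def])

lemma
  assumes \<omega>: "\<omega> \<in> space P"
  shows U'_V_integrable: "integrable Q (\<lambda>x. (U' m \<omega> x - V \<omega> x)\<^sup>2)"
    and U'_V_bound: "(LINT x|Q. (U' m \<omega> x - V \<omega> x)\<^sup>2) \<le> 4 * (1 / 4) ^ m * enn2real (tot \<omega>)"
proof -
  note [measurable] = V_measurable[OF \<omega>] dom_measurable[OF \<omega>] U'_L2[OF \<omega>, THEN measurable_L2]
  have *: "integrable Q (\<lambda>x. (U' m \<omega> x - V \<omega> x)\<^sup>2) \<and>
    (LINT x|Q. (U' m \<omega> x - V \<omega> x)\<^sup>2) \<le> 4 * (1 / 4) ^ m * enn2real (tot \<omega>)"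
  proof (cases "tot \<omega> < \<infinity>")
    case True
    have ae: "AE x in Q. dom \<omega> x < \<infinity>"
      using nn_integral_PInf_AE[of "dom \<omega>" Q] True unfolding tot_def by (simp add: less_top)
    have int: "integrable Q (\<lambda>x. enn2real (dom \<omega> x))"
      by (rule integrableI_nn_integral_finite[of _ _ "enn2real (tot \<omega>)"])
         (use ae True in \<open>auto simp: tot_def intro!: nn_integral_cong_AE\<close>)
    have eq: "(LINT x|Q. enn2real (dom \<omega> x)) = enn2real (tot \<omega>)"
    proof -
      have "(LINT x|Q. enn2real (dom \<omega> x)) = enn2real (\<integral>\<^sup>+x. ennreal (enn2real (dom \<omega> x)) \<partial>Q)"
        by (rule integral_eq_nn_integral) auto
      also have "(\<integral>\<^sup>+x. ennreal (enn2real (dom \<omega> x)) \<partial>Q) = tot \<omega>"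
        unfolding tot_def using ae by (intro nn_integral_cong_AE) auto
      finally show ?thesis .
    qed
    have b: "AE x in Q. (U' m \<omega> x - V \<omega> x)\<^sup>2 \<le> 4 * (1 / 4) ^ m * enn2real (dom \<omega> x)"
      using ae by eventually_elim (use U_V_bound[OF True] True in \<open>auto simp: U'_def\<close>)
    have i: "integrable Q (\<lambda>x. (U' m \<omega> x - V \<omega> x)\<^sup>2)"
      by (rule Bochner_Integration.integrable_bound[OF integrable_mult_right[OF int, of "4 * (1 / 4) ^ m"]])
         (use b in \<open>auto elim!: eventually_mono\<close>)
    have "(LINT x|Q. (U' m \<omega> x - V \<omega> x)\<^sup>2) \<le> (LINT x|Q. 4 * (1 / 4) ^ m * enn2real (dom \<omega> x))"
      by (rule integral_mono_AE[OF i integrable_mult_right[OF int] b])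
    then show ?thesis using i eq by simp
  qed (simp add: U'_def V_def)
  from * show "integrable Q (\<lambda>x. (U' m \<omega> x - V \<omega> x)\<^sup>2)"
    and "(LINT x|Q. (U' m \<omega> x - V \<omega> x)\<^sup>2) \<le> 4 * (1 / 4) ^ m * enn2real (tot \<omega>)" by auto
qed

lemma V_L2: "\<omega> \<in> space P \<Longrightarrow> V \<omega> \<in> L2 Q"
proof -
  assume \<omega>: "\<omega> \<in> space P"
  have "(\<lambda>x. U' 0 \<omega> x - V \<omega> x) \<in> L2 Q"
    unfolding L2_def using U'_V_integrable[OF \<omega>, of 0] V_measurable[OF \<omega>] U'_L2[OF \<omega>, of 0]
    by (auto simp: L2_def)
  from L2_diff[OF U'_L2[OF \<omega>, of 0] this] show ?thesis by simp
qed

lemma tot_integrable: "integrable P (\<lambda>\<omega>. enn2real (tot \<omega>))"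
proof (rule integrableI_nn_integral_finite[of _ _ "enn2real (\<integral>\<^sup>+\<omega>. tot \<omega> \<partial>P)"])
  have "(\<integral>\<^sup>+\<omega>. ennreal (enn2real (tot \<omega>)) \<partial>P) = (\<integral>\<^sup>+\<omega>. tot \<omega> \<partial>P)"
    using AE_tot_finite by (intro nn_integral_cong_AE) auto
  then show "(\<integral>\<^sup>+\<omega>. ennreal (enn2real (tot \<omega>)) \<partial>P) = ennreal (enn2real (\<integral>\<^sup>+\<omega>. tot \<omega> \<partial>P))"
    using tot_finite by simp
qed auto

lemma U_norm_integrable: "integrable P (\<lambda>\<omega>. LINT x|Q. (U m \<omega> x)\<^sup>2)"
  and U_norm_le: "(LINT \<omega>|P. LINT x|Q. (U m \<omega> x)\<^sup>2) \<le> 1"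
proof -
  have "(\<integral>\<^sup>+\<omega>. ennreal (LINT x|Q. (U m \<omega> x)\<^sup>2) \<partial>P) = (\<integral>\<^sup>+\<omega>. \<integral>\<^sup>+x. ennreal ((U m \<omega> x)\<^sup>2) \<partial>Q \<partial>P)"
    using U_L2 by (intro nn_integral_cong nn_integral_eq_integral[symmetric]) (auto simp: L2_def)
  also have "\<dots> = (\<integral>\<^sup>+x. \<integral>\<^sup>+\<omega>. ennreal ((U m \<omega> x)\<^sup>2) \<partial>P \<partial>Q)"
    by (rule PQ.Fubini'[symmetric]) measurable
  also have "\<dots> = (\<integral>\<^sup>+x. ennreal (K (t m x) (t m x)) \<partial>Q)"
    unfolding U_def by (intro nn_integral_cong moment) auto
  also have "\<dots> \<le> (\<integral>\<^sup>+x. 1 \<partial>Q)"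
    using K_bound by (intro nn_integral_mono) (auto simp: abs_le_iff ennreal_le_1)
  also have "\<dots> = 1" using Q.emeasure_space_1 by simp
  finally have le: "(\<integral>\<^sup>+\<omega>. ennreal (LINT x|Q. (U m \<omega> x)\<^sup>2) \<partial>P) \<le> 1" .
  show int: "integrable P (\<lambda>\<omega>. LINT x|Q. (U m \<omega> x)\<^sup>2)"
  proof (rule integrableI_bounded)
    show "(\<integral>\<^sup>+\<omega>. ennreal (norm (LINT x|Q. (U m \<omega> x)\<^sup>2)) \<partial>P) < \<infinity>"
      using le by (auto intro: le_less_trans)
  qed measurable
  then show "(LINT \<omega>|P. LINT x|Q. (U m \<omega> x)\<^sup>2) \<le> 1"
    using le nn_integral_eq_integral[OF int] by simp
qed

lemma V_norm_le: "\<omega> \<in> space P \<Longrightarrow> (LINT x|Q. (V \<omega> x)\<^sup>2) \<le> 2 * (LINT x|Q. (U 0 \<omega> x)\<^sup>2) + 8 * enn2real (tot \<omega>)"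
proof -
  assume \<omega>: "\<omega> \<in> space P"
  have iU: "integrable Q (\<lambda>x. (U' 0 \<omega> x)\<^sup>2)" using U'_L2[OF \<omega>] by (simp add: L2_def)
  have "(LINT x|Q. (V \<omega> x)\<^sup>2) \<le> (LINT x|Q. 2 * (U' 0 \<omega> x)\<^sup>2 + 2 * (U' 0 \<omega> x - V \<omega> x)\<^sup>2)"
  proof (rule integral_mono)
    show "(V \<omega> x)\<^sup>2 \<le> 2 * (U' 0 \<omega> x)\<^sup>2 + 2 * (U' 0 \<omega> x - V \<omega> x)\<^sup>2" for x
      using power2_diff_le[of 0 "V \<omega> x" "U' 0 \<omega> x"] by simp
  qed (use V_L2[OF \<omega>] iU U'_V_integrable[OF \<omega>, of 0] in \<open>auto simp: L2_def\<close>)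
  also have "\<dots> = 2 * (LINT x|Q. (U' 0 \<omega> x)\<^sup>2) + 2 * (LINT x|Q. (U' 0 \<omega> x - V \<omega> x)\<^sup>2)"
    using iU U'_V_integrable[OF \<omega>, of 0] by simp
  also have "(LINT x|Q. (U' 0 \<omega> x)\<^sup>2) \<le> (LINT x|Q. (U 0 \<omega> x)\<^sup>2)"
    using U_L2[OF \<omega>] iU by (intro integral_mono) (auto simp: U'_def L2_def)
  finally show ?thesis using U'_V_bound[OF \<omega>, of 0] by simp
qed

lemma V_norm_integrable: "integrable P (\<lambda>\<omega>. LINT x|Q. (V \<omega> x)\<^sup>2)"
proof (rule Bochner_Integration.integrable_bound)
  show "integrable P (\<lambda>\<omega>. 2 * (LINT x|Q. (U 0 \<omega> x)\<^sup>2) + 8 * enn2real (tot \<omega>))"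
    using U_norm_integrable tot_integrable by simp
  show "AE \<omega> in P. norm (LINT x|Q. (V \<omega> x)\<^sup>2) \<le> norm (2 * (LINT x|Q. (U 0 \<omega> x)\<^sup>2) + 8 * enn2real (tot \<omega>))"
  proof (rule AE_I2)
    fix \<omega> assume "\<omega> \<in> space P"
    from V_norm_le[OF this]
    show "norm (LINT x|Q. (V \<omega> x)\<^sup>2) \<le> norm (2 * (LINT x|Q. (U 0 \<omega> x)\<^sup>2) + 8 * enn2real (tot \<omega>))"
      by (simp add: abs_of_nonneg)
  qed
qed measurable

lemma
  shows U_V_norm_integrable: "integrable P (\<lambda>\<omega>. LINT x|Q. (U m \<omega> x - V \<omega> x)\<^sup>2)"
    and U_V_norm_le: "(LINT \<omega>|P. LINT x|Q. (U m \<omega> x - V \<omega> x)\<^sup>2) \<le> 4 * (1 / 4) ^ m * (LINT \<omega>|P. enn2real (tot \<omega>))"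
proof -
  have ae: "AE \<omega> in P. (LINT x|Q. (U m \<omega> x - V \<omega> x)\<^sup>2) \<le> 4 * (1 / 4) ^ m * enn2real (tot \<omega>)"
    using AE_tot_finite AE_space
  proof eventually_elim
    case (elim \<omega>)
    then show ?case using U'_V_bound[of \<omega> m] by (simp add: U'_def)
  qed
  show int: "integrable P (\<lambda>\<omega>. LINT x|Q. (U m \<omega> x - V \<omega> x)\<^sup>2)"
    by (rule Bochner_Integration.integrable_bound[OF integrable_mult_right[OF tot_integrable, of "4 * (1 / 4) ^ m"]])
       (use ae in \<open>auto elim!: eventually_mono simp: abs_of_nonneg\<close>)
  show "(LINT \<omega>|P. LINT x|Q. (U m \<omega> x - V \<omega> x)\<^sup>2) \<le> 4 * (1 / 4) ^ m * (LINT \<omega>|P. enn2real (tot \<omega>))"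
    using integral_mono_AE[OF int integrable_mult_right[OF tot_integrable] ae] by simp
qed

text \<open>A countable family that comes close to every path of V: arbitrary rational values on the
  finitely many cells of t m. Extensional functions keep the number of value assignments
  countable.\<close>

definition grid_funs :: "('a \<Rightarrow> real) set" where
  "grid_funs = (\<Union>m. (\<lambda>\<phi>. \<phi> \<circ> t m) ` (range (t m) \<rightarrow>\<^sub>E \<rat>))"

lemma V_measurable_L2: "V \<in> measurable P (borel_L2 Q)"
proof (rule measurable_borel_L2I)
  show "V \<omega> \<in> L2 Q" if "\<omega> \<in> space P" for \<omega> by (rule V_L2[OF that])
  show "(\<lambda>\<omega>. norm_L2 Q (\<lambda>x. V \<omega> x - w x)) \<in> borel_measurable P" if "w \<in> L2 Q" for w
    using measurable_L2[OF that, measurable] unfolding norm_L2_def inner_L2_def by measurable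
  show "countable grid_funs"
    unfolding grid_funs_def
    by (intro countable_UN countable_image countable_PiE finite_range_t countable_rat) auto
  show "grid_funs \<subseteq> L2 Q"
  proof
    fix w assume "w \<in> grid_funs"
    then obtain m \<phi> where w: "w = (\<lambda>x. \<phi> (t m x))" by (auto simp: grid_funs_def comp_def)
    have m: "w \<in> borel_measurable Q"
      unfolding w using simple_function_compose1[OF simple, of \<phi> m] by (rule borel_measurable_simple_function)
    have "finite ((\<lambda>y. (\<phi> y)\<^sup>2) ` range (t m))" using finite_range_t by blast
    then have "(w x)\<^sup>2 \<le> Max ((\<lambda>y. (\<phi> y)\<^sup>2) ` range (t m))" for x
      by (rule Max_ge) (auto simp: w)
    then show "w \<in> L2 Q"
      unfolding L2_def using m
      by (auto intro!: Q.integrable_const_bound[where B = "Max ((\<lambda>y. (\<phi> y)\<^sup>2) ` range (t m))"])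
  qed
  fix \<omega> and e :: real assume \<omega>: "\<omega> \<in> space P" and e: "0 < e"
  let ?r = "enn2real (tot \<omega>)"
  have "(\<lambda>m. 4 * (1 / 4) ^ m * ?r) \<longlonglongrightarrow> 4 * 0 * ?r"
    by (intro tendsto_intros LIMSEQ_power_zero) auto
  then have "eventually (\<lambda>m. 4 * (1 / 4) ^ m * ?r < e\<^sup>2 / 4) sequentially"
    using e by (intro order_tendstoD(2)) auto
  \<comment> \<open>A quarter, because \<open>norm_L2_diff_le\<close> doubles both the distance from
    V to U' and the rounding to rational values, each at most e^2 / 4.\<close>
  then obtain m where m: "4 * (1 / 4) ^ m * ?r < e\<^sup>2 / 4"
    by (auto simp: eventually_sequentially)
  define a where "a y = (if tot \<omega> < \<infinity> then g y \<omega> else 0)" for y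
  have "\<exists>q\<in>\<rat>. \<bar>a y - q\<bar> < e / 2" for y
  proof -
    obtain r where "a y - e / 2 < of_rat r" "of_rat r < a y"
      using of_rat_dense[of "a y - e / 2" "a y"] e by auto
    then show ?thesis by (intro bexI[of _ "of_rat r"]) auto
  qed
  then obtain q where q: "\<And>y. q y \<in> \<rat>" "\<And>y. \<bar>a y - q y\<bar> < e / 2" by metis
  define w where "w = restrict q (range (t m)) \<circ> t m"
  have w: "w \<in> grid_funs"
  proof -
    have "restrict q (range (t m)) \<in> range (t m) \<rightarrow>\<^sub>E \<rat>" using q(1) by simp
    from imageI[OF this, of "\<lambda>\<phi>. \<phi> \<circ> t m"] show ?thesis
      unfolding w_def grid_funs_def by (rule UN_I[OF UNIV_I])
  qed
  have wx: "w x = q (t m x)" for x by (simp add: w_def)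
  have ux: "U' m \<omega> x = a (t m x)" for x by (simp add: U'_def U_def a_def)
  have wL: "w \<in> L2 Q" using \<open>grid_funs \<subseteq> L2 Q\<close> w by blast
  have "(norm_L2 Q (\<lambda>x. V \<omega> x - w x))\<^sup>2 \<le>
      2 * (norm_L2 Q (\<lambda>x. V \<omega> x - U' m \<omega> x))\<^sup>2 + 2 * (norm_L2 Q (\<lambda>x. U' m \<omega> x - w x))\<^sup>2"
    by (rule norm_L2_diff_le[OF V_L2[OF \<omega>] U'_L2[OF \<omega>] wL])
  also have "(norm_L2 Q (\<lambda>x. V \<omega> x - U' m \<omega> x))\<^sup>2 = (LINT x|Q. (U' m \<omega> x - V \<omega> x)\<^sup>2)"
    unfolding power2_norm_L2 by (simp add: power2_commute)
  also have "\<dots> < e\<^sup>2 / 4"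
    using U'_V_bound[OF \<omega>, of m] m by linarith
  also have "(norm_L2 Q (\<lambda>x. U' m \<omega> x - w x))\<^sup>2 \<le> e\<^sup>2 / 4"
  proof -
    have "(U' m \<omega> x - w x)\<^sup>2 \<le> e\<^sup>2 / 4" for x
      using power_mono[OF less_imp_le[OF q(2)[of "t m x"]], of 2] by (simp add: ux wx power_divide)
    then have "(LINT x|Q. (U' m \<omega> x - w x)\<^sup>2) \<le> (LINT x|Q. e\<^sup>2 / 4)"
      using L2_diff[OF U'_L2[OF \<omega>, of m] wL] by (intro integral_mono) (auto simp: L2_def)
    then show ?thesis unfolding power2_norm_L2 by (simp add: Q.prob_space)
  qed
  finally have "(norm_L2 Q (\<lambda>x. V \<omega> x - w x))\<^sup>2 < e\<^sup>2" by simp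
  then have "norm_L2 Q (\<lambda>x. V \<omega> x - w x) < e"
    using e by (simp add: power2_less_imp_less)
  then show "\<exists>w\<in>grid_funs. norm_L2 Q (\<lambda>x. V \<omega> x - w x) < e" using w by blast
qed

text \<open>The mass of the cell of y under the signed measure with Q-density h. It is the
  coefficient of \<open>g y\<close> in the inner product of U m with h.\<close>

definition \<theta> :: "nat \<Rightarrow> ('a \<Rightarrow> real) \<Rightarrow> 'a \<Rightarrow> real" where
  "\<theta> m h y = (LINT x|Q. indicator {x. t m x = y} x * h x)"

lemma integral_t:
  fixes F :: "'a \<Rightarrow> real"
  assumes h: "h \<in> L2 Q"
  shows "(LINT x|Q. F (t m x) * h x) = (\<Sum>y\<in>range (t m). F y * \<theta> m h y)"
proof -
  note [measurable] = measurable_L2[OF h]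
  have int: "integrable Q (\<lambda>x. indicator {x. t m x = y} x * h x)" for y
    by (rule Bochner_Integration.integrable_bound[OF integrable_L2[OF h]]) (auto split: split_indicator)
  have "(LINT x|Q. F (t m x) * h x) = (LINT x|Q. (\<Sum>y\<in>range (t m). F y * (indicator {x. t m x = y} x * h x)))"
    by (intro Bochner_Integration.integral_cong refl, subst range_t_sum[of F m])
       (simp add: sum_distrib_left sum_distrib_right ac_simps)
  also have "\<dots> = (\<Sum>y\<in>range (t m). F y * \<theta> m h y)"
    using int by (subst Bochner_Integration.integral_sum) (auto simp: \<theta>_def)
  finally show ?thesis .
qed

text \<open>The left side is the variance of the inner product of U m with h. Since |K| \<le> 1, the
  inner integral is dominated by |h| and the outer one by a multiple of |h|.\<close>

lemma kform_t_tendsto: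
  assumes h: "h \<in> L2 Q"
  shows "(\<lambda>m. \<Sum>y\<in>range (t m). \<Sum>z\<in>range (t m). \<theta> m h y * \<theta> m h z * K y z) \<longlonglongrightarrow> kform h h"
proof -
  note [measurable] = measurable_L2[OF h]
  have eq: "(\<Sum>y\<in>range (t m). \<Sum>z\<in>range (t m). \<theta> m h y * \<theta> m h z * K y z) =
      (LINT x|Q. (LINT x'|Q. K (t m x) (t m x') * h x') * h x)" for m
    using integral_t[OF h, of "\<lambda>y. LINT x'|Q. K y (t m x') * h x'" m]
    unfolding integral_t[OF h, of "K _" m] by (simp add: sum_distrib_right sum_distrib_left ac_simps)
  have bnd: "integrable Q (\<lambda>x'. K (X x') (Y x') * h x') \<and> \<bar>LINT x'|Q. K (X x') (Y x') * h x'\<bar> \<le> (LINT x'|Q. \<bar>h x'\<bar>)"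
    if [measurable]: "X \<in> measurable Q Q" "Y \<in> measurable Q Q" for X Y
  proof
    show int: "integrable Q (\<lambda>x'. K (X x') (Y x') * h x')"
      by (rule Bochner_Integration.integrable_bound[OF integrable_L2[OF h]]) (use K_mult_le in auto)
    have "\<bar>LINT x'|Q. K (X x') (Y x') * h x'\<bar> \<le> (LINT x'|Q. \<bar>K (X x') (Y x') * h x'\<bar>)"
      by (rule integral_abs_bound)
    also have "\<dots> \<le> (LINT x'|Q. \<bar>h x'\<bar>)"
      using int integrable_L2[OF h] K_mult_le by (intro integral_mono) auto
    finally show "\<bar>LINT x'|Q. K (X x') (Y x') * h x'\<bar> \<le> (LINT x'|Q. \<bar>h x'\<bar>)" .
  qed
  have inner: "(\<lambda>m. LINT x'|Q. K (t m x) (t m x') * h x') \<longlonglongrightarrow> (LINT x'|Q. K x x' * h x')" for x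
  proof (rule integral_dominated_convergence)
    show "integrable Q (\<lambda>x'. \<bar>h x'\<bar>)" using integrable_L2[OF h] by simp
    show "AE x' in Q. (\<lambda>m. K (t m x) (t m x') * h x') \<longlonglongrightarrow> K x x' * h x'"
      by (intro AE_I2 tendsto_intros K_tendsto t_tendsto)
  qed (use K_mult_le in auto)
  have "(\<lambda>m. LINT x|Q. (LINT x'|Q. K (t m x) (t m x') * h x') * h x) \<longlonglongrightarrow> (LINT x|Q. (LINT x'|Q. K x x' * h x') * h x)"
  proof (rule integral_dominated_convergence)
    show "integrable Q (\<lambda>x. (LINT x'|Q. \<bar>h x'\<bar>) * \<bar>h x\<bar>)" using integrable_L2[OF h] by simp
    show "AE x in Q. (\<lambda>m. (LINT x'|Q. K (t m x) (t m x') * h x') * h x) \<longlonglongrightarrow> (LINT x'|Q. K x x' * h x') * h x"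
      by (intro AE_I2 tendsto_intros inner)
    show "AE x in Q. norm ((LINT x'|Q. K (t m x) (t m x') * h x') * h x) \<le> (LINT x'|Q. \<bar>h x'\<bar>) * \<bar>h x\<bar>" for m
      using bnd[of "\<lambda>_. t m _" "t m"] by (intro AE_I2) (auto simp: abs_mult intro!: mult_right_mono)
  qed measurable
  also have "(LINT x|Q. (LINT x'|Q. K x x' * h x') * h x) = kform h h"
    unfolding kform_def integral_mult_left_zero[symmetric]
    by (intro Bochner_Integration.integral_cong refl) (simp add: ac_simps)
  finally show ?thesis unfolding eq .
qed

section \<open>Normality of the linear functionals and the covariance operator\<close>

lemma inner_V_measurable: "h \<in> L2 Q \<Longrightarrow> (\<lambda>\<omega>. inner_L2 Q (V \<omega>) h) \<in> borel_measurable P"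
  using measurable_L2[of h, measurable] unfolding inner_L2_def by measurable

text \<open>The product is split by |a b| \<le> p a^2 + b^2 / p with p = 2^m: the squared distance
  of U' from V is of order 1 / 4^m, so both parts are of order 1 / 2^m.\<close>

lemma inner_U'_tendsto:
  assumes h: "h \<in> L2 Q" and \<omega>: "\<omega> \<in> space P"
  shows "(\<lambda>m. inner_L2 Q (U' m \<omega>) h) \<longlonglongrightarrow> inner_L2 Q (V \<omega>) h"
proof -
  let ?b = "\<lambda>m. 4 * (1 / 2) ^ m * enn2real (tot \<omega>) + (1 / 2) ^ m * (LINT x|Q. (h x)\<^sup>2)"
  have le: "\<bar>inner_L2 Q (U' m \<omega>) h - inner_L2 Q (V \<omega>) h\<bar> \<le> ?b m" for m
  proof -
    have ih: "integrable Q (\<lambda>x. (h x)\<^sup>2)" using h by (simp add: L2_def)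
    have "inner_L2 Q (U' m \<omega>) h - inner_L2 Q (V \<omega>) h = (LINT x|Q. (U' m \<omega> x - V \<omega> x) * h x)"
      unfolding inner_L2_def using L2_mult_integrable[OF U'_L2[OF \<omega>] h] L2_mult_integrable[OF V_L2[OF \<omega>] h]
      by (simp add: left_diff_distrib)
    also have "\<bar>\<dots>\<bar> \<le> (LINT x|Q. \<bar>(U' m \<omega> x - V \<omega> x) * h x\<bar>)"
      by (rule integral_abs_bound)
    also have "\<dots> \<le> (LINT x|Q. 2 ^ m * (U' m \<omega> x - V \<omega> x)\<^sup>2 + (1 / 2) ^ m * (h x)\<^sup>2)"
    proof (rule integral_mono)
      show "integrable Q (\<lambda>x. \<bar>(U' m \<omega> x - V \<omega> x) * h x\<bar>)"
        by (intro integrable_abs L2_mult_integrable L2_diff U'_L2 V_L2 h \<omega>)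
      show "integrable Q (\<lambda>x. 2 ^ m * (U' m \<omega> x - V \<omega> x)\<^sup>2 + (1 / 2) ^ m * (h x)\<^sup>2)"
        using U'_V_integrable[OF \<omega>] ih by simp
      fix x
      have "\<bar>a * b\<bar> \<le> p * a\<^sup>2 + (1 / p) * b\<^sup>2" if "0 < p" for a b p :: real
      proof -
        have "2 * (\<bar>sqrt p * a\<bar> * \<bar>b / sqrt p\<bar>) \<le> (sqrt p * a)\<^sup>2 + (b / sqrt p)\<^sup>2"
          using sum_squares_bound[of "\<bar>sqrt p * a\<bar>" "\<bar>b / sqrt p\<bar>"]
          unfolding power2_abs by (simp only: mult.assoc)
        then have "2 * (\<bar>a\<bar> * \<bar>b\<bar>) \<le> p * a\<^sup>2 + (1 / p) * b\<^sup>2"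
          using that by (simp add: abs_mult power_mult_distrib power_divide)
        moreover have "0 \<le> \<bar>a\<bar> * \<bar>b\<bar>" by simp
        ultimately show ?thesis unfolding abs_mult by linarith
      qed
      from this[of "2 ^ m" "U' m \<omega> x - V \<omega> x" "h x"]
      show "\<bar>(U' m \<omega> x - V \<omega> x) * h x\<bar> \<le> 2 ^ m * (U' m \<omega> x - V \<omega> x)\<^sup>2 + (1 / 2) ^ m * (h x)\<^sup>2"
        by (simp add: power_one_over)
    qed
    also have "\<dots> = 2 ^ m * (LINT x|Q. (U' m \<omega> x - V \<omega> x)\<^sup>2) + (1 / 2) ^ m * (LINT x|Q. (h x)\<^sup>2)"
      using U'_V_integrable[OF \<omega>] ih by simp
    also have "2 ^ m * (LINT x|Q. (U' m \<omega> x - V \<omega> x)\<^sup>2) \<le> 2 ^ m * (4 * (1 / 4) ^ m * enn2real (tot \<omega>))"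
      by (intro mult_left_mono U'_V_bound \<omega>) simp
    also have "2 ^ m * (4 * (1 / 4) ^ m * enn2real (tot \<omega>)) = 4 * (2 * (1 / 4)) ^ m * enn2real (tot \<omega>)"
      unfolding power_mult_distrib by (simp only: ac_simps)
    finally show ?thesis by simp
  qed
  have "?b \<longlonglongrightarrow> 4 * 0 * enn2real (tot \<omega>) + 0 * (LINT x|Q. (h x)\<^sup>2)"
    by (intro tendsto_intros LIMSEQ_power_zero) auto
  then have "?b \<longlonglongrightarrow> 0" by simp
  then have "(\<lambda>m. inner_L2 Q (U' m \<omega>) h - inner_L2 Q (V \<omega>) h) \<longlonglongrightarrow> 0"
    by (rule Lim_null_comparison[rotated]) (use le in \<open>auto intro!: always_eventually\<close>)
  then show ?thesis by (simp add: LIM_zero_iff)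
qed

text \<open>For U m the functional is a finite linear combination of values of g, hence normal. Its
  characteristic function and its variance both pass to the limit.\<close>

lemma normal_inner_V:
  assumes h: "h \<in> L2 Q"
  shows "normal_var P (\<lambda>\<omega>. inner_L2 Q (V \<omega>) h) (kform h h)"
  unfolding normal_var_def
proof (intro conjI allI)
  note [measurable] = measurable_L2[OF h] inner_V_measurable[OF h]
  show "(\<lambda>\<omega>. inner_L2 Q (V \<omega>) h) \<in> borel_measurable P" by measurable
  let ?v = "\<lambda>m. \<Sum>y\<in>range (t m). \<Sum>z\<in>range (t m). \<theta> m h y * \<theta> m h z * K y z"
  have n: "normal_var P (\<lambda>\<omega>. \<Sum>y\<in>range (t m). \<theta> m h y * g y \<omega>) (?v m)" for m
    by (rule normal[OF finite_range_t]) auto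
  show "0 \<le> kform h h"
    using n by (intro LIMSEQ_le_const[OF kform_t_tendsto[OF h]]) (auto simp: normal_var_def)
  fix a :: real
  have "(\<lambda>m. LINT \<omega>|P. iexp (a * inner_L2 Q (U' m \<omega>) h)) \<longlonglongrightarrow> (LINT \<omega>|P. iexp (a * inner_L2 Q (V \<omega>) h))"
  proof (rule integral_dominated_convergence)
    show "integrable P (\<lambda>_. 1::real)" by simp
    show "AE \<omega> in P. (\<lambda>m. iexp (a * inner_L2 Q (U' m \<omega>) h)) \<longlonglongrightarrow> iexp (a * inner_L2 Q (V \<omega>) h)"
      by (intro AE_I2 tendsto_intros inner_U'_tendsto h)
    show "(\<lambda>\<omega>. iexp (a * inner_L2 Q (U' m \<omega>) h)) \<in> borel_measurable P" for m
      unfolding inner_L2_def by measurable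
  qed (auto simp del: of_real_mult)
  moreover have "(LINT \<omega>|P. iexp (a * inner_L2 Q (U' m \<omega>) h)) = of_real (exp (- (?v m * a\<^sup>2) / 2))" for m
  proof -
    have "(LINT \<omega>|P. iexp (a * inner_L2 Q (U' m \<omega>) h)) = (LINT \<omega>|P. iexp (a * (\<Sum>y\<in>range (t m). \<theta> m h y * g y \<omega>)))"
    proof (rule integral_cong_AE)
      show "AE \<omega> in P. iexp (a * inner_L2 Q (U' m \<omega>) h) = iexp (a * (\<Sum>y\<in>range (t m). \<theta> m h y * g y \<omega>))"
        using AE_tot_finite
      proof eventually_elim
        case (elim \<omega>)
        then have "inner_L2 Q (U' m \<omega>) h = (LINT x|Q. g (t m x) \<omega> * h x)"
          by (simp add: inner_L2_def U'_def U_def)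
        also have "\<dots> = (\<Sum>y\<in>range (t m). \<theta> m h y * g y \<omega>)"
          using integral_t[OF h, of "\<lambda>y. g y \<omega>" m] by (simp add: mult.commute)
        finally show ?case by simp
      qed
      show "(\<lambda>\<omega>. iexp (a * inner_L2 Q (U' m \<omega>) h)) \<in> borel_measurable P"
        unfolding inner_L2_def by measurable
      show "(\<lambda>\<omega>. iexp (a * (\<Sum>y\<in>range (t m). \<theta> m h y * g y \<omega>))) \<in> borel_measurable P"
        using normal_var_measurable[OF n, measurable] by measurable
    qed
    then show ?thesis using n[of m] unfolding normal_var_def by (simp only:)
  qed
  ultimately have "(\<lambda>m. of_real (exp (- (?v m * a\<^sup>2) / 2))) \<longlonglongrightarrow> (LINT \<omega>|P. iexp (a * inner_L2 Q (V \<omega>) h))"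
    by (simp only:)
  moreover have "(\<lambda>m. complex_of_real (exp (- (?v m * a\<^sup>2) / 2))) \<longlonglongrightarrow> complex_of_real (exp (- (kform h h * a\<^sup>2) / 2))"
    by (intro tendsto_intros kform_t_tendsto h) simp_all
  ultimately show "(LINT \<omega>|P. iexp (a * inner_L2 Q (V \<omega>) h)) = of_real (exp (- (kform h h * a\<^sup>2) / 2))"
    by (rule LIMSEQ_unique)
qed

text \<open>A linear combination of two functionals is the functional of the combined h; the mixed
  moment \<open>E_ZW\<close> of the pair then identifies the covariance.\<close>

lemma kform_normal_pair:
  assumes h: "h \<in> L2 Q" and h': "h' \<in> L2 Q"
  shows "normal_pair P (\<lambda>\<omega>. inner_L2 Q (V \<omega>) h) (\<lambda>\<omega>. inner_L2 Q (V \<omega>) h') (kform h h) (kform h h') (kform h' h')"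
proof
  fix \<alpha> \<beta> :: real
  have L: "(\<lambda>x. \<alpha> * h x + \<beta> * h' x) \<in> L2 Q" by (intro L2_add L2_scale h h')
  have "normal_var P (\<lambda>\<omega>. inner_L2 Q (V \<omega>) (\<lambda>x. \<alpha> * h x + \<beta> * h' x))
      (\<alpha>\<^sup>2 * kform h h + 2 * \<alpha> * \<beta> * kform h h' + \<beta>\<^sup>2 * kform h' h')"
    using normal_inner_V[OF L] unfolding kform_quadratic[OF h h'] .
  moreover have "inner_L2 Q (V \<omega>) (\<lambda>x. \<alpha> * h x + \<beta> * h' x) = \<alpha> * inner_L2 Q (V \<omega>) h + \<beta> * inner_L2 Q (V \<omega>) h'"
    if "\<omega> \<in> space P" for \<omega>
    by (rule inner_L2_linear[OF V_L2[OF that] h h'])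
  ultimately show "normal_var P (\<lambda>\<omega>. \<alpha> * inner_L2 Q (V \<omega>) h + \<beta> * inner_L2 Q (V \<omega>) h')
     (\<alpha>\<^sup>2 * kform h h + 2 * \<alpha> * \<beta> * kform h h' + \<beta>\<^sup>2 * kform h' h')"
    unfolding normal_var_def
    by (simp cong: measurable_cong Bochner_Integration.integral_cong del: of_real_mult)
qed

lemma has_cov_kernel_V: "has_cov_kernel Q P V K"
  unfolding has_cov_kernel_def
proof (intro ballI conjI)
  fix h h' assume h: "h \<in> L2 Q" and h': "h' \<in> L2 Q"
  interpret hh: normal_pair P "\<lambda>\<omega>. inner_L2 Q (V \<omega>) h" "\<lambda>\<omega>. inner_L2 Q (V \<omega>) h'" "kform h h" "kform h h'" "kform h' h'"
    by (rule kform_normal_pair[OF h h'])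
  show "integrable P (\<lambda>\<omega>. inner_L2 Q (V \<omega>) h * inner_L2 Q (V \<omega>) h')"
    using hh.int_ZW[of 1 1] by simp
  show "(LINT \<omega>|P. inner_L2 Q (V \<omega>) h * inner_L2 Q (V \<omega>) h') = (LINT f|Q. LINT g|Q. K f g * h f * h' g)"
    using hh.E_ZW by (simp add: kform_def)
qed

lemma bessel_L2:
  assumes v: "v \<in> L2 Q" and F: "finite F" "F \<subseteq> L2 Q"
    and norm: "\<And>e. e \<in> F \<Longrightarrow> norm_L2 Q e = 1"
    and orth: "\<And>e e'. e \<in> F \<Longrightarrow> e' \<in> F \<Longrightarrow> e \<noteq> e' \<Longrightarrow> inner_L2 Q e e' = 0"
  shows "(\<Sum>e\<in>F. (inner_L2 Q v e)\<^sup>2) \<le> (LINT x|Q. (v x)\<^sup>2)"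
proof -
  let ?c = "\<lambda>e. inner_L2 Q v e"
  have one: "inner_L2 Q e e = 1" if "e \<in> F" for e
    using norm[OF that] by (simp add: norm_L2_def)
  have iv: "integrable Q (\<lambda>x. (v x)\<^sup>2)" using v by (simp add: L2_def)
  have i1: "integrable Q (\<lambda>x. v x * e x)" if "e \<in> F" for e
    using that F v by (intro L2_mult_integrable) auto
  have i2: "integrable Q (\<lambda>x. e x * e' x)" if "e \<in> F" "e' \<in> F" for e e'
    using that F by (intro L2_mult_integrable) auto
  have "0 \<le> (LINT x|Q. (v x - (\<Sum>e\<in>F. ?c e * e x))\<^sup>2)" by simp
  also have "\<dots> = (LINT x|Q. (v x)\<^sup>2 - 2 * (\<Sum>e\<in>F. ?c e * (v x * e x)) + (\<Sum>e\<in>F. \<Sum>e'\<in>F. ?c e * ?c e' * (e x * e' x)))"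
  proof (intro Bochner_Integration.integral_cong refl)
    fix x
    show "(v x - (\<Sum>e\<in>F. ?c e * e x))\<^sup>2 = (v x)\<^sup>2 - 2 * (\<Sum>e\<in>F. ?c e * (v x * e x)) + (\<Sum>e\<in>F. \<Sum>e'\<in>F. ?c e * ?c e' * (e x * e' x))"
      unfolding power2_diff
      by (simp add: power2_eq_square[of "sum _ _"] sum_product sum_distrib_left ac_simps)
  qed
  also have "\<dots> = (LINT x|Q. (v x)\<^sup>2) - 2 * (\<Sum>e\<in>F. ?c e * (LINT x|Q. v x * e x)) +
      (\<Sum>e\<in>F. \<Sum>e'\<in>F. ?c e * ?c e' * (LINT x|Q. e x * e' x))"
    using iv i1 i2 by (simp add: Bochner_Integration.integral_sum)
  also have "\<dots> = (LINT x|Q. (v x)\<^sup>2) - 2 * (\<Sum>e\<in>F. ?c e * ?c e) + (\<Sum>e\<in>F. \<Sum>e'\<in>F. ?c e * ?c e' * inner_L2 Q e e')"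
    by (simp add: inner_L2_def)
  also have "(\<Sum>e\<in>F. \<Sum>e'\<in>F. ?c e * ?c e' * inner_L2 Q e e') = (\<Sum>e\<in>F. ?c e * ?c e)"
  proof (rule sum.cong[OF refl])
    fix e assume e: "e \<in> F"
    have "(\<Sum>e'\<in>F. ?c e * ?c e' * inner_L2 Q e e') = (\<Sum>e'\<in>{e}. ?c e * ?c e' * inner_L2 Q e e')"
      using e F orth[OF e] by (intro sum.mono_neutral_right) auto
    then show "(\<Sum>e'\<in>F. ?c e * ?c e' * inner_L2 Q e e') = ?c e * ?c e" using one[OF e] by simp
  qed
  finally show ?thesis by (simp add: power2_eq_square)
qed

text \<open>A diagonal entry is the variance of the inner product of V with a basis vector. Finite
  sums of them are means of Bessel sums, hence at most the mean squared norm of V, whichever vectors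
  are chosen.\<close>

lemma kop_trace_class: "pos_sym_trace_class_L2 Q kop"
  unfolding pos_sym_trace_class_L2_def
proof (intro conjI ballI allI impI)
  fix f h assume f: "f \<in> L2 Q" and h: "h \<in> L2 Q"
  show "AE x in Q. kop (\<lambda>y. a * f y + b * h y) x = a * kop f x + b * kop h x" for a b
    by (simp add: kop_linear[OF f h])
  show "inner_L2 Q (kop f) h = inner_L2 Q f (kop h)"
    using kform_sym[OF h f] by (simp add: kform_eq_inner inner_L2_commute[of Q f])
next
  show "\<exists>B. \<forall>f\<in>L2 Q. norm_L2 Q (kop f) \<le> B * norm_L2 Q f"
  proof (intro exI[of _ 1] ballI)
    fix f assume f: "f \<in> L2 Q"
    have i: "integrable Q (\<lambda>x. \<bar>f x\<bar>)" using integrable_L2[OF f] by simp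
    have i2: "integrable Q (\<lambda>x. \<bar>f x\<bar>\<^sup>2)" using f by (simp add: L2_def)
    have "(kop f x)\<^sup>2 \<le> (LINT y|Q. \<bar>f y\<bar>)\<^sup>2" for x
      using kop_le[OF f, of x] by (metis abs_ge_zero power2_abs power_mono)
    then have "(LINT x|Q. (kop f x)\<^sup>2) \<le> (LINT x|Q. (LINT y|Q. \<bar>f y\<bar>)\<^sup>2)"
      using kop_L2[OF f] by (intro integral_mono) (auto simp: L2_def)
    also have "\<dots> = (LINT y|Q. \<bar>f y\<bar>)\<^sup>2" by (simp add: Q.prob_space)
    \<comment> \<open>Jensen's inequality, read off from the nonnegative variance of |f| under
      Q.\<close>
    also have "\<dots> \<le> (LINT y|Q. \<bar>f y\<bar>\<^sup>2)"
      using Q.variance_positive[of "\<lambda>x. \<bar>f x\<bar>"] Q.variance_eq[OF i i2] by simp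
    finally have "(norm_L2 Q (kop f))\<^sup>2 \<le> (norm_L2 Q f)\<^sup>2"
      unfolding power2_norm_L2 by simp
    then show "norm_L2 Q (kop f) \<le> 1 * norm_L2 Q f"
      using norm_L2_nonneg unfolding mult_1 by (rule power2_le_imp_le)
  qed
next
  fix B assume B: "orthonormal_basis_L2 Q B"
  have nn: "0 \<le> inner_L2 Q (kop e) e" if "e \<in> B" for e
    using normal_inner_V[of e] that B
    by (auto simp: normal_var_def kform_eq_inner orthonormal_basis_L2_def)
  have bound: "(\<Sum>e\<in>F. inner_L2 Q (kop e) e) \<le> (LINT \<omega>|P. LINT x|Q. (V \<omega> x)\<^sup>2)" if F: "finite F" "F \<subseteq> B" for F
  proof -
    have FL: "F \<subseteq> L2 Q" using F B by (auto simp: orthonormal_basis_L2_def)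
    have "(\<Sum>e\<in>F. inner_L2 Q (kop e) e) = (\<Sum>e\<in>F. (LINT \<omega>|P. (inner_L2 Q (V \<omega>) e)\<^sup>2))"
      using FL P.normal_var_moment_even[OF normal_inner_V, of _ 1]
      by (intro sum.cong refl) (auto simp: kform_eq_inner subset_iff)
    also have "\<dots> = (LINT \<omega>|P. (\<Sum>e\<in>F. (inner_L2 Q (V \<omega>) e)\<^sup>2))"
      using FL P.normal_var_integrable_power[OF normal_inner_V, of _ 2]
      by (intro Bochner_Integration.integral_sum[symmetric]) auto
    also have "\<dots> \<le> (LINT \<omega>|P. LINT x|Q. (V \<omega> x)\<^sup>2)"
    proof (rule integral_mono)
      show "integrable P (\<lambda>\<omega>. \<Sum>e\<in>F. (inner_L2 Q (V \<omega>) e)\<^sup>2)"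
        using FL P.normal_var_integrable_power[OF normal_inner_V, of _ 2]
        by (intro Bochner_Integration.integrable_sum) auto
      show "(\<Sum>e\<in>F. (inner_L2 Q (V \<omega>) e)\<^sup>2) \<le> (LINT x|Q. (V \<omega> x)\<^sup>2)" if "\<omega> \<in> space P" for \<omega>
        using F B by (intro bessel_L2 V_L2 that FL) (auto simp: orthonormal_basis_L2_def subset_iff)
    qed (rule V_norm_integrable)
    finally show ?thesis .
  qed
  show "(\<lambda>e. inner_L2 Q (kop e) e) summable_on B"
    by (rule nonneg_bdd_above_summable_on) (use nn bound in \<open>auto intro!: bdd_aboveI2\<close>)
next
  show "0 \<le> inner_L2 Q (kop f) f" if "f \<in> L2 Q" for f
    using normal_inner_V[OF that] by (auto simp: normal_var_def kform_eq_inner)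
qed (rule kop_L2)

lemma centred_gaussian_V: "centred_gaussian_L2 Q P V"
  unfolding centred_gaussian_L2_def
proof (intro conjI exI[of _ kop] ballI)
  fix f assume f: "f \<in> L2 Q"
  have "(LINT \<omega>|P. iexp (1 * inner_L2 Q (V \<omega>) f)) = of_real (exp (- (kform f f * 1\<^sup>2) / 2))"
    using normal_inner_V[OF f] unfolding normal_var_def by blast
  then show "(LINT \<omega>|P. iexp (inner_L2 Q (V \<omega>) f)) = exp (- of_real (inner_L2 Q (kop f) f) / 2)"
    by (simp add: kform_eq_inner exp_of_real[symmetric])
qed (rule V_measurable_L2 kop_trace_class)+

end

text \<open>For every pointwise approximation of the identity by simple functions the mean of
  \<open>kdist\<close> tends to zero; a subsequence attains the required rate.\<close>

lemma (in cov_kernel) gaussian_approx_exists: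
  fixes \<iota> :: "nat \<Rightarrow> 'i"
  assumes \<iota>: "inj \<iota>"
  obtains t g where "gaussian_approx Q K (\<Pi>\<^sub>M i\<in>(UNIV::'i set). std_normal_distribution) t g"
proof -
  let ?P = "\<Pi>\<^sub>M i\<in>(UNIV::'i set). std_normal_distribution"
  have "(\<lambda>x. x) \<in> borel_measurable Q"
    by (simp cong: measurable_cong_sets add: sets_Q)
  from borel_measurable_implies_sequence_metric[OF this, of undefined]
  obtain s where s: "\<And>i. simple_function Q (s i)" "\<And>x. (\<lambda>i. s i x) \<longlonglongrightarrow> x"
    by auto
  have [measurable]: "s i \<in> measurable Q Q" for i
  proof -
    have "s i \<in> borel_measurable Q"
      by (rule borel_measurable_simple_function[OF s(1)])
    then show ?thesis by (simp cong: measurable_cong_sets add: sets_Q)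
  qed
  have "(\<lambda>i. LINT x|Q. kdist x (s i x)) \<longlonglongrightarrow> (LINT x|Q. 0)"
  proof (rule integral_dominated_convergence)
    show "integrable Q (\<lambda>x. 4 :: real)" by simp
    show "AE x in Q. (\<lambda>i. kdist x (s i x)) \<longlonglongrightarrow> 0" by (intro AE_I2 kdist_tendsto s)
    show "AE x in Q. norm (kdist x (s i x)) \<le> 4" for i
      using kdist_nonneg kdist_le4 by auto
    show "(\<lambda>x. kdist x (s i x)) \<in> borel_measurable Q" for i
      unfolding kdist_def by measurable
  qed simp
  then have lim: "(\<lambda>i. LINT x|Q. kdist x (s i x)) \<longlonglongrightarrow> 0" by simp
  \<comment> \<open>Asking for i \<ge> m makes the chosen indices tend to infinity, so that
    pointwise convergence is kept.\<close>
  have "\<exists>i\<ge>m. (LINT x|Q. kdist x (s i x)) \<le> (1 / 16) ^ m" for m :: nat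
  proof -
    have "eventually (\<lambda>i. (LINT x|Q. kdist x (s i x)) < (1 / 16) ^ m) sequentially"
      by (rule order_tendstoD(2)[OF lim]) simp
    then have "eventually (\<lambda>i. i \<ge> m \<and> (LINT x|Q. kdist x (s i x)) < (1 / 16) ^ m) sequentially"
      using eventually_ge_at_top[of m] by eventually_elim auto
    then show ?thesis by (auto simp: eventually_sequentially intro: less_imp_le)
  qed
  then obtain r where r: "\<And>m. r m \<ge> m" "\<And>m. (LINT x|Q. kdist x (s (r m) x)) \<le> (1 / 16) ^ m"
    by metis
  define t where "t m = s (r m)" for m
  have "filterlim r at_top sequentially"
    using r(1) by (intro filterlim_at_top_mono[OF filterlim_ident]) auto
  then have t: "(\<lambda>m. t m x) \<longlonglongrightarrow> x" for x
    unfolding t_def using filterlim_compose[OF s(2)] by blast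
  have "finite (range (t m))" for m
    using simple_functionD(1)[OF s(1)] by (simp add: t_def)
  then have "countable (\<Union>m. range (t m))"
    by (intro countable_UN uncountable_infinite) (auto intro: countable_finite)
  then obtain g where "\<And>A c. finite A \<Longrightarrow> A \<subseteq> (\<Union>m. range (t m)) \<Longrightarrow>
      normal_var ?P (\<lambda>\<omega>. \<Sum>x\<in>A. c x * g x \<omega>) (\<Sum>x\<in>A. \<Sum>y\<in>A. c x * c y * K x y)"
    using gaussian_process_countable[OF K_psd _ \<iota>] by blast
  then have "gaussian_approx Q K ?P t g"
    using s(1) t r(2) prob_space_PiM_std_normal
    by (intro gaussian_approx.intro gaussian_approx_axioms.intro cov_kernel_axioms) (auto simp: t_def)
  then show thesis by (rule that)
qed

section \<open>The remainder of the linearisation\<close>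

context prob_space
begin

text \<open>Induction on n. In the fourth power the cross terms with a single factor vanish, both
  means being zero. The bound 3 n^2 m grows by 6 n m + 3 m in one step, which covers the increment 6
  n v^2 + m because v^2 \<le> m.\<close>

lemma indep_sum_moments:
  fixes Y :: "nat \<Rightarrow> 'a \<Rightarrow> real"
  assumes ind: "indep_vars (\<lambda>_. borel) Y UNIV"
    and int: "\<And>j k. integrable M (\<lambda>\<omega>. Y j \<omega> ^ k)"
    and mean: "\<And>j. expectation (Y j) = 0"
    and m4: "\<And>j. expectation (\<lambda>\<omega>. Y j \<omega> ^ 4) \<le> m" and m2: "\<And>j. expectation (\<lambda>\<omega>. (Y j \<omega>)\<^sup>2) \<le> v"
    and vm: "v\<^sup>2 \<le> m"
  shows "(\<forall>k. integrable M (\<lambda>\<omega>. (\<Sum>j<n. Y j \<omega>) ^ k)) \<and> expectation (\<lambda>\<omega>. \<Sum>j<n. Y j \<omega>) = 0 \<and>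
    expectation (\<lambda>\<omega>. (\<Sum>j<n. Y j \<omega>)\<^sup>2) \<le> real n * v \<and> expectation (\<lambda>\<omega>. (\<Sum>j<n. Y j \<omega>) ^ 4) \<le> 3 * (real n)\<^sup>2 * m"
proof (induction n)
  case 0
  then show ?case by (auto simp: power_0_left)
next
  case (Suc n)
  let ?S = "\<lambda>\<omega>. \<Sum>j<n. Y j \<omega>"
  have S: "integrable M (\<lambda>\<omega>. ?S \<omega> ^ k)" "expectation ?S = 0"
    "expectation (\<lambda>\<omega>. (?S \<omega>)\<^sup>2) \<le> real n * v" "expectation (\<lambda>\<omega>. ?S \<omega> ^ 4) \<le> 3 * (real n)\<^sup>2 * m" for k
    using Suc.IH by auto
  have v: "0 \<le> v"
  proof -
    have "0 \<le> expectation (\<lambda>\<omega>. (Y 0 \<omega>)\<^sup>2)" by simp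
    then show ?thesis using m2[of 0] by linarith
  qed
  have "indep_var borel (Y n) borel ?S"
    using ind by (intro indep_vars_sum) (auto intro: indep_vars_subset)
  then have iv: "indep_var borel (\<lambda>\<omega>. Y n \<omega> ^ i) borel (\<lambda>\<omega>. ?S \<omega> ^ k)" for i k
    using indep_var_compose[of borel "Y n" borel ?S "\<lambda>y. y ^ i" borel "\<lambda>y. y ^ k" borel] by (simp add: comp_def)
  have pint: "integrable M (\<lambda>\<omega>. Y n \<omega> ^ i * ?S \<omega> ^ k)" for i k
    by (rule indep_var_integrable[OF iv int S(1)])
  have pE: "expectation (\<lambda>\<omega>. Y n \<omega> ^ i * ?S \<omega> ^ k) = expectation (\<lambda>\<omega>. Y n \<omega> ^ i) * expectation (\<lambda>\<omega>. ?S \<omega> ^ k)" for i k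
    by (rule indep_var_lebesgue_integral[OF iv int S(1)])
  have i: "integrable M (\<lambda>\<omega>. (\<Sum>j<Suc n. Y j \<omega>) ^ k)" for k
  proof -
    have "(\<Sum>j<Suc n. Y j \<omega>) ^ k = (\<Sum>i\<le>k. of_nat (k choose i) * (Y n \<omega> ^ i * ?S \<omega> ^ (k - i)))" for \<omega>
      by (simp add: add.commute[of "?S \<omega>"] binomial_ring mult.assoc)
    then show ?thesis using pint by simp
  qed
  have e1: "expectation (\<lambda>\<omega>. \<Sum>j<Suc n. Y j \<omega>) = 0"
    using S(1)[of 1] S(2) int[of n 1] mean[of n] by simp
  have e2: "expectation (\<lambda>\<omega>. (\<Sum>j<Suc n. Y j \<omega>)\<^sup>2) \<le> real (Suc n) * v"
  proof -
    have "expectation (\<lambda>\<omega>. (\<Sum>j<Suc n. Y j \<omega>)\<^sup>2) = expectation (\<lambda>\<omega>. ?S \<omega> ^ 2 + 2 * (Y n \<omega> ^ 1 * ?S \<omega> ^ 1) + Y n \<omega> ^ 2)"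
      by (intro Bochner_Integration.integral_cong) (auto simp: power2_sum)
    also have "\<dots> = expectation (\<lambda>\<omega>. ?S \<omega> ^ 2) + 2 * expectation (\<lambda>\<omega>. Y n \<omega> ^ 1 * ?S \<omega> ^ 1) + expectation (\<lambda>\<omega>. Y n \<omega> ^ 2)"
      using S(1)[of 2] pint[of 1 1] int[of n 2] by simp
    finally show ?thesis unfolding pE using S(3) m2[of n] mean[of n] by (simp add: algebra_simps)
  qed
  have e4: "expectation (\<lambda>\<omega>. (\<Sum>j<Suc n. Y j \<omega>) ^ 4) \<le> 3 * (real (Suc n))\<^sup>2 * m"
  proof -
    have "expectation (\<lambda>\<omega>. (\<Sum>j<Suc n. Y j \<omega>) ^ 4) = expectation (\<lambda>\<omega>. ?S \<omega> ^ 4 + 4 * (Y n \<omega> ^ 1 * ?S \<omega> ^ 3) +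
        6 * (Y n \<omega> ^ 2 * ?S \<omega> ^ 2) + 4 * (Y n \<omega> ^ 3 * ?S \<omega> ^ 1) + Y n \<omega> ^ 4)"
      by (intro Bochner_Integration.integral_cong) (auto simp: power4_eq_xxxx power3_eq_cube power2_eq_square algebra_simps)
    also have "\<dots> = expectation (\<lambda>\<omega>. ?S \<omega> ^ 4) + 4 * expectation (\<lambda>\<omega>. Y n \<omega> ^ 1 * ?S \<omega> ^ 3) +
        6 * expectation (\<lambda>\<omega>. Y n \<omega> ^ 2 * ?S \<omega> ^ 2) + 4 * expectation (\<lambda>\<omega>. Y n \<omega> ^ 3 * ?S \<omega> ^ 1) + expectation (\<lambda>\<omega>. Y n \<omega> ^ 4)"
      using S(1)[of 4] pint[of 1 3] pint[of 2 2] pint[of 3 1] int[of n 4] by simp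
    also have "\<dots> = expectation (\<lambda>\<omega>. ?S \<omega> ^ 4) + 6 * (expectation (\<lambda>\<omega>. Y n \<omega> ^ 2) * expectation (\<lambda>\<omega>. ?S \<omega> ^ 2)) + expectation (\<lambda>\<omega>. Y n \<omega> ^ 4)"
      unfolding pE using mean[of n] S(2) by simp
    also have "\<dots> \<le> 3 * (real n)\<^sup>2 * m + 6 * (v * (real n * v)) + m"
      using m2[of n] S(3) m4[of n] S(4) v by (intro add_mono mult_left_mono mult_mono) auto
    also have "\<dots> \<le> 3 * (real n)\<^sup>2 * m + 6 * (real n * m) + 3 * m"
    proof -
      have "real n * v\<^sup>2 \<le> real n * m" using vm by (intro mult_left_mono) auto
      moreover have "0 \<le> m" using vm zero_le_power2[of v] by linarith
      ultimately show ?thesis by (simp add: power2_eq_square algebra_simps)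
    qed
    also have "\<dots> = 3 * (real (Suc n))\<^sup>2 * m" by (simp add: power2_eq_square algebra_simps)
    finally show ?thesis .
  qed
  show ?case using i e1 e2 e4 by blast
qed

end

text \<open>Here r is the remainder of the first-order expansion of exp(- x / 2) about s. It is
  bounded both by |S - s| and by (S - s)^2: the first bound has the slower growth, the second gives
  the rate.\<close>

lemma exp_remainder_bounds:
  fixes s S :: real
  assumes "0 \<le> S" "0 \<le> s"
  defines "r \<equiv> exp (- S / 2) - exp (- s / 2) + exp (- s / 2) / 2 * (S - s)"
  shows "r\<^sup>2 \<le> (S - s)\<^sup>2" "r\<^sup>2 \<le> (S - s) ^ 4"
proof -
  define d where "d = (S - s) / 2"
  have "0 \<le> r \<and> r \<le> \<bar>d\<bar> \<and> r \<le> d\<^sup>2"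
  proof (cases "0 \<le> d")
    case True
    have "exp (- S / 2) = exp (- s / 2) * exp (- d)" by (simp add: d_def exp_add[symmetric] field_simps)
    then have r: "r = exp (- s / 2) * (exp (- d) - 1 + d)" by (simp add: r_def d_def algebra_simps)
    have pos: "0 \<le> exp (- d) - 1 + d" using exp_ge_add_one_self[of "- d"] by linarith
    have "exp (- d) \<le> 1 - d + d\<^sup>2"
    proof -
      have "exp (- d) * (1 + d) \<le> exp (- d) * exp d"
        using exp_ge_add_one_self[of d] by (intro mult_left_mono) auto
      also have "\<dots> = 1" by (simp add: exp_minus)
      \<comment> \<open>The product equals 1 + d^3.\<close>
      also have "1 \<le> (1 - d + d\<^sup>2) * (1 + d)" using True by (simp add: power2_eq_square algebra_simps)
      finally show ?thesis using True by (simp add: mult_le_cancel_right)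
    qed
    then have b: "exp (- d) - 1 + d \<le> d\<^sup>2" "exp (- d) - 1 + d \<le> d" using True by auto
    have "exp (- s / 2) \<le> 1" using assms by simp
    then have "r \<le> 1 * (exp (- d) - 1 + d)" unfolding r using pos by (intro mult_right_mono) auto
    moreover have "0 \<le> r" unfolding r using pos by simp
    ultimately have "0 \<le> r" "r \<le> d" "r \<le> d\<^sup>2"
      using order.trans[OF _ b(1), of r] order.trans[OF _ b(2), of r] by (simp_all only: mult_1)
    then show ?thesis using True by simp
  next
    case False
    \<comment> \<open>For S < s the factor exp(- S / 2) is split off instead, so that the remaining
      exponential exp(- c) decays.\<close>
    define c where "c = - d"
    have c: "0 < c" using False by (simp add: c_def)
    have "exp (- s / 2) = exp (- S / 2) * exp (- c)" by (simp add: c_def d_def exp_add[symmetric] field_simps)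
    then have r: "r = exp (- S / 2) * (1 - exp (- c) * (1 + c))"
      by (simp add: r_def c_def d_def algebra_simps)
    have "exp (- c) * (1 + c) \<le> exp (- c) * exp c"
      using exp_ge_add_one_self[of c] by (intro mult_left_mono) auto
    then have pos: "0 \<le> 1 - exp (- c) * (1 + c)" by (simp add: exp_minus)
    have e: "1 - c \<le> exp (- c)" using exp_ge_add_one_self[of "- c"] by linarith
    then have "(1 - c) * (1 + c) \<le> exp (- c) * (1 + c)" using c by (intro mult_right_mono) auto
    then have b1: "1 - exp (- c) * (1 + c) \<le> c\<^sup>2" by (simp add: power2_eq_square algebra_simps)
    have "exp (- c) * 1 \<le> exp (- c) * (1 + c)" using c by (intro mult_left_mono) auto
    then have b2: "1 - exp (- c) * (1 + c) \<le> c" using e by linarith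
    have "exp (- S / 2) \<le> 1" using assms by simp
    then have "r \<le> 1 * (1 - exp (- c) * (1 + c))" unfolding r using pos by (intro mult_right_mono) auto
    moreover have "0 \<le> r" unfolding r using pos by simp
    ultimately show ?thesis using b1 b2 c by (simp add: c_def)
  qed
  moreover have "\<bar>d\<bar> \<le> \<bar>S - s\<bar>" "d\<^sup>2 \<le> (S - s)\<^sup>2" by (simp_all add: d_def power_divide)
  ultimately have r: "\<bar>r\<bar> \<le> \<bar>S - s\<bar>" "\<bar>r\<bar> \<le> \<bar>(S - s)\<^sup>2\<bar>" by auto
  show "r\<^sup>2 \<le> (S - s)\<^sup>2" using r(1) by (simp only: abs_le_square_iff)
  have "r\<^sup>2 \<le> ((S - s)\<^sup>2)\<^sup>2" using r(2) by (simp only: abs_le_square_iff)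
  then show "r\<^sup>2 \<le> (S - s) ^ 4" by simp
qed

text \<open>Adding a constant to all observations changes nothing, because the sample mean is
  subtracted; this allows the true mean to be removed at the outset. For n = 0 the value is
  0.\<close>

definition V_stat :: "nat \<Rightarrow> (nat \<Rightarrow> real) \<Rightarrow> real" where
  "V_stat n z = (let a = (\<Sum>j<n. z j) / real n; u = (\<Sum>j<n. (z j - a)\<^sup>2) / real n
    in sqrt (real n) * ((\<Sum>j<n. cos (z j - a) + sin (z j - a)) / real n - exp (- u / 2)))"

definition W_stat :: "nat \<Rightarrow> real \<Rightarrow> (nat \<Rightarrow> real) \<Rightarrow> real" where
  "W_stat n s z = (\<Sum>j<n. psi s (z j)) / sqrt (real n)"

text \<open>The linear effects of the sample mean a and of E are already part of
  \<open>W_stat\<close>. What remains is of second order: the Taylor remainder r1 of cos + sin in a,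
  the product a D, the remainder r3 of the exponential, and r4, which stems from u = S -
  a^2.\<close>

lemma V_stat_W_stat_bound:
  fixes z :: "nat \<Rightarrow> real"
  assumes n: "n > 0" and s: "0 \<le> s"
  defines "a \<equiv> (\<Sum>j<n. z j) / real n" and "D \<equiv> (\<Sum>j<n. cos (z j) - sin (z j) - exp (- s / 2)) / real n"
    and "E \<equiv> (\<Sum>j<n. (z j)\<^sup>2 - s) / real n"
  shows "(V_stat n z - W_stat n s z)\<^sup>2 \<le> 3 * real n * (8 * a ^ 4 + D ^ 4 + E\<^sup>2)"
    and "(V_stat n z - W_stat n s z)\<^sup>2 \<le> 3 * real n * (8 * a ^ 4 + D ^ 4 + E ^ 4)"
proof -
  define e where "e = exp (- s / 2)"
  define S where "S = (\<Sum>j<n. (z j)\<^sup>2) / real n"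
  define u where "u = (\<Sum>j<n. (z j - a)\<^sup>2) / real n"
  define r1 where "r1 = (\<Sum>j<n. (cos (z j - a) + sin (z j - a)) - (cos (z j) + sin (z j)) + a * (cos (z j) - sin (z j))) / real n"
  define r3 where "r3 = exp (- S / 2) - e + e / 2 * (S - s)"
  define r4 where "r4 = exp (- u / 2) - exp (- S / 2)"
  have na: "(\<Sum>j<n. z j) = real n * a" using n by (simp add: a_def)
  have S0: "0 \<le> S" by (simp add: S_def sum_nonneg)
  have u0: "0 \<le> u" by (simp add: u_def sum_nonneg)
  have E: "E = S - s" using n by (simp add: E_def S_def sum_subtractf diff_divide_distrib)
  have D: "D = (\<Sum>j<n. cos (z j) - sin (z j)) / real n - e" using n by (simp add: D_def e_def sum_subtractf diff_divide_distrib)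
  have u: "u = S - a\<^sup>2"
  proof -
    have "(\<Sum>j<n. (z j - a)\<^sup>2) = (\<Sum>j<n. (z j)\<^sup>2) - 2 * a * (\<Sum>j<n. z j) + real n * a\<^sup>2"
      by (simp add: power2_diff sum.distrib sum_subtractf sum_distrib_left mult.commute mult.left_commute)
    then show ?thesis
      unfolding na u_def S_def using n by (simp add: field_simps power2_eq_square)
  qed
  have r1: "\<bar>r1\<bar> \<le> 2 * a\<^sup>2"
  proof -
    have t: "\<bar>(cos (y - a) + sin (y - a)) - (cos y + sin y) + a * (cos y - sin y)\<bar> \<le> 2 * a\<^sup>2" for y
    proof -
      have eq: "(cos (y - a) + sin (y - a)) - (cos y + sin y) + a * (cos y - sin y) =
          (cos a - 1) * (cos y + sin y) + (a - sin a) * (cos y - sin y)"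
        by (simp add: cos_diff sin_diff algebra_simps)
      have c: "\<bar>cos a - 1\<bar> \<le> a\<^sup>2 / 2" using square_diff_quotient_bound[of a] by simp
      have "\<bar>sin a - (\<Sum>m<2. sin_coeff m * a ^ m)\<bar> \<le> inverse (fact 2) * \<bar>a\<bar> ^ 2"
        by (rule Maclaurin_sin_bound)
      moreover have "(\<Sum>m<2. sin_coeff m * a ^ m) = a" by (simp add: numeral_2_eq_2 sin_coeff_def)
      ultimately have si: "\<bar>a - sin a\<bar> \<le> a\<^sup>2 / 2"
        unfolding abs_minus_commute[of a] by simp
      have b: "\<bar>cos y + sin y\<bar> \<le> 2" "\<bar>cos y - sin y\<bar> \<le> 2"
        using cos_ge_minus_one[of y] cos_le_one[of y] sin_ge_minus_one[of y] sin_le_one[of y] by linarith+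
      have "\<bar>(cos a - 1) * (cos y + sin y) + (a - sin a) * (cos y - sin y)\<bar> \<le>
          \<bar>cos a - 1\<bar> * \<bar>cos y + sin y\<bar> + \<bar>a - sin a\<bar> * \<bar>cos y - sin y\<bar>"
        by (metis abs_mult abs_triangle_ineq)
      also have "\<dots> \<le> a\<^sup>2 / 2 * 2 + a\<^sup>2 / 2 * 2"
        by (intro add_mono mult_mono c si b) auto
      finally show ?thesis unfolding eq by simp
    qed
    have "\<bar>r1\<bar> \<le> (\<Sum>j<n. 2 * a\<^sup>2) / real n"
      unfolding r1_def abs_divide using n
      by (simp only: abs_of_nat, intro divide_right_mono order.trans[OF sum_abs] sum_mono t) simp
    then show ?thesis using n by simp
  qed
  have r4: "\<bar>r4\<bar> \<le> a\<^sup>2 / 2"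
  proof -
    have "exp (- S / 2) = exp (- u / 2) * exp (- (a\<^sup>2 / 2))" by (simp add: u exp_add[symmetric] field_simps)
    then have eq: "r4 = exp (- u / 2) * (1 - exp (- (a\<^sup>2 / 2)))" by (simp add: r4_def algebra_simps)
    have "0 \<le> 1 - exp (- (a\<^sup>2 / 2))" by simp
    moreover have "1 - exp (- (a\<^sup>2 / 2)) \<le> a\<^sup>2 / 2" using exp_ge_add_one_self[of "- (a\<^sup>2 / 2)"] by linarith
    moreover have "exp (- u / 2) \<le> 1" using u0 by simp
    ultimately show ?thesis
      unfolding eq using mult_mono[of "exp (- u / 2)" 1 "1 - exp (- (a\<^sup>2 / 2))" "a\<^sup>2 / 2"] by (simp add: abs_mult)
  qed
  have dec: "V_stat n z - W_stat n s z = sqrt (real n) * (r1 - a * D - r3 - r4)"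
  proof -
    let ?H = "(\<Sum>j<n. cos (z j) + sin (z j)) / real n" and ?H' = "(\<Sum>j<n. cos (z j) - sin (z j)) / real n"
    define H H' where "H = ?H" and "H' = ?H'"
    have V: "V_stat n z = sqrt (real n) * ((\<Sum>j<n. cos (z j - a) + sin (z j - a)) / real n - exp (- u / 2))"
      by (simp add: V_stat_def Let_def a_def u_def)
    have A: "(\<Sum>j<n. cos (z j - a) + sin (z j - a)) / real n = r1 + ?H - a * ?H'"
      by (simp add: r1_def sum.distrib sum_subtractf sum_distrib_left[symmetric] add_divide_distrib diff_divide_distrib algebra_simps)
    have B: "W_stat n s z = sqrt (real n) * (?H - e - a * e + e / 2 * (S - s))"
    proof -
      have "(\<Sum>j<n. psi s (z j)) = (\<Sum>j<n. cos (z j) + sin (z j)) - real n * e - (\<Sum>j<n. z j) * e + e / 2 * ((\<Sum>j<n. (z j)\<^sup>2) - real n * s)"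
        unfolding psi_def e_def by (simp add: sum.distrib sum_subtractf sum_distrib_right sum_distrib_left right_diff_distrib)
      also have "\<dots> = real n * (?H - e - a * e + e / 2 * (S - s))"
        unfolding na using n by (simp add: S_def field_simps)
      finally have "W_stat n s z = real n / sqrt (real n) * (?H - e - a * e + e / 2 * (S - s))"
        by (simp add: W_stat_def)
      then show ?thesis by (simp only: real_div_sqrt of_nat_0_le_iff)
    qed
    show ?thesis
      unfolding V A B D r3_def r4_def H_def[symmetric] H'_def[symmetric] by (simp add: algebra_simps)
  qed
  have "(r1 - a * D - r3 - r4)\<^sup>2 \<le> 3 * (8 * a ^ 4 + D ^ 4 + r3\<^sup>2)"
  proof -
    have three: "(x + y + w)\<^sup>2 \<le> 3 * (x\<^sup>2 + y\<^sup>2 + w\<^sup>2)" for x y w :: real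
      using zero_le_power2[of "x - y"] zero_le_power2[of "y - w"] zero_le_power2[of "x - w"]
      by (simp add: power2_eq_square algebra_simps)
    have "(r1 - a * D - r3 - r4)\<^sup>2 = ((r1 - r4) + (- (a * D)) + (- r3))\<^sup>2" by (simp add: algebra_simps)
    also have "\<dots> \<le> 3 * ((r1 - r4)\<^sup>2 + (a * D)\<^sup>2 + r3\<^sup>2)"
      using three[of "r1 - r4" "- (a * D)" "- r3"] by simp
    \<comment> \<open>The bounds 2 a^2 and a^2 / 2 give 25 / 4 after squaring, rounded up to 7; the
      a^4 of the next estimate makes the coefficient 8.\<close>
    also have "(r1 - r4)\<^sup>2 \<le> 7 * a ^ 4"
    proof -
      have "\<bar>r1 - r4\<bar> \<le> 5 / 2 * a\<^sup>2" using r1 r4 by linarith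
      then have "\<bar>r1 - r4\<bar> \<le> \<bar>5 / 2 * a\<^sup>2\<bar>" by simp
      then have "(r1 - r4)\<^sup>2 \<le> (5 / 2 * a\<^sup>2)\<^sup>2" by (simp only: abs_le_square_iff)
      also have "\<dots> = 25 / 4 * a ^ 4" by (simp add: power_mult_distrib power_divide)
      also have "\<dots> \<le> 7 * a ^ 4" by (intro mult_right_mono) auto
      finally show ?thesis .
    qed
    also have "(a * D)\<^sup>2 \<le> a ^ 4 + D ^ 4"
    proof -
      have "2 * (a\<^sup>2 * D\<^sup>2) \<le> a ^ 4 + D ^ 4"
        using sum_squares_bound[of "a\<^sup>2" "D\<^sup>2"] by (simp add: mult.assoc)
      moreover have "0 \<le> a\<^sup>2 * D\<^sup>2" by simp
      ultimately show ?thesis unfolding power_mult_distrib by linarith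
    qed
    finally show ?thesis by simp
  qed
  then have main: "(V_stat n z - W_stat n s z)\<^sup>2 \<le> 3 * real n * (8 * a ^ 4 + D ^ 4 + r3\<^sup>2)"
    unfolding dec power_mult_distrib using n by (simp add: mult_left_mono)
  have "r3\<^sup>2 \<le> E\<^sup>2" "r3\<^sup>2 \<le> E ^ 4"
    unfolding r3_def e_def E by (rule exp_remainder_bounds[OF S0 s])+
  then show "(V_stat n z - W_stat n s z)\<^sup>2 \<le> 3 * real n * (8 * a ^ 4 + D ^ 4 + E\<^sup>2)"
    "(V_stat n z - W_stat n s z)\<^sup>2 \<le> 3 * real n * (8 * a ^ 4 + D ^ 4 + E ^ 4)"
    by (auto intro!: order.trans[OF main] mult_left_mono)
qed

section \<open>Moments of the error for a normal sample\<close>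

lemma V_stat_measurable:
  assumes [measurable]: "\<And>j. z j \<in> borel_measurable M"
  shows "(\<lambda>\<omega>. V_stat n (\<lambda>j. z j \<omega>)) \<in> borel_measurable M"
  unfolding V_stat_def Let_def by measurable

lemma W_stat_measurable:
  assumes [measurable]: "\<And>j. z j \<in> borel_measurable M" "s \<in> borel_measurable M"
  shows "(\<lambda>\<omega>. W_stat n (s \<omega>) (\<lambda>j. z j \<omega>)) \<in> borel_measurable M"
  unfolding W_stat_def psi_def by measurable

locale iid_normal = prob_space +
  fixes z :: "nat \<Rightarrow> 'a \<Rightarrow> real" and s :: real
  assumes indep: "indep_vars (\<lambda>_. borel) z UNIV" and normal_z: "\<And>j. normal_var M (z j) s"
begin

lemma z_measurable [measurable]: "z j \<in> borel_measurable M"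
  by (rule normal_var_measurable[OF normal_z])

lemma s_nonneg: "0 \<le> s"
  using normal_z[of 0] by (simp add: normal_var_def)

lemma indep_fun: "f \<in> borel_measurable borel \<Longrightarrow> indep_vars (\<lambda>_. borel) (\<lambda>j \<omega>. f (z j \<omega>)) UNIV" for f :: "real \<Rightarrow> real"
  using indep_vars_compose2[OF indep, of "\<lambda>_. f" "\<lambda>_. borel"] by simp

lemma z_power_integrable: "integrable M (\<lambda>\<omega>. z j \<omega> ^ k)"
  by (rule normal_var_integrable_power[OF normal_z])

lemma z_moments:
  "expectation (z j) = 0" "expectation (\<lambda>\<omega>. (z j \<omega>)\<^sup>2) = s" "expectation (\<lambda>\<omega>. z j \<omega> ^ 4) = 3 * s\<^sup>2"
  "expectation (\<lambda>\<omega>. z j \<omega> ^ 6) = 15 * s ^ 3" "expectation (\<lambda>\<omega>. z j \<omega> ^ 8) = 105 * s ^ 4"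
  using normal_var_moment_odd[OF normal_z, of 1 j] normal_var_moment_even[OF normal_z, of j 1]
    normal_var_moment_even[OF normal_z, of j 2] normal_var_moment_even[OF normal_z, of j 3]
    normal_var_moment_even[OF normal_z, of j 4]
  by (simp_all add: fact_numeral)

lemma mean_moment:
  "integrable M (\<lambda>\<omega>. ((\<Sum>j<n. z j \<omega>) / real n) ^ 4)"
  "expectation (\<lambda>\<omega>. ((\<Sum>j<n. z j \<omega>) / real n) ^ 4) \<le> 9 * s\<^sup>2 / (real n)\<^sup>2"
proof -
  have *: "(\<forall>k. integrable M (\<lambda>\<omega>. (\<Sum>j<n. z j \<omega>) ^ k)) \<and> expectation (\<lambda>\<omega>. \<Sum>j<n. z j \<omega>) = 0 \<and>
    expectation (\<lambda>\<omega>. (\<Sum>j<n. z j \<omega>)\<^sup>2) \<le> real n * s \<and> expectation (\<lambda>\<omega>. (\<Sum>j<n. z j \<omega>) ^ 4) \<le> 3 * (real n)\<^sup>2 * (3 * s\<^sup>2)"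
    by (rule indep_sum_moments[OF indep z_power_integrable]) (simp_all add: z_moments)
  then show "integrable M (\<lambda>\<omega>. ((\<Sum>j<n. z j \<omega>) / real n) ^ 4)"
    by (simp add: power_divide)
  have "expectation (\<lambda>\<omega>. (\<Sum>j<n. z j \<omega>) ^ 4) / real n ^ 4 \<le> 3 * (real n)\<^sup>2 * (3 * s\<^sup>2) / real n ^ 4"
    using * by (intro divide_right_mono) auto
  then show "expectation (\<lambda>\<omega>. ((\<Sum>j<n. z j \<omega>) / real n) ^ 4) \<le> 9 * s\<^sup>2 / (real n)\<^sup>2"
    by (cases "n = 0") (auto simp: power_divide power2_eq_square power4_eq_xxxx)
qed

lemma trig_moment:
  "integrable M (\<lambda>\<omega>. ((\<Sum>j<n. cos (z j \<omega>) - sin (z j \<omega>) - exp (- s / 2)) / real n) ^ 4)" (is ?A)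
  "expectation (\<lambda>\<omega>. ((\<Sum>j<n. cos (z j \<omega>) - sin (z j \<omega>) - exp (- s / 2)) / real n) ^ 4) \<le> 243 / (real n)\<^sup>2" (is ?B)
proof -
  let ?Y = "\<lambda>j \<omega>. cos (z j \<omega>) - sin (z j \<omega>) - exp (- s / 2)"
  have bnd: "\<bar>?Y j \<omega>\<bar> \<le> 3" for j \<omega>
  proof -
    have "exp (- s / 2) \<le> 1" "0 \<le> exp (- s / 2)" using s_nonneg by auto
    then show ?thesis
      using cos_ge_minus_one[of "z j \<omega>"] cos_le_one[of "z j \<omega>"] sin_ge_minus_one[of "z j \<omega>"] sin_le_one[of "z j \<omega>"]
      by linarith
  qed
  have pw: "\<bar>?Y j \<omega> ^ k\<bar> \<le> 3 ^ k" for j \<omega> k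
    unfolding power_abs by (intro power_mono bnd) simp
  have int: "integrable M (\<lambda>\<omega>. ?Y j \<omega> ^ k)" for j k
    using pw by (intro integrable_const_bound[where B = "3 ^ k"]) auto
  have le: "expectation (\<lambda>\<omega>. ?Y j \<omega> ^ k) \<le> 3 ^ k" for j k
  proof -
    have "expectation (\<lambda>\<omega>. ?Y j \<omega> ^ k) \<le> expectation (\<lambda>\<omega>. 3 ^ k)"
      using int pw by (intro integral_mono) (auto simp: abs_le_iff)
    then show ?thesis by (simp add: prob_space)
  qed
  have mean: "expectation (?Y j) = 0" for j
    using normal_var_cos[OF normal_z, of 1 j] normal_var_sin[OF normal_z, of 1 j]
      integrable_cos_sin[OF z_measurable, of j] by (simp add: prob_space)
  \<comment> \<open>The parameters are v = 9 and m = 81, powers of the pointwise bound 3.\<close>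
  have *: "(\<forall>k. integrable M (\<lambda>\<omega>. (\<Sum>j<n. ?Y j \<omega>) ^ k)) \<and> expectation (\<lambda>\<omega>. \<Sum>j<n. ?Y j \<omega>) = 0 \<and>
    expectation (\<lambda>\<omega>. (\<Sum>j<n. ?Y j \<omega>)\<^sup>2) \<le> real n * 9 \<and> expectation (\<lambda>\<omega>. (\<Sum>j<n. ?Y j \<omega>) ^ 4) \<le> 3 * (real n)\<^sup>2 * 81"
    using le[of _ 2] le[of _ 4] by (intro indep_sum_moments int mean indep_fun) auto
  then show ?A by (simp add: power_divide)
  have "expectation (\<lambda>\<omega>. (\<Sum>j<n. ?Y j \<omega>) ^ 4) / real n ^ 4 \<le> 3 * (real n)\<^sup>2 * 81 / real n ^ 4"
    using * by (intro divide_right_mono) auto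
  then show ?B
    by (cases "n = 0") (auto simp: power_divide power2_eq_square power4_eq_xxxx)
qed

lemma square_moment:
  "integrable M (\<lambda>\<omega>. ((\<Sum>j<n. (z j \<omega>)\<^sup>2 - s) / real n)\<^sup>2)" (is ?A)
  "expectation (\<lambda>\<omega>. ((\<Sum>j<n. (z j \<omega>)\<^sup>2 - s) / real n)\<^sup>2) \<le> 8 * s\<^sup>2 / real n" (is ?B)
  "integrable M (\<lambda>\<omega>. ((\<Sum>j<n. (z j \<omega>)\<^sup>2 - s) / real n) ^ 4)" (is ?C)
  "expectation (\<lambda>\<omega>. ((\<Sum>j<n. (z j \<omega>)\<^sup>2 - s) / real n) ^ 4) \<le> 192 * s ^ 4 / (real n)\<^sup>2" (is ?D)
proof -
  let ?Y = "\<lambda>j \<omega>. (z j \<omega>)\<^sup>2 - s"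
  have int: "integrable M (\<lambda>\<omega>. ?Y j \<omega> ^ k)" for j k
  proof -
    have "?Y j \<omega> ^ k = (\<Sum>i\<le>k. of_nat (k choose i) * (z j \<omega> ^ (2 * i) * (- s) ^ (k - i)))" for \<omega>
      using binomial_ring[of "(z j \<omega>)\<^sup>2" "- s" k] by (simp add: mult.assoc power_mult)
    then show ?thesis using z_power_integrable by simp
  qed
  have e2: "expectation (\<lambda>\<omega>. (?Y j \<omega>)\<^sup>2) = 2 * s\<^sup>2" for j
  proof -
    have "expectation (\<lambda>\<omega>. (?Y j \<omega>)\<^sup>2) = expectation (\<lambda>\<omega>. z j \<omega> ^ 4 - 2 * s * z j \<omega> ^ 2 + s\<^sup>2)"
      by (intro Bochner_Integration.integral_cong) (auto simp: power2_eq_square power4_eq_xxxx algebra_simps)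
    also have "\<dots> = 2 * s\<^sup>2"
      using z_power_integrable[of j 4] z_power_integrable[of j 2]
      by (simp add: z_moments prob_space) (simp add: power2_eq_square)
    finally show ?thesis .
  qed
  have e4: "expectation (\<lambda>\<omega>. ?Y j \<omega> ^ 4) = 60 * s ^ 4" for j
  proof -
    have "expectation (\<lambda>\<omega>. ?Y j \<omega> ^ 4) =
        expectation (\<lambda>\<omega>. z j \<omega> ^ 8 - 4 * s * z j \<omega> ^ 6 + 6 * s\<^sup>2 * z j \<omega> ^ 4 - 4 * s ^ 3 * z j \<omega> ^ 2 + s ^ 4)"
      by (intro Bochner_Integration.integral_cong) (auto simp: eval_nat_numeral algebra_simps)
    also have "\<dots> = 105 * s ^ 4 - 4 * s * (15 * s ^ 3) + 6 * s\<^sup>2 * (3 * s\<^sup>2) - 4 * s ^ 3 * s + s ^ 4"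
      using z_power_integrable by (simp add: z_moments prob_space)
    also have "\<dots> = 60 * s ^ 4" by (simp add: eval_nat_numeral algebra_simps)
    finally show ?thesis .
  qed
  have mean: "expectation (?Y j) = 0" for j
    using z_power_integrable[of j 2] by (simp add: z_moments prob_space)
  \<comment> \<open>The exact values 2 s^2 and 60 s^4 are rounded up to v = 8 s^2 and m = 64 s^4,
    for which v^2 = m.\<close>
  have *: "(\<forall>k. integrable M (\<lambda>\<omega>. (\<Sum>j<n. ?Y j \<omega>) ^ k)) \<and> expectation (\<lambda>\<omega>. \<Sum>j<n. ?Y j \<omega>) = 0 \<and>
    expectation (\<lambda>\<omega>. (\<Sum>j<n. ?Y j \<omega>)\<^sup>2) \<le> real n * (8 * s\<^sup>2) \<and> expectation (\<lambda>\<omega>. (\<Sum>j<n. ?Y j \<omega>) ^ 4) \<le> 3 * (real n)\<^sup>2 * (64 * s ^ 4)"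
    using e2 e4 by (intro indep_sum_moments int mean indep_fun) (auto simp: power_mult_distrib power_mult[symmetric])
  then show ?A ?C by (simp_all add: power_divide)
  have "expectation (\<lambda>\<omega>. (\<Sum>j<n. ?Y j \<omega>) ^ 4) / real n ^ 4 \<le> 3 * (real n)\<^sup>2 * (64 * s ^ 4) / real n ^ 4"
    using * by (intro divide_right_mono) auto
  then show ?D
    by (cases "n = 0") (auto simp: power_divide power2_eq_square power4_eq_xxxx)
  have "expectation (\<lambda>\<omega>. (\<Sum>j<n. ?Y j \<omega>)\<^sup>2) / (real n)\<^sup>2 \<le> real n * (8 * s\<^sup>2) / (real n)\<^sup>2"
    using * by (intro divide_right_mono) auto
  then show ?B
    by (cases "n = 0") (auto simp: power_divide power2_eq_square)
qed

text \<open>The factor n of \<open>V_stat_W_stat_bound\<close> reduces terms of order 1 / n^2 to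
  order 1 / n, whereas the term with E^2 leaves the constant 24 s^2; 216 and 24 add up to
  240.\<close>

lemma
  assumes n: "n > 0"
  shows remainder_integrable: "integrable M (\<lambda>\<omega>. (V_stat n (\<lambda>j. z j \<omega>) - W_stat n s (\<lambda>j. z j \<omega>))\<^sup>2)"
    and remainder_bounded: "expectation (\<lambda>\<omega>. (V_stat n (\<lambda>j. z j \<omega>) - W_stat n s (\<lambda>j. z j \<omega>))\<^sup>2) \<le> 240 * s\<^sup>2 + 729"
    and remainder_small: "expectation (\<lambda>\<omega>. (V_stat n (\<lambda>j. z j \<omega>) - W_stat n s (\<lambda>j. z j \<omega>))\<^sup>2) \<le>
      (216 * s\<^sup>2 + 729 + 576 * s ^ 4) / real n"
proof -
  let ?R = "\<lambda>\<omega>. (V_stat n (\<lambda>j. z j \<omega>) - W_stat n s (\<lambda>j. z j \<omega>))\<^sup>2"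
  let ?a = "\<lambda>\<omega>. (\<Sum>j<n. z j \<omega>) / real n"
  let ?D = "\<lambda>\<omega>. (\<Sum>j<n. cos (z j \<omega>) - sin (z j \<omega>) - exp (- s / 2)) / real n"
  let ?E = "\<lambda>\<omega>. (\<Sum>j<n. (z j \<omega>)\<^sup>2 - s) / real n"
  note b = V_stat_W_stat_bound[OF n s_nonneg]
  note i = mean_moment(1)[of n] trig_moment(1)[of n] square_moment(1)[of n] square_moment(3)[of n]
  have i1: "integrable M (\<lambda>\<omega>. 3 * real n * (8 * ?a \<omega> ^ 4 + ?D \<omega> ^ 4 + (?E \<omega>)\<^sup>2))"
    by (intro integrable_mult_right Bochner_Integration.integrable_add i)
  have i2: "integrable M (\<lambda>\<omega>. 3 * real n * (8 * ?a \<omega> ^ 4 + ?D \<omega> ^ 4 + ?E \<omega> ^ 4))"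
    by (intro integrable_mult_right Bochner_Integration.integrable_add i)
  show int: "integrable M ?R"
  proof (rule Bochner_Integration.integrable_bound[OF i1])
    show "?R \<in> borel_measurable M"
      using V_stat_measurable[of z M n] W_stat_measurable[of z M "\<lambda>_. s" n] by simp
    show "AE \<omega> in M. norm (?R \<omega>) \<le> norm (3 * real n * (8 * ?a \<omega> ^ 4 + ?D \<omega> ^ 4 + (?E \<omega>)\<^sup>2))"
      using b(1) by (intro AE_I2) (auto intro: order.trans[OF _ abs_ge_self])
  qed
  have n1: "1 \<le> real n" using n by simp
  have "expectation ?R \<le> expectation (\<lambda>\<omega>. 3 * real n * (8 * ?a \<omega> ^ 4 + ?D \<omega> ^ 4 + (?E \<omega>)\<^sup>2))"
    by (intro integral_mono int i1 b(1))
  also have "\<dots> = 3 * real n * (8 * expectation (\<lambda>\<omega>. ?a \<omega> ^ 4) + expectation (\<lambda>\<omega>. ?D \<omega> ^ 4) + expectation (\<lambda>\<omega>. (?E \<omega>)\<^sup>2))"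
    using i by simp
  also have "\<dots> \<le> 3 * real n * (8 * (9 * s\<^sup>2 / (real n)\<^sup>2) + 243 / (real n)\<^sup>2 + 8 * s\<^sup>2 / real n)"
    by (intro mult_left_mono add_mono mean_moment trig_moment square_moment) simp_all
  also have "\<dots> = (216 * s\<^sup>2 + 729) / real n + 24 * s\<^sup>2"
    using n by (simp add: field_simps power2_eq_square)
  also have "\<dots> \<le> (216 * s\<^sup>2 + 729) / 1 + 24 * s\<^sup>2"
    using n1 by (intro add_mono divide_left_mono) auto
  finally show "expectation ?R \<le> 240 * s\<^sup>2 + 729" by simp
  have "expectation ?R \<le> expectation (\<lambda>\<omega>. 3 * real n * (8 * ?a \<omega> ^ 4 + ?D \<omega> ^ 4 + ?E \<omega> ^ 4))"
    by (intro integral_mono int i2 b(2))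
  also have "\<dots> = 3 * real n * (8 * expectation (\<lambda>\<omega>. ?a \<omega> ^ 4) + expectation (\<lambda>\<omega>. ?D \<omega> ^ 4) + expectation (\<lambda>\<omega>. ?E \<omega> ^ 4))"
    using i by simp
  also have "\<dots> \<le> 3 * real n * (8 * (9 * s\<^sup>2 / (real n)\<^sup>2) + 243 / (real n)\<^sup>2 + 192 * s ^ 4 / (real n)\<^sup>2)"
    by (intro mult_left_mono add_mono mean_moment trig_moment square_moment) simp_all
  also have "\<dots> = (216 * s\<^sup>2 + 729 + 576 * s ^ 4) / real n"
    using n by (simp add: field_simps power2_eq_square)
  finally show "expectation ?R \<le> (216 * s\<^sup>2 + 729 + 576 * s ^ 4) / real n" .
qed

end

section \<open>Laplace transforms of squared norms\<close>

text \<open>Second moments are known for each fixed x, while norms are integrals over x for fixed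
  \<omega>. The exchange is stated in the form that \<open>laplace_L2_diff_le\<close> asks
  for.\<close>

lemma (in pair_prob_space) double_integral_le:
  assumes [measurable]: "(\<lambda>(\<omega>, x). F \<omega> x) \<in> borel_measurable (M1 \<Otimes>\<^sub>M M2)"
    and nn: "\<And>\<omega> x. 0 \<le> F \<omega> x" and int: "\<And>\<omega>. \<omega> \<in> space M1 \<Longrightarrow> integrable M2 (F \<omega>)"
    and le: "(\<integral>\<^sup>+x. \<integral>\<^sup>+\<omega>. ennreal (F \<omega> x) \<partial>M1 \<partial>M2) \<le> ennreal d" and d: "0 \<le> d"
  shows "integrable M1 (\<lambda>\<omega>. LINT x|M2. F \<omega> x)" "(LINT \<omega>|M1. LINT x|M2. F \<omega> x) \<le> d"
proof -
  have "(\<integral>\<^sup>+\<omega>. ennreal (LINT x|M2. F \<omega> x) \<partial>M1) = (\<integral>\<^sup>+\<omega>. \<integral>\<^sup>+x. ennreal (F \<omega> x) \<partial>M2 \<partial>M1)"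
    using int nn by (intro nn_integral_cong nn_integral_eq_integral[symmetric]) auto
  also have "\<dots> = (\<integral>\<^sup>+x. \<integral>\<^sup>+\<omega>. ennreal (F \<omega> x) \<partial>M1 \<partial>M2)"
    by (rule Fubini'[symmetric]) measurable
  finally have le': "(\<integral>\<^sup>+\<omega>. ennreal (LINT x|M2. F \<omega> x) \<partial>M1) \<le> ennreal d" using le by simp
  have pos: "0 \<le> (LINT x|M2. F \<omega> x)" for \<omega> using nn by simp
  show i: "integrable M1 (\<lambda>\<omega>. LINT x|M2. F \<omega> x)"
  proof (rule integrableI_bounded)
    show "(\<integral>\<^sup>+\<omega>. ennreal (norm (LINT x|M2. F \<omega> x)) \<partial>M1) < \<infinity>"
      using le' pos by (auto intro: le_less_trans)
  qed measurable
  show "(LINT \<omega>|M1. LINT x|M2. F \<omega> x) \<le> d"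
    using le' nn_integral_eq_integral[OF i] pos d by simp
qed

lemma exp_neg_lipschitz:
  fixes a b l :: real
  assumes "0 \<le> a" "0 \<le> b" "0 \<le> l"
  shows "\<bar>exp (- (l * a)) - exp (- (l * b))\<bar> \<le> l * \<bar>a - b\<bar>"
proof -
  have *: "\<bar>exp (- (l * a)) - exp (- (l * b))\<bar> \<le> l * \<bar>a - b\<bar>" if "a \<le> b" "0 \<le> a" for a b
  proof -
    have "exp (- (l * b)) = exp (- (l * a)) * exp (- (l * (b - a)))"
      by (simp add: exp_add[symmetric] algebra_simps)
    then have eq: "exp (- (l * a)) - exp (- (l * b)) = exp (- (l * a)) * (1 - exp (- (l * (b - a))))"
      by (simp add: algebra_simps)
    have "1 - exp (- (l * (b - a))) \<le> l * (b - a)"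
      using exp_ge_add_one_self[of "- (l * (b - a))"] by linarith
    moreover have "0 \<le> 1 - exp (- (l * (b - a)))" "exp (- (l * a)) \<le> 1"
      using that assms(3) by simp_all
    ultimately have "exp (- (l * a)) * (1 - exp (- (l * (b - a)))) \<le> 1 * (l * (b - a))"
      by (intro mult_mono) auto
    then show ?thesis
      unfolding eq using \<open>0 \<le> 1 - exp (- (l * (b - a)))\<close> that by (simp add: abs_mult)
  qed
  show ?thesis
    using *[of a b] *[of b a] assms by (cases "a \<le> b") (auto simp: abs_minus_commute)
qed

text \<open>The map exp(- l x) is Lipschitz, and |u^2 - v^2| \<le> (1 + 1 / e) (u - v)^2 + e v^2
  controls the difference of the squared norms. The parameter e is to be fixed first; the mean
  square distance d then has to be small compared with e.\<close>

lemma (in pair_prob_space) laplace_L2_diff_le: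
  fixes A B :: "'a \<Rightarrow> 'b \<Rightarrow> real"
  assumes [measurable]: "(\<lambda>(\<omega>, x). A \<omega> x) \<in> borel_measurable (M1 \<Otimes>\<^sub>M M2)" "(\<lambda>(\<omega>, x). B \<omega> x) \<in> borel_measurable (M1 \<Otimes>\<^sub>M M2)"
    and A: "\<And>\<omega>. \<omega> \<in> space M1 \<Longrightarrow> A \<omega> \<in> L2 M2" and B: "\<And>\<omega>. \<omega> \<in> space M1 \<Longrightarrow> B \<omega> \<in> L2 M2"
    and i1: "integrable M1 (\<lambda>\<omega>. LINT x|M2. (A \<omega> x - B \<omega> x)\<^sup>2)" and le1: "(LINT \<omega>|M1. LINT x|M2. (A \<omega> x - B \<omega> x)\<^sup>2) \<le> d"
    and i2: "integrable M1 (\<lambda>\<omega>. LINT x|M2. (B \<omega> x)\<^sup>2)" and le2: "(LINT \<omega>|M1. LINT x|M2. (B \<omega> x)\<^sup>2) \<le> 1"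
    and e: "0 < e" and l: "0 \<le> l"
  shows "\<bar>(LINT \<omega>|M1. exp (- (l * (LINT x|M2. (A \<omega> x)\<^sup>2)))) - (LINT \<omega>|M1. exp (- (l * (LINT x|M2. (B \<omega> x)\<^sup>2))))\<bar>
    \<le> l * ((1 + 1 / e) * d + e)"
proof -
  let ?a = "\<lambda>\<omega>. LINT x|M2. (A \<omega> x)\<^sup>2" and ?b = "\<lambda>\<omega>. LINT x|M2. (B \<omega> x)\<^sup>2"
  let ?d = "\<lambda>\<omega>. LINT x|M2. (A \<omega> x - B \<omega> x)\<^sup>2"
  have ptw: "\<bar>?a \<omega> - ?b \<omega>\<bar> \<le> (1 + 1 / e) * ?d \<omega> + e * ?b \<omega>" if \<omega>: "\<omega> \<in> space M1" for \<omega>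
  proof -
    have iA: "integrable M2 (\<lambda>x. (A \<omega> x)\<^sup>2)" and iB: "integrable M2 (\<lambda>x. (B \<omega> x)\<^sup>2)"
      and iD: "integrable M2 (\<lambda>x. (A \<omega> x - B \<omega> x)\<^sup>2)"
      using A[OF \<omega>] B[OF \<omega>] L2_diff[OF A[OF \<omega>] B[OF \<omega>]] by (auto simp: L2_def)
    have "?a \<omega> - ?b \<omega> = (LINT x|M2. (A \<omega> x)\<^sup>2 - (B \<omega> x)\<^sup>2)" using iA iB by simp
    also have "\<bar>\<dots>\<bar> \<le> (LINT x|M2. \<bar>(A \<omega> x)\<^sup>2 - (B \<omega> x)\<^sup>2\<bar>)" by (rule integral_abs_bound)
    also have "\<dots> \<le> (LINT x|M2. (1 + 1 / e) * (A \<omega> x - B \<omega> x)\<^sup>2 + e * (B \<omega> x)\<^sup>2)"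
    proof (rule integral_mono)
      fix x
      have "\<bar>u\<^sup>2 - v\<^sup>2\<bar> \<le> (1 + 1 / e) * (u - v)\<^sup>2 + e * v\<^sup>2" for u v :: real
      proof -
        have se: "sqrt e * sqrt e = e" "0 < sqrt e" using e by auto
        have "2 * (\<bar>u - v\<bar> / sqrt e) * (sqrt e * \<bar>v\<bar>) \<le> (\<bar>u - v\<bar> / sqrt e)\<^sup>2 + (sqrt e * \<bar>v\<bar>)\<^sup>2"
          by (rule sum_squares_bound)
        then have "2 * \<bar>v\<bar> * \<bar>u - v\<bar> \<le> (u - v)\<^sup>2 / e + e * v\<^sup>2"
          using e se by (simp add: power_mult_distrib power_divide mult.commute mult.left_commute)
        moreover have "u\<^sup>2 - v\<^sup>2 = (u - v)\<^sup>2 + 2 * v * (u - v)" by (simp add: power2_eq_square algebra_simps)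
        then have "\<bar>u\<^sup>2 - v\<^sup>2\<bar> \<le> (u - v)\<^sup>2 + 2 * \<bar>v\<bar> * \<bar>u - v\<bar>"
          using abs_triangle_ineq[of "(u - v)\<^sup>2" "2 * v * (u - v)"] by (simp add: abs_mult)
        ultimately show ?thesis by (simp add: distrib_right)
      qed
      then show "\<bar>(A \<omega> x)\<^sup>2 - (B \<omega> x)\<^sup>2\<bar> \<le> (1 + 1 / e) * (A \<omega> x - B \<omega> x)\<^sup>2 + e * (B \<omega> x)\<^sup>2" .
    qed (use iA iB iD in auto)
    also have "\<dots> = (1 + 1 / e) * ?d \<omega> + e * ?b \<omega>" using iB iD by simp
    finally show ?thesis .
  qed
  have a0: "0 \<le> ?a \<omega>" and b0: "0 \<le> ?b \<omega>" for \<omega> by simp_all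
  have ia: "integrable M1 (\<lambda>\<omega>. exp (- (l * ?a \<omega>)))" and ib: "integrable M1 (\<lambda>\<omega>. exp (- (l * ?b \<omega>)))"
    using l a0 b0 by (auto intro!: M1.integrable_const_bound[where B = 1] mult_nonneg_nonneg)
  have "\<bar>(LINT \<omega>|M1. exp (- (l * ?a \<omega>))) - (LINT \<omega>|M1. exp (- (l * ?b \<omega>)))\<bar> =
      \<bar>LINT \<omega>|M1. exp (- (l * ?a \<omega>)) - exp (- (l * ?b \<omega>))\<bar>"
    using ia ib by simp
  also have "\<dots> \<le> (LINT \<omega>|M1. \<bar>exp (- (l * ?a \<omega>)) - exp (- (l * ?b \<omega>))\<bar>)" by (rule integral_abs_bound)
  also have "\<dots> \<le> (LINT \<omega>|M1. l * ((1 + 1 / e) * ?d \<omega> + e * ?b \<omega>))"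
  proof (rule integral_mono)
    fix \<omega> assume \<omega>: "\<omega> \<in> space M1"
    have "\<bar>exp (- (l * ?a \<omega>)) - exp (- (l * ?b \<omega>))\<bar> \<le> l * \<bar>?a \<omega> - ?b \<omega>\<bar>"
      by (rule exp_neg_lipschitz[OF a0 b0 l])
    also have "\<dots> \<le> l * ((1 + 1 / e) * ?d \<omega> + e * ?b \<omega>)"
      by (rule mult_left_mono[OF ptw[OF \<omega>] l])
    finally show "\<bar>exp (- (l * ?a \<omega>)) - exp (- (l * ?b \<omega>))\<bar> \<le> l * ((1 + 1 / e) * ?d \<omega> + e * ?b \<omega>)" .
  qed (use ia ib i1 i2 in auto)
  also have "\<dots> = l * ((1 + 1 / e) * (LINT \<omega>|M1. ?d \<omega>) + e * (LINT \<omega>|M1. ?b \<omega>))" using i1 i2 by simp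
  also have "\<dots> \<le> l * ((1 + 1 / e) * d + e * 1)"
    using l e le1 le2 by (intro mult_left_mono add_mono) auto
  finally show ?thesis by simp
qed

text \<open>Since \<open>exp (- t\<^sup>2 / 2)\<close> is the characteristic function of a standard normal variable, the Laplace
  transform of a quadratic form is an average of characteristic functions of linear forms.\<close>

lemma laplace_quadratic_eq:
  fixes W :: "'x \<Rightarrow> 'w \<Rightarrow> real"
  defines "R \<equiv> \<Pi>\<^sub>M i\<in>(UNIV::'x set). std_normal_distribution"
  assumes M: "prob_space M" and A: "finite A" and W [measurable]: "\<And>x. x \<in> A \<Longrightarrow> W x \<in> borel_measurable M"
    and q: "\<And>x. 0 \<le> q x"
  shows "complex_of_real (LINT \<omega>|M. exp (- (\<Sum>x\<in>A. q x * (W x \<omega>)\<^sup>2))) =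
    (LINT \<xi>|R. LINT \<omega>|M. iexp (\<Sum>x\<in>A. sqrt (2 * q x) * \<xi> x * W x \<omega>))"
proof -
  interpret R: prob_space R unfolding R_def by (rule prob_space_PiM_std_normal)
  interpret M: prob_space M by (rule M)
  interpret MR: pair_prob_space M R ..
  have [measurable]: "(\<lambda>\<xi>. \<xi> x) \<in> borel_measurable R" for x
    unfolding R_def by (rule normal_var_measurable[OF normal_var_PiM_std_normal])
  have meas [measurable]: "(\<lambda>(\<omega>, \<xi>). \<Sum>x\<in>A. sqrt (2 * q x) * \<xi> x * W x \<omega>) \<in> borel_measurable (M \<Otimes>\<^sub>M R)"
    unfolding split_beta' by (intro borel_measurable_sum) measurable
  have inner: "complex_of_real (exp (- (\<Sum>x\<in>A. q x * (W x \<omega>)\<^sup>2))) =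
     (LINT \<xi>|R. iexp (\<Sum>x\<in>A. sqrt (2 * q x) * \<xi> x * W x \<omega>))" for \<omega>
  proof -
    have "normal_var R (\<lambda>\<xi>. \<Sum>x\<in>A. (sqrt (2 * q x) * W x \<omega>) * \<xi> x) (\<Sum>x\<in>A. (sqrt (2 * q x) * W x \<omega>)\<^sup>2 * 1)"
    proof (rule R.normal_var_sum[OF _ A])
      have "R.indep_vars (\<lambda>_. borel) (\<lambda>x \<xi>. \<xi> x) A"
        unfolding R_def using indep_vars_PiM_std_normal[of "\<lambda>x. x" A] by simp
      from R.indep_vars_compose2[OF this, of "\<lambda>x y. (sqrt (2 * q x) * W x \<omega>) * y" "\<lambda>_. borel"]
      show "R.indep_vars (\<lambda>_. borel) (\<lambda>x \<xi>. (sqrt (2 * q x) * W x \<omega>) * \<xi> x) A" by simp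
      show "normal_var R (\<lambda>\<xi>. (sqrt (2 * q x) * W x \<omega>) * \<xi> x) ((sqrt (2 * q x) * W x \<omega>)\<^sup>2 * 1)" for x
        unfolding R_def by (intro normal_var_scale normal_var_PiM_std_normal)
    qed
    then have "(LINT \<xi>|R. iexp (1 * (\<Sum>x\<in>A. (sqrt (2 * q x) * W x \<omega>) * \<xi> x))) =
        complex_of_real (exp (- ((\<Sum>x\<in>A. (sqrt (2 * q x) * W x \<omega>)\<^sup>2 * 1) * 1\<^sup>2) / 2))"
      unfolding normal_var_def by blast
    \<comment> \<open>The factor 2 under the root cancels the 1 / 2 in the exponent of the
      characteristic function.\<close>
    also have "- ((\<Sum>x\<in>A. (sqrt (2 * q x) * W x \<omega>)\<^sup>2 * 1) * 1\<^sup>2) / 2 = - (\<Sum>x\<in>A. q x * (W x \<omega>)\<^sup>2)"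
      using q by (simp add: power_mult_distrib mult.assoc sum_distrib_left[symmetric])
    finally show ?thesis by (simp only: ac_simps mult_1)
  qed
  have int: "integrable (M \<Otimes>\<^sub>M R) (\<lambda>(\<omega>, \<xi>). iexp (\<Sum>x\<in>A. sqrt (2 * q x) * \<xi> x * W x \<omega>))"
  proof -
    have "integrable (M \<Otimes>\<^sub>M R) (\<lambda>z. iexp (case z of (\<omega>, \<xi>) \<Rightarrow> \<Sum>x\<in>A. sqrt (2 * q x) * \<xi> x * W x \<omega>))"
      by (rule MR.integrable_iexp) (auto simp del: of_real_sum)
    then show ?thesis by (simp only: split_beta')
  qed
  have "complex_of_real (LINT \<omega>|M. exp (- (\<Sum>x\<in>A. q x * (W x \<omega>)\<^sup>2))) =
      (LINT \<omega>|M. complex_of_real (exp (- (\<Sum>x\<in>A. q x * (W x \<omega>)\<^sup>2))))"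
    by (rule integral_complex_of_real[symmetric])
  also have "\<dots> = (LINT \<omega>|M. LINT \<xi>|R. iexp (\<Sum>x\<in>A. sqrt (2 * q x) * \<xi> x * W x \<omega>))"
    unfolding inner ..
  also have "\<dots> = (LINT \<xi>|R. LINT \<omega>|M. iexp (\<Sum>x\<in>A. sqrt (2 * q x) * \<xi> x * W x \<omega>))"
    using MR.Fubini_integral[OF int] by simp
  finally show ?thesis .
qed

text \<open>The characteristic functions converge for each \<xi> and have modulus at most one, so
  their averages over \<xi> converge.\<close>

lemma laplace_quadratic_tendsto:
  fixes W :: "nat \<Rightarrow> 'x \<Rightarrow> 'w \<Rightarrow> real" and G :: "'x \<Rightarrow> 'v \<Rightarrow> real"
  assumes M: "prob_space M" and P: "prob_space P" and A: "finite A"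
    and W [measurable]: "\<And>n x. x \<in> A \<Longrightarrow> W n x \<in> borel_measurable M"
    and G [measurable]: "\<And>x. x \<in> A \<Longrightarrow> G x \<in> borel_measurable P"
    and q: "\<And>x. 0 \<le> q x"
    and lim: "\<And>c. (\<lambda>n. LINT \<omega>|M. iexp (\<Sum>x\<in>A. c x * W n x \<omega>)) \<longlonglongrightarrow> (LINT \<omega>|P. iexp (\<Sum>x\<in>A. c x * G x \<omega>))"
  shows "(\<lambda>n. LINT \<omega>|M. exp (- (\<Sum>x\<in>A. q x * (W n x \<omega>)\<^sup>2))) \<longlonglongrightarrow> (LINT \<omega>|P. exp (- (\<Sum>x\<in>A. q x * (G x \<omega>)\<^sup>2)))"
proof -
  let ?R = "\<Pi>\<^sub>M i\<in>(UNIV::'x set). std_normal_distribution"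
  interpret R: prob_space ?R by (rule prob_space_PiM_std_normal)
  interpret M: prob_space M by (rule M)
  interpret P: prob_space P by (rule P)
  have [measurable]: "(\<lambda>\<xi>. \<xi> x) \<in> borel_measurable ?R" for x :: 'x
    by (rule normal_var_measurable[OF normal_var_PiM_std_normal])
  have m1: "(\<lambda>(\<xi>, \<omega>). \<Sum>x\<in>A. sqrt (2 * q x) * \<xi> x * W n x \<omega>) \<in> borel_measurable (?R \<Otimes>\<^sub>M M)" for n
    unfolding split_beta' by (intro borel_measurable_sum) measurable
  have m2: "(\<lambda>(\<xi>, \<omega>). \<Sum>x\<in>A. sqrt (2 * q x) * \<xi> x * G x \<omega>) \<in> borel_measurable (?R \<Otimes>\<^sub>M P)"
    unfolding split_beta' by (intro borel_measurable_sum) measurable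
  have "(\<lambda>n. LINT \<xi>|?R. LINT \<omega>|M. iexp (\<Sum>x\<in>A. sqrt (2 * q x) * \<xi> x * W n x \<omega>)) \<longlonglongrightarrow>
      (LINT \<xi>|?R. LINT \<omega>|P. iexp (\<Sum>x\<in>A. sqrt (2 * q x) * \<xi> x * G x \<omega>))"
  proof (rule integral_dominated_convergence)
    show "integrable ?R (\<lambda>_. 1 :: real)" by simp
    show "AE \<xi> in ?R. (\<lambda>n. LINT \<omega>|M. iexp (\<Sum>x\<in>A. sqrt (2 * q x) * \<xi> x * W n x \<omega>)) \<longlonglongrightarrow>
        (LINT \<omega>|P. iexp (\<Sum>x\<in>A. sqrt (2 * q x) * \<xi> x * G x \<omega>))"
      by (intro AE_I2 lim)
    show "(\<lambda>\<xi>. LINT \<omega>|M. iexp (\<Sum>x\<in>A. sqrt (2 * q x) * \<xi> x * W n x \<omega>)) \<in> borel_measurable ?R" for n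
      by (rule M.borel_measurable_lebesgue_integral) (use m1[of n] in \<open>simp add: split_beta' del: of_real_sum\<close>)
    show "(\<lambda>\<xi>. LINT \<omega>|P. iexp (\<Sum>x\<in>A. sqrt (2 * q x) * \<xi> x * G x \<omega>)) \<in> borel_measurable ?R"
      by (rule P.borel_measurable_lebesgue_integral) (use m2 in \<open>simp add: split_beta' del: of_real_sum\<close>)
    show "AE \<xi> in ?R. norm (LINT \<omega>|M. iexp (\<Sum>x\<in>A. sqrt (2 * q x) * \<xi> x * W n x \<omega>)) \<le> 1" for n
    proof (rule AE_I2)
      fix \<xi> :: "'x \<Rightarrow> real"
      have "norm (LINT \<omega>|M. iexp (\<Sum>x\<in>A. sqrt (2 * q x) * \<xi> x * W n x \<omega>)) \<le>
          (LINT \<omega>|M. norm (iexp (\<Sum>x\<in>A. sqrt (2 * q x) * \<xi> x * W n x \<omega>)))"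
        by (rule integral_norm_bound)
      also have "\<dots> = 1" by (simp only: norm_exp_i_times) (simp add: M.prob_space)
      finally show "norm (LINT \<omega>|M. iexp (\<Sum>x\<in>A. sqrt (2 * q x) * \<xi> x * W n x \<omega>)) \<le> 1" .
    qed
  qed
  then have "(\<lambda>n. complex_of_real (LINT \<omega>|M. exp (- (\<Sum>x\<in>A. q x * (W n x \<omega>)\<^sup>2)))) \<longlonglongrightarrow>
      complex_of_real (LINT \<omega>|P. exp (- (\<Sum>x\<in>A. q x * (G x \<omega>)\<^sup>2)))"
  proof -
    have "complex_of_real (LINT \<omega>|M. exp (- (\<Sum>x\<in>A. q x * (W n x \<omega>)\<^sup>2))) =
      (LINT \<xi>|?R. LINT \<omega>|M. iexp (\<Sum>x\<in>A. sqrt (2 * q x) * \<xi> x * W n x \<omega>))" for n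
      by (rule laplace_quadratic_eq[OF M A _ q]) (rule W)
    moreover have "complex_of_real (LINT \<omega>|P. exp (- (\<Sum>x\<in>A. q x * (G x \<omega>)\<^sup>2))) =
      (LINT \<xi>|?R. LINT \<omega>|P. iexp (\<Sum>x\<in>A. sqrt (2 * q x) * \<xi> x * G x \<omega>))"
      by (rule laplace_quadratic_eq[OF P A _ q]) (rule G)
    moreover note \<open>(\<lambda>n. LINT \<xi>|?R. LINT \<omega>|M. iexp (\<Sum>x\<in>A. sqrt (2 * q x) * \<xi> x * W n x \<omega>)) \<longlonglongrightarrow> _\<close>
    ultimately show ?thesis by (simp only:)
  qed
  then show ?thesis by (simp only: tendsto_of_real_iff)
qed


text \<open>In contrast to \<open>indep_sum_moments\<close> this is an equality: through it the
  normalised sums have the kernel as their covariance for every n > 0.\<close>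

lemma (in prob_space) indep_sum_square:
  fixes Y :: "nat \<Rightarrow> 'a \<Rightarrow> real"
  assumes ind: "indep_vars (\<lambda>_. borel) Y UNIV"
    and int: "\<And>j. integrable M (\<lambda>\<omega>. (Y j \<omega>)\<^sup>2)"
    and mean: "\<And>j. expectation (Y j) = 0" and var: "\<And>j. expectation (\<lambda>\<omega>. (Y j \<omega>)\<^sup>2) = v"
  shows "integrable M (\<lambda>\<omega>. (\<Sum>j<n. Y j \<omega>)\<^sup>2) \<and> expectation (\<lambda>\<omega>. (\<Sum>j<n. Y j \<omega>)\<^sup>2) = real n * v"
proof (induction n)
  case (Suc n)
  let ?S = "\<lambda>\<omega>. \<Sum>j<n. Y j \<omega>"
  have [measurable]: "Y j \<in> borel_measurable M" for j
    using ind by (simp add: indep_vars_def)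
  have iY: "integrable M (Y j)" for j
    by (rule square_integrable_imp_integrable[OF _ int]) simp
  have iS: "integrable M ?S" by (intro Bochner_Integration.integrable_sum iY)
  have iv: "indep_var borel (Y n) borel ?S"
    using ind by (intro indep_vars_sum) (auto intro: indep_vars_subset)
  have p: "integrable M (\<lambda>\<omega>. Y n \<omega> * ?S \<omega>)" "expectation (\<lambda>\<omega>. Y n \<omega> * ?S \<omega>) = 0"
    using indep_var_integrable[OF iv iY iS] indep_var_lebesgue_integral[OF iv iY iS] mean[of n] by simp_all
  have eq: "(\<Sum>j<Suc n. Y j \<omega>)\<^sup>2 = (?S \<omega>)\<^sup>2 + 2 * (Y n \<omega> * ?S \<omega>) + (Y n \<omega>)\<^sup>2" for \<omega>
    by (simp add: power2_eq_square algebra_simps)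
  have IH: "integrable M (\<lambda>\<omega>. (?S \<omega>)\<^sup>2)" "expectation (\<lambda>\<omega>. (?S \<omega>)\<^sup>2) = real n * v"
    using Suc.IH by auto
  show ?case
    unfolding eq using IH p int[of n] var[of n] by (simp add: algebra_simps)
qed simp

section \<open>The limit distribution\<close>

text \<open>The law enters in two ways: its characteristic functional makes the projections normal,
  and equality of distributions is what the central limit theorem asks for.\<close>

locale gaussian_sample = prob_space M
  for M :: "'w measure" +
  fixes X :: "nat \<Rightarrow> 'w \<Rightarrow> 'h::{real_inner, second_countable_topology}" and \<mu> :: 'h and C :: "'h \<Rightarrow> 'h"
  assumes X_indep: "indep_vars (\<lambda>_. borel) X UNIV"
    and X_distr: "\<And>j. distr M borel (X j) = distr M borel (X 0)"
    and X_char: "\<And>j f. (LINT \<omega>|M. iexp (inner (X j \<omega>) f)) = gauss_char \<mu> C f"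
    and C_linear: "bounded_linear C"
    and C_sym: "\<And>f g. inner (C f) g = inner f (C g)"
    and C_nonneg: "\<And>f. 0 \<le> inner (C f) f"
begin

abbreviation \<sigma> :: "'h \<Rightarrow> 'h \<Rightarrow> real" where
  "\<sigma> f g \<equiv> inner (C f) g"

abbreviation K :: "'h \<Rightarrow> 'h \<Rightarrow> real" where
  "K \<equiv> limit_kernel C"

definition z :: "'h \<Rightarrow> nat \<Rightarrow> 'w \<Rightarrow> real" where
  "z f j \<omega> = inner (X j \<omega> - \<mu>) f"

definition \<Psi> :: "'h \<Rightarrow> nat \<Rightarrow> 'w \<Rightarrow> real" where
  "\<Psi> f j \<omega> = psi (\<sigma> f f) (z f j \<omega>)"

definition W :: "nat \<Rightarrow> 'h \<Rightarrow> 'w \<Rightarrow> real" where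
  "W n f \<omega> = W_stat n (\<sigma> f f) (\<lambda>j. z f j \<omega>)"

lemma X_measurable [measurable]: "X j \<in> borel_measurable M"
  using X_indep by (simp add: indep_vars_def)

lemma z_measurable [measurable]: "z f j \<in> borel_measurable M"
  unfolding z_def[abs_def] by measurable

lemma C_scaleR: "C (a *\<^sub>R f) = a *\<^sub>R C f" and C_add: "C (f + g) = C f + C g"
  using bounded_linear.linear[OF C_linear] by (auto simp: linear_add linear_scale)

lemma normal_z: "normal_var M (z f j) (\<sigma> f f)"
  unfolding normal_var_def
proof (intro conjI allI)
  fix t :: real
  have "iexp (t * z f j \<omega>) = iexp (- inner \<mu> (t *\<^sub>R f)) * iexp (inner (X j \<omega>) (t *\<^sub>R f))" for \<omega>
    by (simp add: z_def inner_diff_left exp_add[symmetric] algebra_simps)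
  then have "(LINT \<omega>|M. iexp (t * z f j \<omega>)) = iexp (- inner \<mu> (t *\<^sub>R f)) * gauss_char \<mu> C (t *\<^sub>R f)"
    using X_char[of j "t *\<^sub>R f"] by simp
  also have "\<dots> = exp (of_real (- (\<sigma> f f * t\<^sup>2) / 2))"
    unfolding gauss_char_def exp_add[symmetric] C_scaleR
    by (simp add: power2_eq_square algebra_simps)
  finally show "(LINT \<omega>|M. iexp (t * z f j \<omega>)) = of_real (exp (- (\<sigma> f f * t\<^sup>2) / 2))"
    by (simp only: exp_of_real)
qed (auto simp: C_nonneg)

lemma \<sigma>_sym: "\<sigma> f g = \<sigma> g f"
  by (metis C_sym inner_commute)

lemma pair: "normal_pair M (z f j) (z g j) (\<sigma> f f) (\<sigma> f g) (\<sigma> g g)"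
proof
  fix \<alpha> \<beta> :: real
  have z: "z (\<alpha> *\<^sub>R f + \<beta> *\<^sub>R g) j = (\<lambda>\<omega>. \<alpha> * z f j \<omega> + \<beta> * z g j \<omega>)"
    by (simp add: z_def inner_right_distrib fun_eq_iff)
  have \<sigma>: "\<sigma> (\<alpha> *\<^sub>R f + \<beta> *\<^sub>R g) (\<alpha> *\<^sub>R f + \<beta> *\<^sub>R g) = \<alpha>\<^sup>2 * \<sigma> f f + 2 * \<alpha> * \<beta> * \<sigma> f g + \<beta>\<^sup>2 * \<sigma> g g"
    using \<sigma>_sym[of g f]
    by (simp add: C_scaleR C_add
       inner_right_distrib inner_left_distrib power2_eq_square algebra_simps)
  show "normal_var M (\<lambda>\<omega>. \<alpha> * z f j \<omega> + \<beta> * z g j \<omega>) (\<alpha>\<^sup>2 * \<sigma> f f + 2 * \<alpha> * \<beta> * \<sigma> f g + \<beta>\<^sup>2 * \<sigma> g g)"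
    using normal_z[of "\<alpha> *\<^sub>R f + \<beta> *\<^sub>R g" j] unfolding z \<sigma> .
qed

lemma
  shows \<Psi>_integrable: "integrable M (\<Psi> f j)" and E_\<Psi>: "expectation (\<Psi> f j) = 0"
    and \<Psi>_\<Psi>_integrable: "integrable M (\<lambda>\<omega>. \<Psi> f j \<omega> * \<Psi> g j \<omega>)"
    and E_\<Psi>_\<Psi>: "expectation (\<lambda>\<omega>. \<Psi> f j \<omega> * \<Psi> g j \<omega>) = K f g"
proof -
  interpret normal_pair M "z f j" "z g j" "\<sigma> f f" "\<sigma> f g" "\<sigma> g g" by (rule pair)
  show "integrable M (\<Psi> f j)" "expectation (\<Psi> f j) = 0" "integrable M (\<lambda>\<omega>. \<Psi> f j \<omega> * \<Psi> g j \<omega>)"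
    "expectation (\<lambda>\<omega>. \<Psi> f j \<omega> * \<Psi> g j \<omega>) = K f g"
    unfolding \<Psi>_def[abs_def] using psi_integrable E_psi psi_psi_integrable E_psi_psi
    by (auto simp: limit_kernel_def Let_def)
qed

lemma lin_\<Psi>:
  assumes "finite A"
  shows "integrable M (\<lambda>\<omega>. \<Sum>f\<in>A. c f * \<Psi> f j \<omega>)" "expectation (\<lambda>\<omega>. \<Sum>f\<in>A. c f * \<Psi> f j \<omega>) = 0"
    "integrable M (\<lambda>\<omega>. (\<Sum>f\<in>A. c f * \<Psi> f j \<omega>)\<^sup>2)"
    "expectation (\<lambda>\<omega>. (\<Sum>f\<in>A. c f * \<Psi> f j \<omega>)\<^sup>2) = (\<Sum>f\<in>A. \<Sum>g\<in>A. c f * c g * K f g)"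
proof -
  show "integrable M (\<lambda>\<omega>. \<Sum>f\<in>A. c f * \<Psi> f j \<omega>)" "expectation (\<lambda>\<omega>. \<Sum>f\<in>A. c f * \<Psi> f j \<omega>) = 0"
    using \<Psi>_integrable E_\<Psi> by (simp_all add: Bochner_Integration.integral_sum)
  have eq: "(\<Sum>f\<in>A. c f * \<Psi> f j \<omega>)\<^sup>2 = (\<Sum>f\<in>A. \<Sum>g\<in>A. c f * c g * (\<Psi> f j \<omega> * \<Psi> g j \<omega>))" for \<omega>
    unfolding power2_eq_square sum_product by (simp add: ac_simps)
  show "integrable M (\<lambda>\<omega>. (\<Sum>f\<in>A. c f * \<Psi> f j \<omega>)\<^sup>2)"
    unfolding eq using \<Psi>_\<Psi>_integrable by simp
  show "expectation (\<lambda>\<omega>. (\<Sum>f\<in>A. c f * \<Psi> f j \<omega>)\<^sup>2) = (\<Sum>f\<in>A. \<Sum>g\<in>A. c f * c g * K f g)"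
    unfolding eq using \<Psi>_\<Psi>_integrable E_\<Psi>_\<Psi> by (simp add: Bochner_Integration.integral_sum)
qed

text \<open>Positive definiteness is inherited from the variables \<open>\<Psi> f 0\<close>, of
  which K is the covariance.\<close>

lemma psd_K: "psd K"
  unfolding psd_def
proof (intro conjI allI impI)
  show "K f g = K g f" for f g
    using \<sigma>_sym[of f g] by (simp add: limit_kernel_def Let_def add.commute)
  fix A :: "'h set" and c :: "'h \<Rightarrow> real" assume A: "finite A"
  have "0 \<le> expectation (\<lambda>\<omega>. (\<Sum>f\<in>A. c f * \<Psi> f 0 \<omega>)\<^sup>2)" by simp
  then show "0 \<le> (\<Sum>f\<in>A. \<Sum>g\<in>A. c f * c g * K f g)" unfolding lin_\<Psi>(4)[OF A] .
qed

lemma K_diag_le_1: "K f f \<le> 1"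
proof -
  have "exp (- (\<sigma> f f + \<sigma> f f) / 2) * (exp (\<sigma> f f) - 1 - \<sigma> f f - (\<sigma> f f)\<^sup>2 / 2) \<le>
      exp (- (\<sigma> f f + \<sigma> f f) / 2) * exp (\<sigma> f f)"
    using C_nonneg[of f] zero_le_power2[of "\<sigma> f f"] by (intro mult_left_mono) (linarith, simp)
  also have "\<dots> = 1" by (simp add: exp_add[symmetric])
  finally show ?thesis by (simp add: limit_kernel_def Let_def)
qed

lemma C_tendsto: "Y \<longlonglongrightarrow> y \<Longrightarrow> (\<lambda>n. C (Y n)) \<longlonglongrightarrow> C y"
  by (rule bounded_linear.tendsto[OF C_linear])

lemma C_measurable [measurable]: "C \<in> borel_measurable borel"
  by (intro borel_measurable_continuous_onI linear_continuous_on C_linear)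

lemma cov_kernel_K:
  assumes "prob_space Q" "sets Q = sets borel"
  shows "cov_kernel Q K"
proof (intro cov_kernel.intro cov_kernel_axioms.intro assms psd_K)
  show "\<bar>K f g\<bar> \<le> 1" for f g
    \<comment> \<open>The values 1 and - 1 of t give 2 |K f g| \<le> K f f + K g g.\<close>
    using psd_extend[OF psd_K, of "{f}" "\<lambda>_. 1" 1 g] psd_extend[OF psd_K, of "{f}" "\<lambda>_. 1" "- 1" g]
      K_diag_le_1[of f] K_diag_le_1[of g] by simp
  show "(\<lambda>n. K (F n) (G n)) \<longlonglongrightarrow> K f g" if "F \<longlonglongrightarrow> f" "G \<longlonglongrightarrow> g" for F G f g
    unfolding limit_kernel_def Let_def by (intro tendsto_intros C_tendsto that) simp_all
qed

lemma indep_lin_\<Psi>: "indep_vars (\<lambda>_. borel) (\<lambda>j \<omega>. \<Sum>f\<in>A. c f * \<Psi> f j \<omega>) UNIV"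
proof -
  have "(\<lambda>x. \<Sum>f\<in>A. c f * psi (\<sigma> f f) (inner (x - \<mu>) f)) \<in> borel_measurable borel"
    by measurable
  from indep_vars_compose2[OF X_indep, of "\<lambda>_ x. \<Sum>f\<in>A. c f * psi (\<sigma> f f) (inner (x - \<mu>) f)" "\<lambda>_. borel", OF this]
  show ?thesis by (simp add: \<Psi>_def z_def)
qed

lemma lin_W: "(\<Sum>f\<in>A. c f * W n f \<omega>) = (\<Sum>j<n. \<Sum>f\<in>A. c f * \<Psi> f j \<omega>) / sqrt (real n)"
  unfolding W_def W_stat_def \<Psi>_def
  by (subst sum.swap) (simp add: sum_divide_distrib sum_distrib_left)

lemma
  assumes A: "finite A" and n: "n > 0"
  shows lin_W_square_integrable: "integrable M (\<lambda>\<omega>. (\<Sum>f\<in>A. c f * W n f \<omega>)\<^sup>2)"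
    and lin_W_square: "expectation (\<lambda>\<omega>. (\<Sum>f\<in>A. c f * W n f \<omega>)\<^sup>2) = (\<Sum>f\<in>A. \<Sum>g\<in>A. c f * c g * K f g)"
proof -
  have "integrable M (\<lambda>\<omega>. (\<Sum>j<n. \<Sum>f\<in>A. c f * \<Psi> f j \<omega>)\<^sup>2) \<and>
    expectation (\<lambda>\<omega>. (\<Sum>j<n. \<Sum>f\<in>A. c f * \<Psi> f j \<omega>)\<^sup>2) = real n * (\<Sum>f\<in>A. \<Sum>g\<in>A. c f * c g * K f g)"
    by (rule indep_sum_square[OF indep_lin_\<Psi> lin_\<Psi>(3)[OF A] lin_\<Psi>(2)[OF A] lin_\<Psi>(4)[OF A]])
  then show "integrable M (\<lambda>\<omega>. (\<Sum>f\<in>A. c f * W n f \<omega>)\<^sup>2)"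
    "expectation (\<lambda>\<omega>. (\<Sum>f\<in>A. c f * W n f \<omega>)\<^sup>2) = (\<Sum>f\<in>A. \<Sum>g\<in>A. c f * c g * K f g)"
    unfolding lin_W using n by (simp_all add: power_divide)
qed

text \<open>A linear combination of the W n f is itself a normalised sum of independent variables,
  so the one-dimensional central limit theorem applies. Vanishing variance is treated apart, since
  the theorem divides by the standard deviation; otherwise evaluation at sqrt v undoes the
  division.\<close>

lemma W_char_tendsto:
  assumes A: "finite A"
  shows "(\<lambda>n. LINT \<omega>|M. iexp (\<Sum>f\<in>A. c f * W n f \<omega>)) \<longlonglongrightarrow>
    of_real (exp (- (\<Sum>f\<in>A. \<Sum>g\<in>A. c f * c g * K f g) / 2))"
proof -
  define v where "v = (\<Sum>f\<in>A. \<Sum>g\<in>A. c f * c g * K f g)"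
  define Y where "Y j \<omega> = (\<Sum>f\<in>A. c f * \<Psi> f j \<omega>)" for j \<omega>
  have v0: "0 \<le> v" unfolding v_def by (rule psdD[OF psd_K A])
  have Ymeas [measurable]: "Y j \<in> borel_measurable M" for j
    unfolding Y_def \<Psi>_def[abs_def] by measurable
  have YW: "(\<Sum>f\<in>A. c f * W n f \<omega>) = (\<Sum>j<n. Y j \<omega>) / sqrt (real n)" for n \<omega>
    unfolding lin_W Y_def ..
  have Y: "indep_vars (\<lambda>_. borel) Y UNIV" "integrable M (Y j)" "expectation (Y j) = 0"
    "integrable M (\<lambda>\<omega>. (Y j \<omega>)\<^sup>2)" "expectation (\<lambda>\<omega>. (Y j \<omega>)\<^sup>2) = v" for j
    unfolding Y_def[abs_def] v_def by (rule indep_lin_\<Psi> lin_\<Psi>[OF A])+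
  show ?thesis
  proof (cases "v = 0")
    case True
    have "(LINT \<omega>|M. iexp ((\<Sum>j<n. Y j \<omega>) / sqrt (real n))) = 1" for n
    proof -
      have "AE \<omega> in M. Y j \<omega> = 0" for j
        using integral_nonneg_eq_0_iff_AE[OF Y(4)[of j]] Y(5)[of j] True by simp
      then have "AE \<omega> in M. \<forall>j. Y j \<omega> = 0" by (simp add: AE_all_countable)
      then have "(LINT \<omega>|M. iexp ((\<Sum>j<n. Y j \<omega>) / sqrt (real n))) = (LINT \<omega>|M. 1)"
        by (intro integral_cong_AE) (auto elim!: eventually_mono)
      then show ?thesis by (simp add: prob_space)
    qed
    then show ?thesis using True unfolding YW v_def[symmetric] by simp
  next
    case False
    then have vp: "0 < v" using v0 by simp
    define F where "F x = (\<Sum>f\<in>A. c f * psi (\<sigma> f f) (inner (x - \<mu>) f))" for x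
    have [measurable]: "F \<in> borel_measurable borel" unfolding F_def by measurable
    have YF: "Y j = (\<lambda>\<omega>. F (X j \<omega>))" for j by (simp add: Y_def F_def \<Psi>_def z_def fun_eq_iff)
    have dist: "distr M borel (Y j) = distr M borel (Y 0)" for j
    proof -
      have "distr M borel (Y j) = distr (distr M borel (X j)) borel F" for j
        unfolding YF by (subst distr_distr) (simp_all add: comp_def)
      then show ?thesis using X_distr[of j] by simp
    qed
    have "weak_conv_m (\<lambda>n. distr M borel (\<lambda>\<omega>. (\<Sum>j<n. Y j \<omega>) / sqrt (real n * (sqrt v)\<^sup>2))) std_normal_distribution"
      by (rule central_limit_theorem_zero_mean[OF Y(1,3) _ Y(4) _ dist]) (use vp Y in auto)
    then have "(\<lambda>n. char (distr M borel (\<lambda>\<omega>. (\<Sum>j<n. Y j \<omega>) / sqrt (real n * (sqrt v)\<^sup>2))) (sqrt v)) \<longlonglongrightarrow>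
        char std_normal_distribution (sqrt v)"
      by (intro levy_continuity1 real_distribution_distr real_dist_normal_dist) measurable
    moreover have "char (distr M borel (\<lambda>\<omega>. (\<Sum>j<n. Y j \<omega>) / sqrt (real n * (sqrt v)\<^sup>2))) (sqrt v) =
        (LINT \<omega>|M. iexp ((\<Sum>j<n. Y j \<omega>) / sqrt (real n)))" for n
    proof -
      have eq: "sqrt v * ((\<Sum>j<n. Y j \<omega>) / sqrt (real n * (sqrt v)\<^sup>2)) = (\<Sum>j<n. Y j \<omega>) / sqrt (real n)" for \<omega>
        using vp by (simp add: real_sqrt_mult)
      have "char (distr M borel (\<lambda>\<omega>. (\<Sum>j<n. Y j \<omega>) / sqrt (real n * (sqrt v)\<^sup>2))) (sqrt v) =
          (LINT \<omega>|M. iexp (sqrt v * ((\<Sum>j<n. Y j \<omega>) / sqrt (real n * (sqrt v)\<^sup>2))))"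
        unfolding char_def by (rule integral_distr) measurable
      then show ?thesis unfolding eq .
    qed
    moreover have "char std_normal_distribution (sqrt v) = of_real (exp (- v / 2))"
      using v0 by (simp add: char_std_normal_distribution)
    ultimately show ?thesis unfolding YW v_def[symmetric] by (simp only:)
  qed
qed

lemma iid_z: "iid_normal M (z f) (\<sigma> f f)"
proof
  have "(\<lambda>x. inner (x - \<mu>) f) \<in> borel_measurable borel" by measurable
  from indep_vars_compose2[OF X_indep, of "\<lambda>_ x. inner (x - \<mu>) f" "\<lambda>_. borel", OF this]
  show "indep_vars (\<lambda>_. borel) (z f) UNIV" by (simp add: z_def[abs_def])
qed (rule normal_z)

end

section \<open>The linearisation error in mean square over Q\<close>

locale test_setting = gaussian_sample M X \<mu> C + Q: prob_space Q
  for M :: "'w measure" and X :: "nat \<Rightarrow> 'w \<Rightarrow> 'h::{real_inner, second_countable_topology}"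
    and \<mu> C and Q :: "'h measure" +
  assumes Q_borel: "sets Q = sets borel"
    and Q_moment: "integrable Q (\<lambda>f. norm f ^ 4)"
begin

sublocale cov_kernel Q K
  by (intro cov_kernel_K Q.prob_space_axioms Q_borel)

sublocale MQ: pair_prob_space M Q ..

definition Vn :: "nat \<Rightarrow> 'w \<Rightarrow> 'h \<Rightarrow> real" where
  "Vn n \<omega> f = V_stat n (\<lambda>j. z f j \<omega>)"

lemma z_measurable_pair [measurable]: "(\<lambda>(\<omega>, f). z f j \<omega>) \<in> borel_measurable (M \<Otimes>\<^sub>M Q)"
proof -
  have [measurable]: "(\<lambda>f. f) \<in> measurable Q borel" by (simp cong: measurable_cong_sets add: sets_Q)
  show ?thesis unfolding z_def split_beta' by measurable
qed

lemma \<sigma>_measurable [measurable]: "(\<lambda>f. \<sigma> f f) \<in> borel_measurable Q"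
proof -
  have [measurable]: "(\<lambda>f. f) \<in> measurable Q borel" by (simp cong: measurable_cong_sets add: sets_Q)
  show ?thesis by measurable
qed

lemma Vn_measurable_pair [measurable]: "(\<lambda>(\<omega>, f). Vn n \<omega> f) \<in> borel_measurable (M \<Otimes>\<^sub>M Q)"
  unfolding Vn_def split_beta'
  by (rule V_stat_measurable) (use z_measurable_pair in \<open>simp add: split_beta'\<close>)

lemma W_measurable_pair [measurable]: "(\<lambda>(\<omega>, f). W n f \<omega>) \<in> borel_measurable (M \<Otimes>\<^sub>M Q)"
  unfolding W_def split_beta'
  by (rule W_stat_measurable) (use z_measurable_pair in \<open>simp_all add: split_beta'\<close>)

lemma W_measurable [measurable]: "W n f \<in> borel_measurable M"
  unfolding W_def[abs_def] by (rule W_stat_measurable) simp_all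

text \<open>Dominated convergence over Q: boundedness of C gives \<sigma> f f \<le> B (norm f)^2, so
  the bound of order two in the variance is integrable by the fourth moment of Q.\<close>

lemma remainder_tendsto:
  "\<exists>\<rho>. \<rho> \<longlonglongrightarrow> 0 \<and> (\<forall>n. 0 \<le> \<rho> n) \<and> (\<forall>n>0. (\<integral>\<^sup>+f. \<integral>\<^sup>+\<omega>. ennreal ((Vn n \<omega> f - W n f \<omega>)\<^sup>2) \<partial>M \<partial>Q) = ennreal (\<rho> n))"
proof -
  \<comment> \<open>The value 0 at n = 0 makes the bounds valid for all n, although the estimates of
    the error are for n > 0.\<close>
  define r where "r n f = (if n = 0 then 0 else (LINT \<omega>|M. (Vn n \<omega> f - W n f \<omega>)\<^sup>2))" for n f
  obtain B where B: "\<And>f. norm (C f) \<le> norm f * B" and B0: "0 \<le> B"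
    using bounded_linear.nonneg_bounded[OF C_linear] by blast
  have \<sigma>_le: "\<sigma> f f \<le> B * (norm f)\<^sup>2" for f
  proof -
    have "\<sigma> f f \<le> norm (C f) * norm f" by (rule norm_cauchy_schwarz)
    also have "\<dots> \<le> norm f * B * norm f" by (intro mult_right_mono B) simp
    finally show ?thesis by (simp add: power2_eq_square ac_simps)
  qed
  have \<sigma>2_le: "(\<sigma> f f)\<^sup>2 \<le> B\<^sup>2 * norm f ^ 4" for f
    using power_mono[OF \<sigma>_le C_nonneg, of f 2] by (simp add: power_mult_distrib)
  have r0: "0 \<le> r n f" for n f by (simp add: r_def)
  have rb: "r n f \<le> 240 * (B\<^sup>2 * norm f ^ 4) + 729" for n f
  proof (cases "n = 0")
    case False
    interpret zf: iid_normal M "z f" "\<sigma> f f" by (rule iid_z)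
    have "r n f \<le> 240 * (\<sigma> f f)\<^sup>2 + 729"
      using zf.remainder_bounded[of n] False by (simp add: r_def Vn_def W_def)
    then show ?thesis using \<sigma>2_le[of f] by linarith
  qed (simp add: r_def)
  have r_lim: "(\<lambda>n. r n f) \<longlonglongrightarrow> 0" for f
  proof -
    interpret zf: iid_normal M "z f" "\<sigma> f f" by (rule iid_z)
    have le: "r n f \<le> (216 * (\<sigma> f f)\<^sup>2 + 729 + 576 * (\<sigma> f f) ^ 4) / real n" for n
      using zf.remainder_small[of n] by (simp add: r_def Vn_def W_def)
    show ?thesis
      by (rule tendsto_sandwich[OF _ _ tendsto_const lim_const_over_n]; rule always_eventually; rule allI)
        (rule r0 le)+
  qed
  have meas [measurable]: "r n \<in> borel_measurable Q" for n
  proof (cases "n = 0")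
    case False
    have "(\<lambda>f. LINT \<omega>|M. (Vn n \<omega> f - W n f \<omega>)\<^sup>2) \<in> borel_measurable Q"
    proof (rule borel_measurable_lebesgue_integral)
      have "(\<lambda>z. (\<lambda>(\<omega>, f). (Vn n \<omega> f - W n f \<omega>)\<^sup>2) (snd z, fst z)) \<in> borel_measurable (Q \<Otimes>\<^sub>M M)"
        by (rule measurable_compose[of _ _ "M \<Otimes>\<^sub>M Q"]) measurable
      then show "(\<lambda>(f, \<omega>). (Vn n \<omega> f - W n f \<omega>)\<^sup>2) \<in> borel_measurable (Q \<Otimes>\<^sub>M M)" by (simp add: split_beta')
    qed
    then show ?thesis using False by (simp add: r_def[abs_def])
  qed (simp add: r_def[abs_def])
  have dom: "integrable Q (\<lambda>f. 240 * (B\<^sup>2 * norm f ^ 4) + 729)" using Q_moment by simp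
  have int: "integrable Q (r n)" for n
    by (rule Bochner_Integration.integrable_bound[OF dom]) (use rb r0 in \<open>auto intro: order.trans[OF _ abs_ge_self]\<close>)
  have "(\<lambda>n. LINT f|Q. r n f) \<longlonglongrightarrow> (LINT f|Q. 0)"
    by (rule integral_dominated_convergence[OF _ _ dom]) (use rb r0 r_lim in auto)
  moreover have "(\<integral>\<^sup>+f. \<integral>\<^sup>+\<omega>. ennreal ((Vn n \<omega> f - W n f \<omega>)\<^sup>2) \<partial>M \<partial>Q) = ennreal (LINT f|Q. r n f)" if "n > 0" for n
  proof -
    have "(\<integral>\<^sup>+\<omega>. ennreal ((Vn n \<omega> f - W n f \<omega>)\<^sup>2) \<partial>M) = ennreal (r n f)" for f
    proof -
      interpret zf: iid_normal M "z f" "\<sigma> f f" by (rule iid_z)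
      show ?thesis
        using that zf.remainder_integrable[OF that] unfolding r_def Vn_def W_def
        by (subst nn_integral_eq_integral) auto
    qed
    then show ?thesis using int r0 by (simp add: nn_integral_eq_integral)
  qed
  ultimately show ?thesis using r0 by (intro exI[of _ "\<lambda>n. LINT f|Q. r n f"]) auto
qed

end

section \<open>Passage to the limit in the Laplace transform\<close>

locale test_limit = test_setting M X \<mu> C Q + gaussian_approx Q "limit_kernel C" P t g
  for M :: "'w measure" and X :: "nat \<Rightarrow> 'w \<Rightarrow> 'h::{real_inner, second_countable_topology}"
    and \<mu> C and Q :: "'h measure" and P :: "'p measure" and t g
begin

lemma Vn_L2: "\<omega> \<in> space M \<Longrightarrow> Vn n \<omega> \<in> L2 Q"
proof -
  assume \<omega>: "\<omega> \<in> space M"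
  have m: "Vn n \<omega> \<in> borel_measurable Q"
    using measurable_compose[OF measurable_Pair1'[OF \<omega>] Vn_measurable_pair, of n] by simp
  have "\<bar>Vn n \<omega> f\<bar> \<le> sqrt (real n) * 3" for f
  proof -
    let ?a = "(\<Sum>j<n. z f j \<omega>) / real n"
    let ?u = "(\<Sum>j<n. (z f j \<omega> - ?a)\<^sup>2) / real n"
    have "\<bar>cos y + sin y\<bar> \<le> 2" for y :: real
      using cos_ge_minus_one[of y] cos_le_one[of y] sin_ge_minus_one[of y] sin_le_one[of y] by linarith
    then have "\<bar>\<Sum>j<n. cos (z f j \<omega> - ?a) + sin (z f j \<omega> - ?a)\<bar> \<le> (\<Sum>j<n. 2)"
      by (intro order.trans[OF sum_abs] sum_mono)
    then have 1: "\<bar>(\<Sum>j<n. cos (z f j \<omega> - ?a) + sin (z f j \<omega> - ?a)) / real n\<bar> \<le> 2"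
      by (cases "n = 0") (auto simp: field_simps)
    have "0 \<le> ?u" by (simp add: sum_nonneg)
    then have "exp (- ?u / 2) \<le> 1" "0 < exp (- ?u / 2)" by auto
    with 1 have "\<bar>(\<Sum>j<n. cos (z f j \<omega> - ?a) + sin (z f j \<omega> - ?a)) / real n - exp (- ?u / 2)\<bar> \<le> 3" by linarith
    then show ?thesis
      unfolding Vn_def V_stat_def Let_def abs_mult by (intro mult_mono) auto
  qed
  then have "(Vn n \<omega> f)\<^sup>2 \<le> (sqrt (real n) * 3)\<^sup>2" for f
    by (simp only: abs_le_square_iff[symmetric]) (simp add: abs_mult)
  then show ?thesis
    unfolding L2_def using m by (auto intro!: Q.integrable_const_bound[where B = "(sqrt (real n) * 3)\<^sup>2"])
qed

lemma W_t_measurable_pair [measurable]: "(\<lambda>(\<omega>, f). W n (t m f) \<omega>) \<in> borel_measurable (M \<Otimes>\<^sub>M Q)"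
  using measurable_compose[of "\<lambda>(\<omega>, f). (\<omega>, t m f)" "M \<Otimes>\<^sub>M Q" "M \<Otimes>\<^sub>M Q", OF _ W_measurable_pair[of n]]
  by (simp add: split_beta')

lemma W_t_L2: "\<omega> \<in> space M \<Longrightarrow> (\<lambda>f. W n (t m f) \<omega>) \<in> L2 Q"
proof -
  assume \<omega>: "\<omega> \<in> space M"
  have m: "(\<lambda>f. W n (t m f) \<omega>) \<in> borel_measurable Q"
    using measurable_compose[OF measurable_Pair1'[OF \<omega>] W_t_measurable_pair, of n m] by simp
  have "finite ((\<lambda>y. (W n y \<omega>)\<^sup>2) ` range (t m))" using finite_range_t by blast
  then have "(W n (t m f) \<omega>)\<^sup>2 \<le> Max ((\<lambda>y. (W n y \<omega>)\<^sup>2) ` range (t m))" for f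
    by (rule Max_ge) auto
  then show ?thesis
    unfolding L2_def using m
    by (auto intro!: Q.integrable_const_bound[where B = "Max ((\<lambda>y. (W n y \<omega>)\<^sup>2) ` range (t m))"])
qed

text \<open>The right side does not depend on n, so replacing f by t m f costs the same for all
  sample sizes.\<close>

lemma W_diff_moment:
  assumes n: "n > 0"
  shows "(\<integral>\<^sup>+\<omega>. ennreal ((W n f \<omega> - W n h \<omega>)\<^sup>2) \<partial>M) = ennreal (kdist f h)"
proof (cases "f = h")
  case True
  then show ?thesis by (simp add: kdist_def)
next
  case False
  let ?c = "\<lambda>y. if y = f then 1 else - 1 :: real"
  have eq: "(\<Sum>y\<in>{f, h}. ?c y * W n y \<omega>) = W n f \<omega> - W n h \<omega>" for \<omega> using False by auto
  have v: "(\<Sum>y\<in>{f, h}. \<Sum>y'\<in>{f, h}. ?c y * ?c y' * K y y') = kdist f h"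
    using False K_sym[of f h] by (auto simp: kdist_def)
  have "integrable M (\<lambda>\<omega>. (W n f \<omega> - W n h \<omega>)\<^sup>2)" "expectation (\<lambda>\<omega>. (W n f \<omega> - W n h \<omega>)\<^sup>2) = kdist f h"
    using lin_W_square_integrable[where A = "{f, h}" and n = n and c = ?c] lin_W_square[where A = "{f, h}" and n = n and c = ?c] n unfolding eq v by auto
  then show ?thesis by (subst nn_integral_eq_integral) auto
qed

lemma W_moment:
  assumes n: "n > 0"
  shows "(\<integral>\<^sup>+\<omega>. ennreal ((W n f \<omega>)\<^sup>2) \<partial>M) \<le> 1"
proof -
  have "integrable M (\<lambda>\<omega>. (W n f \<omega>)\<^sup>2)" "expectation (\<lambda>\<omega>. (W n f \<omega>)\<^sup>2) = K f f"
    using lin_W_square_integrable[where A = "{f}" and n = n and c = "\<lambda>_. 1"] lin_W_square[where A = "{f}" and n = n and c = "\<lambda>_. 1"] n by auto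
  then show ?thesis using K_diag_le_1[of f] by (subst nn_integral_eq_integral) auto
qed

text \<open>For fixed m the squared norm is a quadratic form in finitely many variables, weighted by
  the Q-masses of the cells of t m.\<close>

lemma laplace_W_t_tendsto:
  assumes l: "0 \<le> l"
  shows "(\<lambda>n. LINT \<omega>|M. exp (- (l * (LINT f|Q. (W n (t m f) \<omega>)\<^sup>2)))) \<longlonglongrightarrow>
    (LINT \<omega>|P. exp (- (l * (LINT f|Q. (U m \<omega> f)\<^sup>2))))"
proof -
  have one: "(\<lambda>_. 1) \<in> L2 Q" by (simp add: L2_def)
  define q where "q y = l * \<theta> m (\<lambda>_. 1) y" for y
  have q: "0 \<le> q y" for y unfolding q_def \<theta>_def using l by simp
  have "(LINT f|Q. (G (t m f))\<^sup>2) = (\<Sum>y\<in>range (t m). (G y)\<^sup>2 * \<theta> m (\<lambda>_. 1) y)" for G :: "'h \<Rightarrow> real"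
    using integral_t[OF one, of "\<lambda>y. (G y)\<^sup>2" m] by simp
  then have sq: "l * (LINT f|Q. (G (t m f))\<^sup>2) = (\<Sum>y\<in>range (t m). q y * (G y)\<^sup>2)" for G :: "'h \<Rightarrow> real"
    by (simp add: q_def sum_distrib_left ac_simps)
  have "(\<lambda>n. LINT \<omega>|M. exp (- (\<Sum>y\<in>range (t m). q y * (W n y \<omega>)\<^sup>2))) \<longlonglongrightarrow>
      (LINT \<omega>|P. exp (- (\<Sum>y\<in>range (t m). q y * (g y \<omega>)\<^sup>2)))"
  proof (rule laplace_quadratic_tendsto[OF prob_space_axioms P.prob_space_axioms finite_range_t _ _ q])
    fix c :: "'h \<Rightarrow> real"
    have "normal_var P (\<lambda>\<omega>. \<Sum>y\<in>range (t m). c y * g y \<omega>) (\<Sum>x\<in>range (t m). \<Sum>y\<in>range (t m). c x * c y * K x y)"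
      by (rule normal[OF finite_range_t]) auto
    then have "(LINT \<omega>|P. iexp (1 * (\<Sum>y\<in>range (t m). c y * g y \<omega>))) =
        of_real (exp (- ((\<Sum>x\<in>range (t m). \<Sum>y\<in>range (t m). c x * c y * K x y) * 1\<^sup>2) / 2))"
      unfolding normal_var_def by blast
    then show "(\<lambda>n. LINT \<omega>|M. iexp (\<Sum>y\<in>range (t m). c y * W n y \<omega>)) \<longlonglongrightarrow> (LINT \<omega>|P. iexp (\<Sum>y\<in>range (t m). c y * g y \<omega>))"
      using W_char_tendsto[OF finite_range_t[of m], of c] by (simp only: mult_1 one_power2 mult_1_right)
  qed (auto intro: W_measurable)
  moreover have "l * (LINT f|Q. (W n (t m f) \<omega>)\<^sup>2) = (\<Sum>y\<in>range (t m). q y * (W n y \<omega>)\<^sup>2)" for n \<omega>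
    by (rule sq)
  moreover have "l * (LINT f|Q. (g (t m f) \<omega>)\<^sup>2) = (\<Sum>y\<in>range (t m). q y * (g y \<omega>)\<^sup>2)" for \<omega>
    by (rule sq)
  ultimately show ?thesis unfolding U_def by (simp only:)
qed

text \<open>The parameters are chosen in the order e, m, n: e absorbs the additive term of
  \<open>laplace_L2_diff_le\<close>, m the discretisation of both processes, and n the linearisation
  error \<rho> n as well as the convergence for fixed m.\<close>

lemma laplace_Vn_tendsto:
  assumes l: "0 \<le> l"
  shows "(\<lambda>n. LINT \<omega>|M. exp (- (l * (LINT f|Q. (Vn n \<omega> f)\<^sup>2)))) \<longlonglongrightarrow>
    (LINT \<omega>|P. exp (- (l * (LINT f|Q. (V \<omega> f)\<^sup>2))))"
proof (rule LIMSEQ_I)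
  fix r :: real assume r: "0 < r"
  obtain \<rho> where \<rho>: "\<rho> \<longlonglongrightarrow> 0" "\<And>n. 0 \<le> \<rho> n"
    "\<And>n. n > 0 \<Longrightarrow> (\<integral>\<^sup>+f. \<integral>\<^sup>+\<omega>. ennreal ((Vn n \<omega> f - W n f \<omega>)\<^sup>2) \<partial>M \<partial>Q) = ennreal (\<rho> n)"
    using remainder_tendsto by blast
  \<comment> \<open>The denominator contains l + 1 rather than l because l may be 0.\<close>
  define e where "e = r / (8 * (l + 1))"
  have e: "0 < e" "l * e \<le> r / 8" using r l by (auto simp: e_def field_simps)
  define b where "b = l * (1 + 1 / e)"
  let ?T = "LINT \<omega>|P. enn2real (tot \<omega>)"
  have "(\<lambda>m. b * (2 * (1 / 16) ^ m)) \<longlonglongrightarrow> b * (2 * 0)"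
    by (intro tendsto_intros LIMSEQ_power_zero) auto
  then have ev1: "eventually (\<lambda>m. b * (2 * (1 / 16) ^ m) < r / 8) sequentially"
    using r by (intro order_tendstoD(2)) auto
  have "(\<lambda>m. b * (4 * (1 / 4) ^ m * ?T)) \<longlonglongrightarrow> b * (4 * 0 * ?T)"
    by (intro tendsto_intros LIMSEQ_power_zero) auto
  then have ev2: "eventually (\<lambda>m. b * (4 * (1 / 4) ^ m * ?T) < r / 8) sequentially"
    using r by (intro order_tendstoD(2)) auto
  obtain m where m: "b * (2 * (1 / 16) ^ m) < r / 8" "b * (4 * (1 / 4) ^ m * ?T) < r / 8"
    using eventually_conj[OF ev1 ev2] by (auto simp: eventually_sequentially)
  let ?LV = "\<lambda>n. LINT \<omega>|M. exp (- (l * (LINT f|Q. (Vn n \<omega> f)\<^sup>2)))"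
  let ?LW = "\<lambda>n. LINT \<omega>|M. exp (- (l * (LINT f|Q. (W n (t m f) \<omega>)\<^sup>2)))"
  let ?LU = "LINT \<omega>|P. exp (- (l * (LINT f|Q. (U m \<omega> f)\<^sup>2)))"
  let ?L = "LINT \<omega>|P. exp (- (l * (LINT f|Q. (V \<omega> f)\<^sup>2)))"
  have UV: "\<bar>?L - ?LU\<bar> \<le> r / 4"
  proof -
    have "\<bar>?L - ?LU\<bar> \<le> l * ((1 + 1 / e) * (4 * (1 / 4) ^ m * ?T) + e)"
    proof (rule PQ.laplace_L2_diff_le[OF _ _ V_L2 U_L2 _ _ U_norm_integrable U_norm_le e(1) l])
      show "integrable P (\<lambda>\<omega>. LINT x|Q. (V \<omega> x - U m \<omega> x)\<^sup>2)"
        using U_V_norm_integrable[of m] by (simp add: power2_commute)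
      show "(LINT \<omega>|P. LINT x|Q. (V \<omega> x - U m \<omega> x)\<^sup>2) \<le> 4 * (1 / 4) ^ m * ?T"
        using U_V_norm_le[of m] by (simp add: power2_commute)
    qed measurable
    also have "\<dots> = b * (4 * (1 / 4) ^ m * ?T) + l * e" by (simp add: b_def algebra_simps)
    finally show ?thesis using m(2) e(2) by linarith
  qed
  have VW: "\<bar>?LV n - ?LW n\<bar> \<le> b * (2 * \<rho> n) + r / 4" if n: "n > 0" for n
  proof -
    let ?d = "2 * \<rho> n + 2 * (1 / 16) ^ m"
    have d0: "0 \<le> ?d" using \<rho>(2)[of n] by simp
    have "(\<integral>\<^sup>+f. \<integral>\<^sup>+\<omega>. ennreal ((Vn n \<omega> f - W n (t m f) \<omega>)\<^sup>2) \<partial>M \<partial>Q) \<le>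
        (\<integral>\<^sup>+f. \<integral>\<^sup>+\<omega>. 2 * ennreal ((Vn n \<omega> f - W n f \<omega>)\<^sup>2) + 2 * ennreal ((W n f \<omega> - W n (t m f) \<omega>)\<^sup>2) \<partial>M \<partial>Q)"
    proof (intro nn_integral_mono)
      fix f \<omega>
      have "ennreal ((Vn n \<omega> f - W n (t m f) \<omega>)\<^sup>2) \<le>
          ennreal (2 * (Vn n \<omega> f - W n f \<omega>)\<^sup>2 + 2 * (W n f \<omega> - W n (t m f) \<omega>)\<^sup>2)"
        by (intro ennreal_leI power2_diff_le)
      then show "ennreal ((Vn n \<omega> f - W n (t m f) \<omega>)\<^sup>2) \<le>
          2 * ennreal ((Vn n \<omega> f - W n f \<omega>)\<^sup>2) + 2 * ennreal ((W n f \<omega> - W n (t m f) \<omega>)\<^sup>2)"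
        by (simp add: ennreal_mult)
    qed
    also have "\<dots> = (\<integral>\<^sup>+f. 2 * (\<integral>\<^sup>+\<omega>. ennreal ((Vn n \<omega> f - W n f \<omega>)\<^sup>2) \<partial>M) + 2 * ennreal (kdist f (t m f)) \<partial>Q)"
    proof (rule nn_integral_cong)
      fix f
      have [measurable]: "(\<lambda>\<omega>. Vn n \<omega> f) \<in> borel_measurable M"
        unfolding Vn_def by (rule V_stat_measurable) simp
      show "(\<integral>\<^sup>+\<omega>. 2 * ennreal ((Vn n \<omega> f - W n f \<omega>)\<^sup>2) + 2 * ennreal ((W n f \<omega> - W n (t m f) \<omega>)\<^sup>2) \<partial>M) =
        2 * (\<integral>\<^sup>+\<omega>. ennreal ((Vn n \<omega> f - W n f \<omega>)\<^sup>2) \<partial>M) + 2 * ennreal (kdist f (t m f))"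
        by (simp add: nn_integral_add nn_integral_cmult W_diff_moment[OF n])
    qed
    also have "\<dots> = 2 * (\<integral>\<^sup>+f. \<integral>\<^sup>+\<omega>. ennreal ((Vn n \<omega> f - W n f \<omega>)\<^sup>2) \<partial>M \<partial>Q) + 2 * (\<integral>\<^sup>+f. ennreal (kdist f (t m f)) \<partial>Q)"
    proof -
      have [measurable]: "(\<lambda>f. \<integral>\<^sup>+\<omega>. ennreal ((Vn n \<omega> f - W n f \<omega>)\<^sup>2) \<partial>M) \<in> borel_measurable Q"
      proof (rule borel_measurable_nn_integral)
        have "(\<lambda>z. (\<lambda>(\<omega>, f). ennreal ((Vn n \<omega> f - W n f \<omega>)\<^sup>2)) (snd z, fst z)) \<in> borel_measurable (Q \<Otimes>\<^sub>M M)"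
          by (rule measurable_compose[of _ _ "M \<Otimes>\<^sub>M Q"]) measurable
        then show "(\<lambda>(f, \<omega>). ennreal ((Vn n \<omega> f - W n f \<omega>)\<^sup>2)) \<in> borel_measurable (Q \<Otimes>\<^sub>M M)" by (simp add: split_beta')
      qed
      have [measurable]: "(\<lambda>f. kdist f (t m f)) \<in> borel_measurable Q"
        by (rule borel_measurable_integrable[OF kdist_t_integrable])
      show ?thesis by (simp add: nn_integral_add nn_integral_cmult)
    qed
    also have "(\<integral>\<^sup>+f. ennreal (kdist f (t m f)) \<partial>Q) = ennreal (LINT f|Q. kdist f (t m f))"
      using kdist_nonneg by (intro nn_integral_eq_integral kdist_t_integrable) auto
    also have "2 * (\<integral>\<^sup>+f. \<integral>\<^sup>+\<omega>. ennreal ((Vn n \<omega> f - W n f \<omega>)\<^sup>2) \<partial>M \<partial>Q) + 2 * ennreal (LINT f|Q. kdist f (t m f)) =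
        ennreal (2 * \<rho> n + 2 * (LINT f|Q. kdist f (t m f)))"
      unfolding \<rho>(3)[OF n] using \<rho>(2)[of n] kdist_nonneg by (simp add: ennreal_mult)
    also have "\<dots> \<le> ennreal ?d"
      using fast[of m] by (intro ennreal_leI) linarith
    finally have nn: "(\<integral>\<^sup>+f. \<integral>\<^sup>+\<omega>. ennreal ((Vn n \<omega> f - W n (t m f) \<omega>)\<^sup>2) \<partial>M \<partial>Q) \<le> ennreal ?d" .
    have iD: "integrable Q (\<lambda>f. (Vn n \<omega> f - W n (t m f) \<omega>)\<^sup>2)" if "\<omega> \<in> space M" for \<omega>
      using L2_diff[OF Vn_L2[OF that, of n] W_t_L2[OF that, of n m]] by (simp add: L2_def)
    have iW: "integrable Q (\<lambda>f. (W n (t m f) \<omega>)\<^sup>2)" if "\<omega> \<in> space M" for \<omega>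
      using W_t_L2[OF that, of n m] by (simp add: L2_def)
    have mD: "(\<lambda>(\<omega>, f). (Vn n \<omega> f - W n (t m f) \<omega>)\<^sup>2) \<in> borel_measurable (M \<Otimes>\<^sub>M Q)" by measurable
    have mW: "(\<lambda>(\<omega>, f). (W n (t m f) \<omega>)\<^sup>2) \<in> borel_measurable (M \<Otimes>\<^sub>M Q)" by measurable
    have nnW: "(\<integral>\<^sup>+f. \<integral>\<^sup>+\<omega>. ennreal ((W n (t m f) \<omega>)\<^sup>2) \<partial>M \<partial>Q) \<le> ennreal 1"
    proof -
      have "(\<integral>\<^sup>+f. \<integral>\<^sup>+\<omega>. ennreal ((W n (t m f) \<omega>)\<^sup>2) \<partial>M \<partial>Q) \<le> (\<integral>\<^sup>+f. 1 \<partial>Q)"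
        by (intro nn_integral_mono W_moment[OF n])
      then show ?thesis using Q.emeasure_space_1 by simp
    qed
    have "\<bar>?LV n - ?LW n\<bar> \<le> l * ((1 + 1 / e) * ?d + e)"
      by (rule MQ.laplace_L2_diff_le[OF Vn_measurable_pair W_t_measurable_pair Vn_L2 W_t_L2
          MQ.double_integral_le[OF mD _ iD nn d0] MQ.double_integral_le[OF mW _ iW nnW] e(1) l]) auto
    also have "\<dots> = b * (2 * \<rho> n) + b * (2 * (1 / 16) ^ m) + l * e" by (simp add: b_def algebra_simps)
    finally show ?thesis using m(1) e(2) by linarith
  qed
  have "(\<lambda>n. b * (2 * \<rho> n)) \<longlonglongrightarrow> b * (2 * 0)" by (intro tendsto_intros \<rho>(1))
  then have ev3: "eventually (\<lambda>n. b * (2 * \<rho> n) < r / 8) sequentially"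
    using r by (intro order_tendstoD(2)) auto
  have ev4: "eventually (\<lambda>n. \<bar>?LW n - ?LU\<bar> < r / 8) sequentially"
    using tendstoD[OF laplace_W_t_tendsto[OF l, of m], of "r / 8"] r by (simp add: dist_real_def)
  \<comment> \<open>The three distances are below r / 8 + r / 4, r / 8 and at most r / 4, which sum
    to less than r.\<close>
  have "eventually (\<lambda>n. norm (?LV n - ?L) < r) sequentially"
    using ev3 ev4 eventually_gt_at_top[of 0]
  proof eventually_elim
    case (elim n)
    then show ?case using VW[of n] UV r unfolding real_norm_def by linarith
  qed
  then show "\<exists>n0. \<forall>n\<ge>n0. norm (?LV n - ?L) < r" by (simp add: eventually_sequentially)
qed

lemma weak_conv_Vn:
  "weak_conv_m (\<lambda>n. distr M borel (\<lambda>\<omega>. LINT f|Q. (Vn n \<omega> f)\<^sup>2)) (distr P borel (\<lambda>\<omega>. (norm_L2 Q (V \<omega>))\<^sup>2))"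
  unfolding power2_norm_L2
proof (rule weak_conv_m_if_laplace[OF prob_space_axioms P.prob_space_axioms])
  show "(\<lambda>n. LINT \<omega>|M. exp (- (real k * (LINT f|Q. (Vn n \<omega> f)\<^sup>2)))) \<longlonglongrightarrow>
      (LINT \<omega>|P. exp (- (real k * (LINT f|Q. (V \<omega> f)\<^sup>2))))" for k :: nat
    by (rule laplace_Vn_tendsto) simp
  show "(\<lambda>\<omega>. LINT f|Q. (Vn n \<omega> f)\<^sup>2) \<in> borel_measurable M" for n by measurable
  show "(\<lambda>\<omega>. LINT f|Q. (V \<omega> f)\<^sup>2) \<in> borel_measurable P" by measurable
qed simp_all

end

section \<open>The test statistic as a squared norm\<close>

lemma rep_l2unit_L2: "rep_l2unit x \<in> L2 unit_interval_measure"
  using Quotient3_rep_reflp[OF Quotient3_l2unit, of x] by auto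

lemma abs_rep_l2unit: "abs_l2unit (rep_l2unit x) = x"
  by (rule Quotient3_abs_rep[OF Quotient3_l2unit])

lemma inner_abs_l2unit:
  assumes "F \<in> L2 unit_interval_measure"
  shows "inner (abs_l2unit F) f = inner_L2 unit_interval_measure F (rep_l2unit f)"
  using inner_l2unit.abs_eq[of F "rep_l2unit f"] assms rep_l2unit_L2[of f] by (simp add: abs_rep_l2unit)

lemma inner_rep_l2unit: "inner x f = inner_L2 unit_interval_measure (rep_l2unit x) (rep_l2unit f)"
  using inner_abs_l2unit[OF rep_l2unit_L2[of x], of f] by (simp add: abs_rep_l2unit)

text \<open>The operator has finite rank: with m the sample mean it sends f to the average of
  \<langle>x_j - m, f\<rangle> (x_j - m). The difference of the representatives of x_j and m
  represents x_j - m without having to be the chosen representative, and inner products depend on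
  the class only.\<close>

lemma inner_sample_cov:
  "inner (sample_cov n x f) f = (\<Sum>j<n. (inner (x j - sample_mean n x) f)\<^sup>2) / real n"
proof -
  let ?U = unit_interval_measure
  let ?c = "\<lambda>j s. rep_l2unit (x j) s - rep_l2unit (sample_mean n x) s"
  have c: "?c j \<in> L2 ?U" for j by (intro L2_diff rep_l2unit_L2)
  have ic: "integrable ?U (\<lambda>t. ?c j t * rep_l2unit f t)" for j
    by (rule L2_mult_integrable[OF c rep_l2unit_L2])
  define b where "b j = inner (x j - sample_mean n x) f" for j
  have b: "(LINT t|?U. ?c j t * rep_l2unit f t) = b j" for j
  proof -
    have "b j = inner (x j) f - inner (sample_mean n x) f" by (simp add: b_def inner_diff_left)
    then show ?thesis
      using L2_mult_integrable[OF rep_l2unit_L2 rep_l2unit_L2, of "x j" f]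
        L2_mult_integrable[OF rep_l2unit_L2 rep_l2unit_L2, of "sample_mean n x" f]
      unfolding inner_rep_l2unit inner_L2_def left_diff_distrib by simp
  qed
  define F where "F s = (\<Sum>j<n. (b j / real n) * ?c j s)" for s
  have Fm: "F \<in> L2 ?U"
  proof -
    have "(\<lambda>s. \<Sum>j<m. (b j / real n) * ?c j s) \<in> L2 ?U" for m
    proof (induction m)
      case (Suc m)
      show ?case using L2_add[OF Suc L2_scale[OF c[of m], of "b m / real n"]] by simp
    qed (simp add: L2_zero)
    then show ?thesis unfolding F_def by blast
  qed
  \<comment> \<open>The identity holds for every s, as the representatives are fixed before
    integrating.\<close>
  have "(LINT t|?U. sample_cov_kernel n x s t * rep_l2unit f t) = F s" for s
  proof -
    have "(LINT t|?U. sample_cov_kernel n x s t * rep_l2unit f t) =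
        (LINT t|?U. (\<Sum>j<n. (?c j s / real n) * (?c j t * rep_l2unit f t)))"
      by (intro Bochner_Integration.integral_cong refl)
         (simp add: sample_cov_kernel_def sum_divide_distrib sum_distrib_left sum_distrib_right ac_simps)
    also have "\<dots> = F s"
      using ic by (simp only: Bochner_Integration.integral_sum integrable_mult_right integral_mult_right_zero b)
        (simp add: F_def ac_simps)
    finally show ?thesis .
  qed
  then have "inner (sample_cov n x f) f = inner_L2 ?U F (rep_l2unit f)"
    unfolding sample_cov_def by (simp add: inner_abs_l2unit[OF Fm])
  also have "\<dots> = (LINT t|?U. (\<Sum>j<n. (b j / real n) * (?c j t * rep_l2unit f t)))"
    unfolding inner_L2_def F_def by (simp add: sum_distrib_right mult.assoc)
  also have "\<dots> = (\<Sum>j<n. b j / real n * b j)"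
    using ic by (simp only: Bochner_Integration.integral_sum integrable_mult_right integral_mult_right_zero b)
  finally show ?thesis by (simp add: b_def power2_eq_square sum_divide_distrib)
qed

text \<open>The vector \<mu> is arbitrary because \<open>V_stat\<close> subtracts the mean of its
  arguments. It is later the true mean, which makes the inner products centred normal
  variables.\<close>

lemma T_stat_eq:
  fixes Q :: "l2unit measure"
  assumes Q: "prob_space Q" and sets_Q [measurable_cong]: "sets Q = sets borel" and sym: "distr Q borel uminus = Q"
  shows "real n * T_stat Q n x = (LINT f|Q. (V_stat n (\<lambda>j. inner (x j - \<mu>) f))\<^sup>2)"
proof (cases "n = 0")
  case True
  then show ?thesis by (simp add: V_stat_def)
next
  case False
  then have n: "0 < real n" by simp
  interpret Q: prob_space Q by (rule Q)
  have [measurable]: "(\<lambda>f. f) \<in> measurable Q borel" by (simp cong: measurable_cong_sets add: sets_Q)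
  define m where "m = sample_mean n x"
  define y where "y f j = inner (x j - m) f" for f j
  define u where "u f = (\<Sum>j<n. (y f j)\<^sup>2) / real n" for f
  define A where "A f = (\<Sum>j<n. cos (y f j)) / real n - exp (- u f / 2)" for f
  define B where "B f = (\<Sum>j<n. sin (y f j)) / real n" for f
  have [measurable]: "A \<in> borel_measurable Q" "B \<in> borel_measurable Q"
    unfolding A_def B_def u_def y_def by measurable
  have mean: "(\<Sum>j<n. inner (x j - \<mu>) f) / real n = inner (m - \<mu>) f" for f
    using n unfolding m_def sample_mean_def
    by (simp add: inner_diff_left sum_subtractf inner_sum_left diff_divide_distrib)
  have V: "(V_stat n (\<lambda>j. inner (x j - \<mu>) f))\<^sup>2 = real n * (A f + B f)\<^sup>2" for f
  proof -
    have "inner (x j - \<mu>) f - inner (m - \<mu>) f = y f j" for j by (simp add: y_def inner_diff_left)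
    then have "V_stat n (\<lambda>j. inner (x j - \<mu>) f) = sqrt (real n) * (A f + B f)"
      unfolding V_stat_def Let_def mean by (simp add: A_def B_def u_def sum.distrib add_divide_distrib)
    then show ?thesis by (simp add: power_mult_distrib)
  qed
  have T: "(cmod (emp_char n x f - gauss_char (sample_mean n x) (sample_cov n x) f))\<^sup>2 = (A f)\<^sup>2 + (B f)\<^sup>2" for f
  proof -
    have e: "emp_char n x f = iexp (inner m f) * ((\<Sum>j<n. iexp (y f j)) / of_nat n)"
    proof -
      have "iexp (inner f (x j)) = iexp (inner m f) * iexp (y f j)" for j
        by (simp add: y_def inner_diff_left inner_commute[of f] exp_add[symmetric] algebra_simps)
      then show ?thesis by (simp add: emp_char_def sum_distrib_left[symmetric])
    qed
    have g: "gauss_char (sample_mean n x) (sample_cov n x) f = iexp (inner m f) * of_real (exp (- u f / 2))"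
      unfolding gauss_char_def inner_sample_cov exp_of_real[symmetric] exp_add[symmetric]
      by (simp add: m_def u_def y_def)
    have "emp_char n x f - gauss_char (sample_mean n x) (sample_cov n x) f =
        iexp (inner m f) * ((\<Sum>j<n. iexp (y f j)) / of_nat n - of_real (exp (- u f / 2)))"
      unfolding e g by (simp only: right_diff_distrib)
    also have "(\<Sum>j<n. iexp (y f j)) / of_nat n - of_real (exp (- u f / 2)) = Complex (A f) (B f)"
      by (rule complex_eqI) (simp_all add: A_def B_def cis_conv_exp[symmetric])
    finally show ?thesis by (simp add: norm_mult cmod_power2)
  qed
  have trig: "\<bar>(\<Sum>j<n. h (y f j)) / real n\<bar> \<le> 1" if "\<And>t. \<bar>h t\<bar> \<le> 1" for h :: "real \<Rightarrow> real" and f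
  proof -
    have "\<bar>\<Sum>j<n. h (y f j)\<bar> \<le> (\<Sum>j<n. 1)"
      by (intro order.trans[OF sum_abs] sum_mono that)
    then show ?thesis using n by (simp add: field_simps)
  qed
  have Ab: "\<bar>A f\<bar> \<le> 2" for f
  proof -
    have "0 \<le> u f" by (simp add: u_def sum_nonneg)
    then have "exp (- u f / 2) \<le> 1" "0 < exp (- u f / 2)" by auto
    moreover have "\<bar>(\<Sum>j<n. cos (y f j)) / real n\<bar> \<le> 1" by (rule trig) simp
    ultimately show ?thesis unfolding A_def by linarith
  qed
  have Bb: "\<bar>B f\<bar> \<le> 1" for f unfolding B_def by (rule trig) simp
  have iAB: "integrable Q (\<lambda>f. A f * B f)"
    using mult_mono[OF Ab Bb] by (intro Q.integrable_const_bound[where B = "2 * 1"]) (auto simp: abs_mult)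
  have iA: "integrable Q (\<lambda>f. (A f)\<^sup>2)"
    using power_mono[OF Ab abs_ge_zero, of _ 2] by (intro Q.integrable_const_bound[where B = "2\<^sup>2"]) auto
  have iB: "integrable Q (\<lambda>f. (B f)\<^sup>2)"
    using power_mono[OF Bb abs_ge_zero, of _ 2] by (intro Q.integrable_const_bound[where B = "1\<^sup>2"]) auto
  have zero: "(LINT f|Q. A f * B f) = 0"
  proof -
    have odd: "A (- f) * B (- f) = - (A f * B f)" for f
      by (simp add: A_def B_def u_def y_def sum_negf)
    have "(LINT f|Q. A f * B f) = (LINT f|distr Q borel uminus. A f * B f)" by (simp only: sym)
    also have "\<dots> = (LINT f|Q. A (- f) * B (- f))"
    proof (rule integral_distr)
      show "uminus \<in> measurable Q borel" by measurable
      show "(\<lambda>f. A f * B f) \<in> borel_measurable borel"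
        unfolding A_def B_def u_def y_def by measurable
    qed
    also have "\<dots> = - (LINT f|Q. A f * B f)" unfolding odd by simp
    finally show ?thesis by simp
  qed
  have "(LINT f|Q. (V_stat n (\<lambda>j. inner (x j - \<mu>) f))\<^sup>2) = real n * (LINT f|Q. (A f)\<^sup>2 + (B f)\<^sup>2 + 2 * (A f * B f))"
    unfolding V by (simp add: power2_sum mult.assoc)
  also have "\<dots> = real n * (LINT f|Q. (A f)\<^sup>2 + (B f)\<^sup>2)"
    using iA iB iAB zero by simp
  also have "\<dots> = real n * T_stat Q n x"
    unfolding T_stat_def T ..
  finally show ?thesis ..
qed

text \<open>The theorem prescribes functions on \<^typ>\<open>l2unit\<close> as sample points. The product of standard normal
  distributions over all of \<^typ>\<open>l2unit\<close> is such a space, and an injective sequence of indices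
  selects the countably many coordinates that the construction needs.\<close>

lemma inj_multiples: "inj (\<lambda>n. real n *\<^sub>R abs_l2unit (indicator UNIV))"
proof -
  have "norm (abs_l2unit (indicator UNIV)) = sqrt (LINT t|unit_interval_measure. 1)"
    using indicator_L2[of UNIV] by (simp add: norm_abs_l2unit norm_L2_def inner_L2_def)
  then have "abs_l2unit (indicator UNIV) \<noteq> 0"
    by (auto simp: measure_restrict_space)
  then show ?thesis by (simp add: inj_on_def)
qed

theorem theorem5p1:
  fixes Q :: "l2unit measure"
    and M :: "'w measure" and X :: "nat \<Rightarrow> 'w \<Rightarrow> l2unit"
    and M\<^sub>0 :: "'v measure" and X\<^sub>0 :: "'v \<Rightarrow> l2unit"
    and \<mu> :: l2unit and C :: "l2unit \<Rightarrow> l2unit"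
  assumes "prob_space Q" and "sets Q = sets borel"
    and "distr Q borel uminus = Q"
    and "prob_space M\<^sub>0" and "gaussian_element M\<^sub>0 X\<^sub>0 \<mu> C"
    and "prob_space M" and "prob_space.indep_vars M (\<lambda>_. borel) X UNIV"
    and "\<And>j. distr M borel (X j) = distr M\<^sub>0 borel X\<^sub>0"
    and "integrable Q (\<lambda>f. norm f ^ 4)"
  shows "\<exists>(N :: (l2unit \<Rightarrow> real) measure) V.
    prob_space N \<and> centred_gaussian_L2 Q N V \<and> has_cov_kernel Q N V (limit_kernel C) \<and>
    weak_conv_m (\<lambda>n. distr M borel (\<lambda>\<omega>. real n * T_stat Q n (\<lambda>j. X j \<omega>)))
      (distr N borel (\<lambda>\<omega>. (norm_L2 Q (V \<omega>))\<^sup>2))"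
proof -
  interpret M: prob_space M by fact
  interpret Q: prob_space Q by fact
  have C: "pos_sym_trace_class C" and X0 [measurable]: "X\<^sub>0 \<in> borel_measurable M\<^sub>0"
    and ch: "\<And>f. (LINT \<omega>|M\<^sub>0. iexp (inner (X\<^sub>0 \<omega>) f)) = gauss_char \<mu> C f"
    using assms(5) by (auto simp: gaussian_element_def)
  have [measurable]: "X j \<in> borel_measurable M" for j
    using assms(7) by (simp add: M.indep_vars_def)
  \<comment> \<open>The Gaussian law is given for \<open>X\<^sub>0\<close> on a space of its own and
    is carried to each X j by equality of distributions.\<close>
  have Xch: "(LINT \<omega>|M. iexp (inner (X j \<omega>) f)) = gauss_char \<mu> C f" for j f
  proof -
    have "(LINT \<omega>|M. iexp (inner (X j \<omega>) f)) = (LINT x|distr M borel (X j). iexp (inner x f))"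
      by (rule integral_distr[symmetric]) measurable
    also have "\<dots> = (LINT \<omega>|M\<^sub>0. iexp (inner (X\<^sub>0 \<omega>) f))"
      unfolding assms(8) by (rule integral_distr) measurable
    finally show ?thesis using ch by simp
  qed
  interpret test_setting M X \<mu> C Q
  proof (intro test_setting.intro gaussian_sample.intro gaussian_sample_axioms.intro test_setting_axioms.intro)
    show "distr M borel (X j) = distr M borel (X 0)" for j by (simp only: assms(8))
  qed (use assms C Xch in \<open>auto simp: pos_sym_trace_class_def\<close>)
  obtain t g where "gaussian_approx Q (limit_kernel C) (\<Pi>\<^sub>M i\<in>(UNIV::l2unit set). std_normal_distribution) t g"
    using gaussian_approx_exists[OF inj_multiples] by blast
  then interpret gaussian_approx Q "limit_kernel C" "\<Pi>\<^sub>M i\<in>(UNIV::l2unit set). std_normal_distribution" t g .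
  interpret test_limit M X \<mu> C Q "\<Pi>\<^sub>M i\<in>(UNIV::l2unit set). std_normal_distribution" t g ..
  have "real n * T_stat Q n (\<lambda>j. X j \<omega>) = (LINT f|Q. (Vn n \<omega> f)\<^sup>2)" for n \<omega>
    unfolding T_stat_eq[OF assms(1-3), of n _ \<mu>] by (simp add: Vn_def z_def)
  then show ?thesis
    using P.prob_space_axioms centred_gaussian_V has_cov_kernel_V weak_conv_Vn by auto
qed

end
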